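(* Let $c,d\geq 1$ be integers with $\gcd(c,d)=1$ and let $\mathcal{N}_{c/d}$ be the space of null geodesics of $\left(\mathbb{S}^2\times\mathbb{S}^1,\ g_\circ-\frac{d^2}{c^2}dt^2\right)$. If $c=1$, the canonical contact structure $\mathcal{H}$ on $ST\mathbb{S}^2\cong\mathcal{N}_{1/d}$ is the canonical contact structure $\chi$ on $ST\mathbb{S}^2$. If $c>1$, the canonical contact structure $\mathcal{H}$ on $L(2c,1)\cong\mathcal{N}_{c/d}$ is $r_*\chi$, where $r:ST\mathbb{S}^2\to L(2c,1)$ is the projection.
   Context: All manifolds are smooth. A spacetime is a time-oriented connected Lorentzian manifold $(M,g)$ of dimension $\geq 3$. Let $C^+\subset TM$ be the bundle of future-pointing null vectors. The space of null geodesics is $\mathcal{N}=\{\gamma(I) \mid \gamma:I\to M \text{ a maximal geodesic with } \dot\gamma\subset C^+\}$, identified with the leaf space $C^+/\langle X_g,\Delta\rangle$, where $X_g$ is the geodesic spray and $\Delta$ the Euler vector field on $TM$, with the quotient smooth structure. The sky of $x\in M$ is $\mathfrak{S}_x=\{\gamma\in\mathcal{N}\mid x\in\gamma\}$. When $\mathcal{N}$ is a manifold, its canonical contact structure $\mathcal{H}$ is the codimension-one distribution given at $\gamma\in\mathcal{N}$ by $\mathcal{H}_\gamma=T_\gamma\mathfrak{S}_x\oplus T_\gamma\mathfrak{S}_y$, where $x,y\in\gamma$ are points that cannot be joined by a one-parameter family of geodesics; this does not depend on the choice of $x,y$. Here $g_\circ$ is the round metric on the unit sphere $\mathbb{S}^2$,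 $t$ is the angle coordinate (period $2\pi$) on $\mathbb{S}^1$, and the time-orientation is given by $\partial_t$. $ST\mathbb{S}^2$ is the unit tangent bundle, $\pi:ST\mathbb{S}^2\to\mathbb{S}^2$ the projection; it is identified with pairs $(x,u)\in\mathbb{S}^2\times\mathbb{S}^2\subset \mathbb{R}^3\times\mathbb{R}^3$ with $\langle x,u\rangle=0$. Its canonical contact structure is $\chi_u=(T_u\pi)^{-1}(\langle u\rangle^\perp)$, where $\langle u\rangle^\perp$ is the $g_\circ$-orthogonal of $u$ in $T_{\pi(u)}\mathbb{S}^2$. Identifications. Each $(x,u)\in ST\mathbb{S}^2$ determines the null geodesic $s\mapsto(\mu(s),\frac{c}{d}s)$, where $\mu$ is the unit-speed great circle with $\mu(0)=x$, $\dot\mu(0)=u$. For $c=1$ this gives $\mathcal{N}_{1/d}\cong ST\mathbb{S}^2$; for $c>1$ it gives $\mathcal{N}_{c/d}\cong ST\mathbb{S}^2/\mathbb{Z}_c$, where $\mathbb{Z}_c$ acts by the maps $(x,u)\mapsto(\cos\frac{2\pi j}{c}\,x+\sin\frac{2\pi j}{c}\,u,\ -\sin\frac{2\pi j}{c}\,x+\cos\frac{2\pi j}{c}\,u)$, $j\in\mathbb{Z}$. The lens space $L(p,1)$ is the quotient of $\mathbb{S}^3\subset\mathbb{C}^2$ by the $\mathbb{Z}_p$-action generated by $(z_0,z_1)\mapsto(e^{2\pi i/p}z_0,e^{2\pi i/p}z_1)$. Identify $\mathbb{C}^2$ with the quaternions $\mathbb{H}$ by $(z_0,z_1)\mapsto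 z_0+z_1j$, and $\mathbb{R}^3$ with the imaginary quaternions. The map $q\mapsto(q^{-1}kq,q^{-1}jq)$ from unit quaternions to $ST\mathbb{S}^2$ induces diffeomorphisms $L(2,1)\cong ST\mathbb{S}^2$ and $L(2c,1)\cong ST\mathbb{S}^2/\mathbb{Z}_c$ for $c>1$; $r$ is the resulting quotient projection $ST\mathbb{S}^2\to ST\mathbb{S}^2/\mathbb{Z}_c\cong L(2c,1)$. *)

theory Defs
  imports "HOL-Analysis.Analysis"
begin

section \<open>Smooth maps between subsets of Euclidean spaces\<close>

primrec Ck_on :: "nat \<Rightarrow> 'a::euclidean_space set \<Rightarrow> ('a \<Rightarrow> 'b::real_normed_vector) \<Rightarrow> bool" where
  "Ck_on 0 U f \<longleftrightarrow> continuous_on U f"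
| "Ck_on (Suc k) U f \<longleftrightarrow> (\<forall>x\<in>U. f differentiable (at x)) \<and>
     (\<forall>v. Ck_on k U (\<lambda>x. frechet_derivative f (at x) v))"

text \<open>Smoothness on an arbitrary subset: local existence of smooth extensions to open sets.
  For open \<open>S\<close> this is ordinary smoothness.\<close>

definition smooth_on :: "'a::euclidean_space set \<Rightarrow> ('a \<Rightarrow> 'b::real_normed_vector) \<Rightarrow> bool" where
  "smooth_on S f \<longleftrightarrow> (\<forall>x\<in>S. \<exists>U F. open U \<and> x \<in> U \<and> (\<forall>k. Ck_on k U F) \<and> (\<forall>y\<in>S \<inter> U. F y = f y))"

text \<open>All diffeomorphisms from open subsets of the coordinate space \<open>'m\<close> onto relatively open
  subsets of \<open>M\<close>.\<close>

definition local_params :: "'a::euclidean_space set \<Rightarrow> ('m::euclidean_space set \<times> ('m \<Rightarrow> 'a)) set" where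
  "local_params M = {(U, \<phi>). open U \<and> smooth_on U \<phi> \<and> inj_on \<phi> U \<and>
     openin (top_of_set M) (\<phi> ` U) \<and> smooth_on (\<phi> ` U) (the_inv_into U \<phi>)}"

definition tangent_vectors :: "'a::euclidean_space set \<Rightarrow> 'a \<Rightarrow> 'a set" where
  "tangent_vectors M p =
     {vector_derivative \<alpha> (at 0) | \<alpha>. smooth_on UNIV \<alpha> \<and> range \<alpha> \<subseteq> M \<and> \<alpha> (0::real) = p}"


section \<open>Manifolds through their smooth functions\<close>

text \<open>A manifold \<open>X\<close> is represented by its points and the algebra \<open>C\<^sup>\<infinity>(X)\<close>; only the values on
  \<open>pts X\<close> of a function matter. This makes quotient manifolds direct: the smooth functions on the
  target of a surjective submersion \<open>q\<close> are those \<open>f\<close> for which \<open>f \<circ> q\<close> is smooth.\<close>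

record 'p smooth_space =
  pts :: "'p set"
  funs :: "('p \<Rightarrow> real) set"

definition embedded :: "'a::euclidean_space set \<Rightarrow> 'a smooth_space" where
  "embedded M = \<lparr>pts = M, funs = {f. smooth_on M f}\<rparr>"

definition quotient_space :: "'p smooth_space \<Rightarrow> ('p \<Rightarrow> 'q) \<Rightarrow> 'q smooth_space" where
  "quotient_space X q = \<lparr>pts = q ` pts X, funs = {f. f \<circ> q \<in> funs X}\<rparr>"

definition diffeo :: "'p smooth_space \<Rightarrow> 'q smooth_space \<Rightarrow> ('p \<Rightarrow> 'q) \<Rightarrow> bool" where
  "diffeo X Z \<Phi> \<longleftrightarrow> bij_betw \<Phi> (pts X) (pts Z) \<and> (\<forall>f. f \<in> funs Z \<longleftrightarrow> f \<circ> \<Phi> \<in> funs X)"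

definition smooth_curve :: "'p smooth_space \<Rightarrow> (real \<Rightarrow> 'p) \<Rightarrow> bool" where
  "smooth_curve X \<alpha> \<longleftrightarrow> range \<alpha> \<subseteq> pts X \<and> (\<forall>f\<in>funs X. smooth_on UNIV (f \<circ> \<alpha>))"

text \<open>Tangent vectors are derivations of \<open>C\<^sup>\<infinity>(X)\<close>, extended by zero to all other functions
  so that equality of tangent vectors is equality of functionals.\<close>

type_synonym 'p tvec = "('p \<Rightarrow> real) \<Rightarrow> real"

definition velocity :: "'p smooth_space \<Rightarrow> (real \<Rightarrow> 'p) \<Rightarrow> 'p tvec" where
  "velocity X \<alpha> = (\<lambda>f. if f \<in> funs X then deriv (f \<circ> \<alpha>) 0 else 0)"

text \<open>The tangent space at \<open>p\<close> of a submanifold \<open>Y\<close> of \<open>X\<close>, as a subspace of that of \<open>X\<close>.\<close>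

definition tangent_space :: "'p smooth_space \<Rightarrow> 'p set \<Rightarrow> 'p \<Rightarrow> 'p tvec set" where
  "tangent_space X Y p = {velocity X \<alpha> | \<alpha>. smooth_curve X \<alpha> \<and> range \<alpha> \<subseteq> Y \<and> \<alpha> 0 = p}"

text \<open>The differential of a smooth map \<open>\<Phi>\<close> into \<open>Z\<close>.\<close>

definition differential :: "'q smooth_space \<Rightarrow> ('p \<Rightarrow> 'q) \<Rightarrow> 'p tvec \<Rightarrow> 'q tvec" where
  "differential Z \<Phi> D = (\<lambda>f. if f \<in> funs Z then D (f \<circ> \<Phi>) else 0)"

definition pullback_distribution ::
  "'p smooth_space \<Rightarrow> 'q smooth_space \<Rightarrow> ('p \<Rightarrow> 'q) \<Rightarrow> ('q \<Rightarrow> 'q tvec set) \<Rightarrow> 'p \<Rightarrow> 'p tvec set" where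
  "pullback_distribution X Z \<Phi> H p =
     {D \<in> tangent_space X (pts X) p. differential Z \<Phi> D \<in> H (\<Phi> p)}"

text \<open>The value at \<open>z\<close> is meaningful only if \<open>z\<close> has a preimage and all preimages give the same
  image.\<close>

definition pushforward_distribution ::
  "'p smooth_space \<Rightarrow> 'q smooth_space \<Rightarrow> ('p \<Rightarrow> 'q) \<Rightarrow> ('p \<Rightarrow> 'p tvec set) \<Rightarrow> 'q \<Rightarrow> 'q tvec set" where
  "pushforward_distribution X Z \<Phi> xi z =
     (THE E. \<exists>p\<in>pts X. \<Phi> p = z \<and> E = differential Z \<Phi> ` xi p)"

definition direct_sum :: "'p tvec set \<Rightarrow> 'p tvec set \<Rightarrow> 'p tvec set \<Rightarrow> bool" where
  "direct_sum D A B \<longleftrightarrow> A \<inter> B = {\<lambda>_. 0} \<and> D = {\<lambda>f. a f + b f | a b. a \<in> A \<and> b \<in> B}"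


section \<open>Spacetimes and null geodesics\<close>

text \<open>\<open>metric p\<close> is relevant on vectors tangent at \<open>p\<close> only, with signature \<open>(+,\<dots>,+,-)\<close>;
  \<open>future\<close> is a timelike vector field giving the time-orientation.\<close>

record ('a, 'm) spacetime =
  points :: "'a set"
  charts :: "('m set \<times> ('m \<Rightarrow> 'a)) set"
  metric :: "'a \<Rightarrow> 'a \<Rightarrow> 'a \<Rightarrow> real"
  future :: "'a \<Rightarrow> 'a"

definition metric_coeff ::
  "('a::euclidean_space, 'm::euclidean_space) spacetime \<Rightarrow> ('m \<Rightarrow> 'a) \<Rightarrow> 'm \<Rightarrow> 'm \<Rightarrow> 'm \<Rightarrow> real" where
  "metric_coeff S \<phi> i j u =
     metric S (\<phi> u) (frechet_derivative \<phi> (at u) i) (frechet_derivative \<phi> (at u) j)"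

text \<open>Christoffel symbols of the first kind: \<open>g (\<nabla>\<^sub>i \<partial>\<^sub>j) \<partial>\<^sub>k\<close>.\<close>

definition christoffel ::
  "('a::euclidean_space, 'm::euclidean_space) spacetime \<Rightarrow> ('m \<Rightarrow> 'a) \<Rightarrow> 'm \<Rightarrow> 'm \<Rightarrow> 'm \<Rightarrow> 'm \<Rightarrow> real" where
  "christoffel S \<phi> i j k u =
     (frechet_derivative (metric_coeff S \<phi> j k) (at u) i
      + frechet_derivative (metric_coeff S \<phi> i k) (at u) j
      - frechet_derivative (metric_coeff S \<phi> i j) (at u) k) / 2"

text \<open>The geodesic equation in all charts, in the form \<open>g (\<nabla>\<^sub>\<gamma>\<^sub>' \<gamma>') \<partial>\<^sub>k = 0\<close> for all \<open>k\<close>.\<close>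

definition is_geodesic ::
  "('a::euclidean_space, 'm::euclidean_space) spacetime \<Rightarrow> real set \<Rightarrow> (real \<Rightarrow> 'a) \<Rightarrow> bool" where
  "is_geodesic S I \<gamma> \<longleftrightarrow> open I \<and> is_interval I \<and> I \<noteq> {} \<and> smooth_on I \<gamma> \<and> \<gamma> ` I \<subseteq> points S \<and>
     (\<forall>(U, \<phi>)\<in>charts S. \<forall>s\<in>I. \<gamma> s \<in> \<phi> ` U \<longrightarrow>
        (let x = the_inv_into U \<phi> \<circ> \<gamma>;
             x' = (\<lambda>s. vector_derivative x (at s));
             x'' = (\<lambda>s. vector_derivative x' (at s))
         in \<forall>k\<in>Basis.
              (\<Sum>j\<in>Basis. metric_coeff S \<phi> j k (x s) * (x'' s \<bullet> j))
            + (\<Sum>i\<in>Basis. \<Sum>j\<in>Basis. christoffel S \<phi> i j k (x s) * (x' s \<bullet> i) * (x' s \<bullet> j)) = 0))"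

definition maximal_geodesic ::
  "('a::euclidean_space, 'm::euclidean_space) spacetime \<Rightarrow> real set \<Rightarrow> (real \<Rightarrow> 'a) \<Rightarrow> bool" where
  "maximal_geodesic S I \<gamma> \<longleftrightarrow> is_geodesic S I \<gamma> \<and>
     (\<forall>J \<delta>. is_geodesic S J \<delta> \<and> I \<subseteq> J \<and> (\<forall>s\<in>I. \<delta> s = \<gamma> s) \<longrightarrow> J = I)"

text \<open>The bundle \<open>C\<^sup>+\<close>; a causal vector is future-pointing iff its product with a future timelike
  vector is negative (which also excludes the zero vector).\<close>

definition future_null :: "('a::euclidean_space, 'm) spacetime \<Rightarrow> ('a \<times> 'a) set" where
  "future_null S = {(p, v). p \<in> points S \<and> v \<in> tangent_vectors (points S) p \<and>
     metric S p v v = 0 \<and> metric S p v (future S p) < 0}"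

definition null_geodesics :: "('a::euclidean_space, 'm::euclidean_space) spacetime \<Rightarrow> 'a set set" where
  "null_geodesics S = {\<gamma> ` I | \<gamma> I. maximal_geodesic S I \<gamma> \<and>
     (\<forall>s\<in>I. (\<gamma> s, vector_derivative \<gamma> (at s)) \<in> future_null S)}"

text \<open>The null geodesic with a given initial vector: the projection from \<open>C\<^sup>+\<close> to its quotient by the
  foliation spanned by the geodesic spray and the Euler field, a leaf being identified with the
  image of the corresponding geodesic.\<close>

definition geodesic_of :: "('a::euclidean_space, 'm::euclidean_space) spacetime \<Rightarrow> 'a \<times> 'a \<Rightarrow> 'a set" where
  "geodesic_of S = (\<lambda>(p, v). THE \<Gamma>. \<exists>I \<gamma>. maximal_geodesic S I \<gamma> \<and> 0 \<in> I \<and> \<gamma> 0 = p \<and>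
     vector_derivative \<gamma> (at 0) = v \<and> \<Gamma> = \<gamma> ` I)"

definition null_space :: "('a::euclidean_space, 'm::euclidean_space) spacetime \<Rightarrow> 'a set smooth_space" where
  "null_space S = \<lparr>pts = null_geodesics S, funs = {f. smooth_on (future_null S) (f \<circ> geodesic_of S)}\<rparr>"

definition sky :: "('a::euclidean_space, 'm::euclidean_space) spacetime \<Rightarrow> 'a \<Rightarrow> 'a set set" where
  "sky S x = {\<Gamma> \<in> null_geodesics S. x \<in> \<Gamma>}"

text \<open>\<open>F\<close> is a non-constant one-parameter family of geodesics \<open>F s\<close> from \<open>x\<close> to \<open>y\<close>. Fixing the
  parameter values at both ends rules out mere reparametrisations of one geodesic.\<close>

definition joined_by_family ::
  "('a::euclidean_space, 'm::euclidean_space) spacetime \<Rightarrow> 'a \<Rightarrow> 'a \<Rightarrow> bool" where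
  "joined_by_family S x y \<longleftrightarrow> (\<exists>(F :: real \<Rightarrow> real \<Rightarrow> 'a) J I.
     open J \<and> is_interval J \<and> 0 \<in> I \<and> 1 \<in> I \<and> smooth_on (J \<times> I) (\<lambda>(s, \<tau>). F s \<tau>) \<and>
     (\<forall>s\<in>J. is_geodesic S I (F s) \<and> F s 0 = x \<and> F s 1 = y) \<and>
     (\<exists>s\<in>J. \<exists>s'\<in>J. \<exists>\<tau>\<in>I. F s \<tau> \<noteq> F s' \<tau>))"

definition admissible_pair ::
  "('a::euclidean_space, 'm::euclidean_space) spacetime \<Rightarrow> 'a set \<Rightarrow> 'a \<Rightarrow> 'a \<Rightarrow> bool" where
  "admissible_pair S \<Gamma> x y \<longleftrightarrow> x \<in> \<Gamma> \<and> y \<in> \<Gamma> \<and> x \<noteq> y \<and> \<not> joined_by_family S x y"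

definition canonical_contact ::
  "('a::euclidean_space, 'm::euclidean_space) spacetime \<Rightarrow> 'a set \<Rightarrow> 'a set tvec set" where
  "canonical_contact S \<Gamma> = (THE D. (\<exists>x y. admissible_pair S \<Gamma> x y) \<and>
     (\<forall>x y. admissible_pair S \<Gamma> x y \<longrightarrow>
        direct_sum D (tangent_space (null_space S) (sky S x) \<Gamma>)
                     (tangent_space (null_space S) (sky S y) \<Gamma>)))"


section \<open>The spacetime \<open>S\<^sup>2 \<times> S\<^sup>1\<close>\<close>

text \<open>The circle is the unit circle in \<open>\<complex>\<close>. A vector tangent to it at \<open>z\<close> has the form
  \<open>\<i> * a * z\<close> with \<open>a\<close> real, and \<open>dt\<close> maps it to \<open>a\<close>; thus \<open>\<partial>\<^sub>t\<close> is \<open>\<i> * z\<close>.\<close>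

definition dt :: "complex \<Rightarrow> complex \<Rightarrow> real" where
  "dt z \<tau> = Im (\<tau> * cnj z)"

definition S2xS1 :: "nat \<Rightarrow> nat \<Rightarrow> ((real^3) \<times> complex, real^3) spacetime" where
  "S2xS1 c d = \<lparr>points = sphere 0 1 \<times> sphere 0 1,
     charts = local_params (sphere 0 1 \<times> sphere 0 1),
     metric = (\<lambda>(x, z) (v, \<tau>) (w, \<sigma>). v \<bullet> w - (real d)\<^sup>2 / (real c)\<^sup>2 * dt z \<tau> * dt z \<sigma>),
     future = (\<lambda>(x, z). (0, \<i> * z))\<rparr>"


section \<open>The unit tangent bundle of \<open>S\<^sup>2\<close>\<close>

definition S2 :: "(real^3) smooth_space" where
  "S2 = embedded (sphere 0 1)"

definition STS2 :: "((real^3) \<times> (real^3)) smooth_space" where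
  "STS2 = embedded {(x, u). norm x = 1 \<and> norm u = 1 \<and> x \<bullet> u = 0}"

text \<open>The orthogonal of \<open>u\<close> in the tangent space of \<open>S\<^sup>2\<close> at \<open>x\<close>.\<close>

definition perp :: "(real^3) \<times> (real^3) \<Rightarrow> (real^3) tvec set" where
  "perp = (\<lambda>(x, u). {velocity S2 \<alpha> | \<alpha>. smooth_curve S2 \<alpha> \<and> \<alpha> 0 = x \<and>
     vector_derivative \<alpha> (at 0) \<bullet> u = 0})"

definition chi_contact :: "(real^3) \<times> (real^3) \<Rightarrow> ((real^3) \<times> (real^3)) tvec set" where
  "chi_contact w = {D \<in> tangent_space STS2 (pts STS2) w. differential S2 fst D \<in> perp w}"

definition rot :: "real \<Rightarrow> (real^3) \<times> (real^3) \<Rightarrow> (real^3) \<times> (real^3)" where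
  "rot \<theta> = (\<lambda>(x, u). (cos \<theta> *\<^sub>R x + sin \<theta> *\<^sub>R u, - sin \<theta> *\<^sub>R x + cos \<theta> *\<^sub>R u))"

definition Zc_orbit :: "nat \<Rightarrow> (real^3) \<times> (real^3) \<Rightarrow> ((real^3) \<times> (real^3)) set" where
  "Zc_orbit c w = range (\<lambda>j::int. rot (2 * pi * of_int j / real c) w)"

definition STS2_mod :: "nat \<Rightarrow> ((real^3) \<times> (real^3)) set smooth_space" where
  "STS2_mod c = quotient_space STS2 (Zc_orbit c)"

definition to_null :: "nat \<Rightarrow> nat \<Rightarrow> (real^3) \<times> (real^3) \<Rightarrow> ((real^3) \<times> complex) set" where
  "to_null c d = (\<lambda>(x, u). range (\<lambda>s. (cos s *\<^sub>R x + sin s *\<^sub>R u, cis (real c / real d * s))))"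

text \<open>The map induced by \<open>to_null\<close> on \<open>\<int>\<^sub>c\<close>-orbits.\<close>

definition orbit_to_null :: "nat \<Rightarrow> nat \<Rightarrow> ((real^3) \<times> (real^3)) set \<Rightarrow> ((real^3) \<times> complex) set" where
  "orbit_to_null c d Q = (THE \<Gamma>. \<Gamma> \<in> to_null c d ` Q)"


section \<open>Quaternions and lens spaces\<close>

text \<open>The pair \<open>(a, b)\<close> stands for the quaternion \<open>a + b j\<close>, where \<open>j * z = cnj z * j\<close> for complex \<open>z\<close>.\<close>

definition qmult :: "complex \<times> complex \<Rightarrow> complex \<times> complex \<Rightarrow> complex \<times> complex" where
  "qmult = (\<lambda>(a, b) (a', b'). (a * a' - b * cnj b', a * b' + b * cnj a'))"

definition qinv :: "complex \<times> complex \<Rightarrow> complex \<times> complex" where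
  "qinv q = (1 / (norm q)\<^sup>2) *\<^sub>R (cnj (fst q), - snd q)"

definition qj :: "complex \<times> complex" where "qj = (0, 1)"

definition qk :: "complex \<times> complex" where "qk = (0, \<i>)"

text \<open>Coordinates of the imaginary part with respect to \<open>i, j, k\<close>.\<close>

definition qimag :: "complex \<times> complex \<Rightarrow> real^3" where
  "qimag q = vector [Im (fst q), Re (snd q), Im (snd q)]"

definition lens_orbit :: "nat \<Rightarrow> complex \<times> complex \<Rightarrow> (complex \<times> complex) set" where
  "lens_orbit p = (\<lambda>(z0, z1).
     range (\<lambda>j::int. (cis (2 * pi * of_int j / real p) * z0, cis (2 * pi * of_int j / real p) * z1)))"

text \<open>The lens space \<open>L(p,1)\<close>.\<close>

definition lens_space :: "nat \<Rightarrow> (complex \<times> complex) set smooth_space" where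
  "lens_space p = quotient_space (embedded (sphere 0 1)) (lens_orbit p)"

definition quat_to_STS2 :: "complex \<times> complex \<Rightarrow> (real^3) \<times> (real^3)" where
  "quat_to_STS2 q = (qimag (qmult (qmult (qinv q) qk) q), qimag (qmult (qmult (qinv q) qj) q))"

text \<open>The map \<open>L(2c,1) \<rightarrow> STS\<^sup>2/\<int>\<^sub>c\<close> induced by \<open>quat_to_STS2\<close>, which sends each orbit onto an orbit.\<close>

definition lens_to_STS2_mod :: "(complex \<times> complex) set \<Rightarrow> ((real^3) \<times> (real^3)) set" where
  "lens_to_STS2_mod Q = quat_to_STS2 ` Q"

definition lens_to_null :: "nat \<Rightarrow> nat \<Rightarrow> (complex \<times> complex) set \<Rightarrow> ((real^3) \<times> complex) set" where
  "lens_to_null c d = orbit_to_null c d \<circ> lens_to_STS2_mod"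

text \<open>The projection \<open>r : STS\<^sup>2 \<rightarrow> STS\<^sup>2/\<int>\<^sub>c \<cong> L(2c,1)\<close>.\<close>

definition r_proj :: "nat \<Rightarrow> (real^3) \<times> (real^3) \<Rightarrow> (complex \<times> complex) set" where
  "r_proj c w = the_inv_into (pts (lens_space (2 * c))) lens_to_STS2_mod (Zc_orbit c w)"

end

(* The metric is the restriction to S^2 x S^1 of an indefinite bilinear form with constant
   coefficients, so the geodesic equation says that the ambient acceleration is orthogonal to the
   tangent space, and the geodesics are pairs of uniformly traversed circles. Hence to_null induces
   a bijection from STS^2 / Z_c onto the null geodesics.

   Write w = (x, u) and n = x cross u. The sky of the point (p, z) of to_null w at parameter s is
   the image of rot (-s) applied to the fibre of STS^2 over p; its tangent space at to_null w is
   the image of the line spanned by (- sin s n, cos s n). For two parameters s, t with sin (s - t) nonzero these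
   lines span the image of {(a n, b n)} = chi_w. Points with sin (s - t) = 0 are joined by the
   rotated great circles; points at distance pi/2 are joined by countably many geodesics only and
   therefore by no continuous family. Tangent vectors of the quotient are compared with those of
   STS^2 through the monomials of degree c in the components of x + i u, which are Z_c-invariant. *)
theory Submission
  imports Defs
begin

section \<open>Calculus of smooth maps\<close>

text \<open>The space of null geodesics is given only by its points and its smooth functions, and
  tangent vectors are derivations. A smooth curve of null geodesics therefore comes without a lift
  to STS^2, and statements about velocities must be read off from explicit smooth functions. Lifts
  are constructed only for curves inside one sky, where the base point is fixed and just a direction
  has to be recovered; for arbitrary curves injectivity of differentials suffices. Coprimality
  enters once: the circle factor closes up after the parameter 2 pi d / c, so two initial data give
  the same geodesic when they differ by a multiple of this angle, and gcd 1 makes these multiples,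
  modulo 2 pi, the full group Z_c. The canonical contact structure is a definite description, so an
  admissible pair must be exhibited on every geodesic. Families consist of arbitrary geodesics, not
  only null ones; countability disposes of all of them at once. On the quaternion side, x + i u is
  an isotropic vector of C^3 and the map from unit quaternions is its quadratic parametrisation by
  spinors. It is two-to-one, so smooth functions descend through local square roots.\<close>

lemma Ck_on_subset: "Ck_on k U f \<Longrightarrow> V \<subseteq> U \<Longrightarrow> Ck_on k V f"
  by (induction k arbitrary: f) (auto intro: continuous_on_subset)

lemma Ck_on_imp_continuous_on: "Ck_on k U f \<Longrightarrow> continuous_on U f"
  by (cases k) (auto intro!: continuous_at_imp_continuous_on differentiable_imp_continuous_within)

lemma Ck_on_Suc_D: "Ck_on (Suc k) U f \<Longrightarrow> Ck_on k U f"
proof (induction k arbitrary: f)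
  case 0
  then show ?case using Ck_on_imp_continuous_on by (metis Ck_on.simps(1))
next
  case (Suc k)
  then show ?case by (metis Ck_on.simps(2))
qed

lemma Ck_on_cong:
  assumes "open U" "\<And>x. x \<in> U \<Longrightarrow> f x = g x" "Ck_on k U f"
  shows "Ck_on k U g"
  using assms(2,3)
proof (induction k arbitrary: f g)
  case 0
  then show ?case using continuous_on_cong by (metis Ck_on.simps(1))
next
  case (Suc k)
  have *: "g differentiable (at x)" "frechet_derivative f (at x) = frechet_derivative g (at x)"
    if "x \<in> U" for x
  proof -
    have f: "f differentiable (at x)" using Suc.prems that by simp
    show "g differentiable (at x)"
      using f Suc.prems(1) assms(1) that
      by (meson differentiable_def has_derivative_transform_within_open)
    show "frechet_derivative f (at x) = frechet_derivative g (at x)"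
      using frechet_derivative_transform_within_open[OF f assms(1) that] Suc.prems(1) by blast
  qed
  have "Ck_on k U (\<lambda>x. frechet_derivative g (at x) v)" for v
    by (rule Suc.IH[of "\<lambda>x. frechet_derivative f (at x) v"]) (use * Suc.prems in auto)
  then show ?case using * by simp
qed

lemma Ck_on_SucI:
  assumes "open U" "\<And>x. x \<in> U \<Longrightarrow> (f has_derivative f' x) (at x)"
    and "\<And>v. Ck_on k U (\<lambda>x. f' x v)"
  shows "Ck_on (Suc k) U f"
proof -
  have "frechet_derivative f (at x) = f' x" if "x \<in> U" for x
    using assms(2)[OF that] frechet_derivative_at by metis
  then have "Ck_on k U (\<lambda>x. frechet_derivative f (at x) v)" for v
    by (intro Ck_on_cong[OF assms(1) _ assms(3)[of v]]) simp
  then show ?thesis using assms(2) by (auto simp: differentiable_def)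
qed

lemma Ck_on_const: "Ck_on k U (\<lambda>x. c)"
  by (induction k arbitrary: c) (auto simp: frechet_derivative_const)

lemma Ck_on_bounded_linear:
  assumes "bounded_linear f"
  shows "Ck_on k U f"
proof (cases k)
  case 0
  then show ?thesis using assms by (simp add: linear_continuous_on)
next
  case (Suc n)
  have "(f has_derivative f) (at x)" for x
    using assms bounded_linear_imp_has_derivative by blast
  then show ?thesis
    using Suc Ck_on_const frechet_derivative_at[of f f]
    by (auto simp: differentiable_def)
qed

lemma Ck_on_add:
  assumes "open U" "Ck_on k U f" "Ck_on k U g"
  shows "Ck_on k U (\<lambda>x. f x + g x)"
  using assms(2,3)
proof (induction k arbitrary: f g)
  case 0
  then show ?case by (simp add: continuous_on_add)
next
  case (Suc n)
  have "((\<lambda>x. f x + g x) has_derivative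
         (\<lambda>v. frechet_derivative f (at x) v + frechet_derivative g (at x) v)) (at x)" if "x \<in> U" for x
    using Suc.prems that by (intro has_derivative_add) (auto simp: frechet_derivative_works)
  then show ?case
    using Suc by (intro Ck_on_SucI[OF assms(1)]) auto
qed

lemma Ck_on_bounded_bilinear:
  assumes "bounded_bilinear (\<lambda>x y. bop x y)" "open U" "Ck_on k U f" "Ck_on k U g"
  shows "Ck_on k U (\<lambda>x. bop (f x) (g x))"
proof -
  interpret bounded_bilinear bop by (rule assms)
  show ?thesis using assms(3,4)
  proof (induction k arbitrary: f g)
    case 0
    then show ?case by (simp add: continuous_on)
  next
    case (Suc k)
    have "((\<lambda>x. bop (f x) (g x)) has_derivative (\<lambda>v. bop (f x) (frechet_derivative g (at x) v) +
       bop (frechet_derivative f (at x) v) (g x))) (at x)" if "x \<in> U" for x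
      using Suc.prems that by (intro FDERIV) (auto simp: frechet_derivative_works)
    then show ?case
      using Suc.prems Suc.IH[OF Ck_on_Suc_D] Suc.IH[OF _ Ck_on_Suc_D]
      by (intro Ck_on_SucI[OF assms(2)]) (auto intro!: Ck_on_add assms(2))
  qed
qed

lemma Ck_on_sum:
  assumes "open U" "\<And>i. i \<in> I \<Longrightarrow> Ck_on k U (f i)"
  shows "Ck_on k U (\<lambda>x. \<Sum>i\<in>I. f i x)"
  using assms(2)
  by (induction I rule: infinite_finite_induct) (auto intro: Ck_on_const Ck_on_add assms(1))

lemma Ck_on_Pair:
  assumes "open U" "Ck_on k U f" "Ck_on k U g"
  shows "Ck_on k U (\<lambda>x. (f x, g x))"
  using assms(2,3)
proof (induction k arbitrary: f g)
  case 0
  then show ?case by (simp add: continuous_on_Pair)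
next
  case (Suc n)
  have "((\<lambda>x. (f x, g x)) has_derivative
         (\<lambda>v. (frechet_derivative f (at x) v, frechet_derivative g (at x) v))) (at x)" if "x \<in> U" for x
    using Suc.prems that by (intro has_derivative_Pair) (auto simp: frechet_derivative_works)
  then show ?case
    using Suc by (intro Ck_on_SucI[OF assms(1)]) auto
qed

lemma linear_basis_expansion:
  fixes f :: "'a::euclidean_space \<Rightarrow> 'b::real_vector"
  assumes "linear f"
  shows "f y = (\<Sum>b\<in>Basis. (y \<bullet> b) *\<^sub>R f b)"
proof -
  have "f y = f (\<Sum>b\<in>Basis. (y \<bullet> b) *\<^sub>R b)" by (simp only: euclidean_representation)
  also have "\<dots> = (\<Sum>b\<in>Basis. (y \<bullet> b) *\<^sub>R f b)"
    using assms by (simp only: linear_sum linear_cmul)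
  finally show ?thesis .
qed

text \<open>In the chain rule both the base point and the direction of the derivative of
  \<open>g\<close> vary with \<open>x\<close>. Expanding the direction in the basis leaves only
  derivatives of \<open>g\<close> in constant directions, to which the induction hypothesis for
  arbitrary outer functions applies.\<close>

lemma Ck_on_compose:
  fixes f :: "'a::euclidean_space \<Rightarrow> 'b::euclidean_space" and g :: "'b \<Rightarrow> 'c::real_normed_vector"
  assumes "open U" "open V" "f ` U \<subseteq> V" "Ck_on k U f" "Ck_on k V g"
  shows "Ck_on k U (\<lambda>x. g (f x))"
  using assms(4,5)
proof (induction k arbitrary: g)
  case 0
  then show ?case using assms(3) by (auto intro: continuous_on_compose2)
next
  case (Suc k)
  let ?Df = "\<lambda>x. frechet_derivative f (at x)" and ?Dg = "\<lambda>y. frechet_derivative g (at y)"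
  have "((\<lambda>x. g (f x)) has_derivative (\<lambda>v. \<Sum>b\<in>Basis. (?Df x v \<bullet> b) *\<^sub>R ?Dg (f x) b)) (at x)"
    if "x \<in> U" for x
  proof -
    have dg: "(g has_derivative ?Dg (f x)) (at (f x))"
      using Suc.prems that assms(3) by (auto simp: frechet_derivative_works)
    have "((\<lambda>x. g (f x)) has_derivative (\<lambda>v. ?Dg (f x) (?Df x v))) (at x)"
      using Suc.prems that by (intro has_derivative_compose[where f = f and g = g, OF _ dg]) (auto simp: frechet_derivative_works)
    moreover have "(\<lambda>v. ?Dg (f x) (?Df x v)) = (\<lambda>v. \<Sum>b\<in>Basis. (?Df x v \<bullet> b) *\<^sub>R ?Dg (f x) b)"
      by (rule ext, rule linear_basis_expansion[OF has_derivative_linear[OF dg]])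
    ultimately show ?thesis by simp
  qed
  moreover have "Ck_on k U (\<lambda>x. \<Sum>b\<in>Basis. (?Df x v \<bullet> b) *\<^sub>R ?Dg (f x) b)" for v
  proof (intro Ck_on_sum assms(1) Ck_on_bounded_bilinear[OF bounded_bilinear_scaleR]
      Ck_on_bounded_bilinear[OF bounded_bilinear_inner] Ck_on_const)
    show "Ck_on k U (\<lambda>x. ?Df x v)" using Suc.prems by simp
    show "Ck_on k U (\<lambda>x. ?Dg (f x) b)" for b
      by (rule Suc.IH) (use Suc.prems Ck_on_Suc_D in auto)
  qed
  ultimately show ?case by (intro Ck_on_SucI[OF assms(1)])
qed

lemma Ck_on_real_SucI:
  fixes f :: "real \<Rightarrow> real"
  assumes "open U" "\<And>x. x \<in> U \<Longrightarrow> (f has_field_derivative f' x) (at x)" "Ck_on k U f'"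
  shows "Ck_on (Suc k) U f"
  using assms
  by (intro Ck_on_SucI[where f' = "\<lambda>x v. f' x * v"])
     (auto simp: has_field_derivative_def intro!: Ck_on_bounded_bilinear[OF bounded_bilinear_mult] Ck_on_const)

text \<open>The two are treated together because each is, up to sign, the derivative of the
  other.\<close>

lemma Ck_on_sin_cos: "Ck_on k (UNIV :: real set) sin \<and> Ck_on k (UNIV :: real set) cos"
proof (induction k)
  case 0
  then show ?case by (simp add: continuous_on_sin continuous_on_cos continuous_on_id)
next
  case (Suc k)
  have "Ck_on k (UNIV :: real set) (\<lambda>x. (-1) * sin x)"
    using Suc by (intro Ck_on_bounded_bilinear[OF bounded_bilinear_mult] Ck_on_const) auto
  then have "Ck_on (Suc k) (UNIV :: real set) cos"
    by (rule Ck_on_real_SucI[OF open_UNIV, rotated]) (auto intro!: derivative_eq_intros)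
  moreover have "Ck_on (Suc k) (UNIV :: real set) sin"
    using Suc by (intro Ck_on_real_SucI[OF open_UNIV, where f' = cos]) (auto intro!: derivative_eq_intros)
  ultimately show ?case by blast
qed

lemma Ck_on_inverse: "Ck_on k (- {0::real}) inverse"
proof (induction k)
  case 0
  then show ?case by (auto intro!: continuous_intros)
next
  case (Suc k)
  have "Ck_on k (- {0::real}) (\<lambda>x. (-1) * (inverse x * inverse x))"
    using Suc by (intro Ck_on_bounded_bilinear[OF bounded_bilinear_mult] Ck_on_const) auto
  moreover have "(inverse has_field_derivative (-1) * (inverse x * inverse x)) (at x)" if "x \<in> - {0}" for x :: real
    using that by (auto intro!: derivative_eq_intros simp: power2_eq_square)
  ultimately show ?case
    by (intro Ck_on_real_SucI) auto
qed

lemma Ck_on_arctan: "Ck_on k (UNIV :: real set) arctan"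
proof (cases k)
  case 0
  then show ?thesis by (auto intro!: continuous_intros)
next
  case (Suc n)
  have pos: "1 + x * x \<noteq> 0" for x :: real by (metis add_pos_nonneg less_numeral_extra(1,3) zero_le_square)
  have "Ck_on n (UNIV :: real set) (\<lambda>x. 1 + x * x)"
    by (intro Ck_on_add Ck_on_const Ck_on_bounded_bilinear[OF bounded_bilinear_mult]
        Ck_on_bounded_linear[of "\<lambda>x. x"] bounded_linear_ident) auto
  then have "Ck_on n (UNIV :: real set) (\<lambda>x. inverse (1 + x * x))"
    using pos by (intro Ck_on_compose[of UNIV "- {0}" _ _ inverse] Ck_on_inverse) auto
  then show ?thesis
    using Suc by (auto intro!: Ck_on_real_SucI[where f' = "\<lambda>x. inverse (1 + x * x)"]
      derivative_eq_intros simp: power2_eq_square simp del: Ck_on.simps)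
qed

lemma Ck_on_sqrt: "Ck_on k {0::real<..} sqrt"
proof (induction k)
  case 0
  then show ?case by (auto intro!: continuous_intros)
next
  case (Suc k)
  have "Ck_on k {0::real<..} (\<lambda>x. inverse (sqrt x))"
    using Suc by (intro Ck_on_compose[of "{0<..}" "- {0}" _ _ inverse] Ck_on_inverse) auto
  then have "Ck_on k {0::real<..} (\<lambda>x. inverse (sqrt x) * (1 / 2))"
    by (intro Ck_on_bounded_bilinear[OF bounded_bilinear_mult] Ck_on_const) auto
  then show ?case
    by (auto intro!: Ck_on_real_SucI[where f' = "\<lambda>x. inverse (sqrt x) * (1 / 2)"]
      derivative_eq_intros simp: divide_simps simp del: Ck_on.simps)
qed

section \<open>Smoothness on arbitrary subsets of Euclidean space\<close>

lemma smooth_onI_Ck: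
  assumes "open U" "\<And>k. Ck_on k U f"
  shows "smooth_on U f"
  unfolding smooth_on_def using assms by blast

text \<open>Near a point of an open set the local extension coincides with \<open>f\<close>, so it
  remains to see that \<open>Ck_on\<close> is a local property. The auxiliary fact
  \<open>loc\<close> is stated for all functions because its induction passes to
  derivatives.\<close>

lemma smooth_on_openD:
  assumes "open U" "smooth_on U f"
  shows "Ck_on k U f"
proof -
  have loc: "Ck_on k U f" if "\<And>x. x \<in> U \<Longrightarrow> \<exists>V. open V \<and> x \<in> V \<and> Ck_on k V f"
    for k and f :: "'a \<Rightarrow> 'b"
    using that
  proof (induction k arbitrary: f)
    case 0
    have "continuous (at x) f" if "x \<in> U" for x
      using 0[OF that] continuous_on_eq_continuous_at by auto
    then show ?case by (simp add: continuous_at_imp_continuous_on)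
  next
    case (Suc k)
    have "f differentiable (at x)" if "x \<in> U" for x using Suc.prems[OF that] by auto
    moreover have "Ck_on k U (\<lambda>x. frechet_derivative f (at x) v)" for v
    proof (rule Suc.IH)
      fix x assume "x \<in> U"
      from Suc.prems[OF this] show "\<exists>V. open V \<and> x \<in> V \<and> Ck_on k V (\<lambda>x. frechet_derivative f (at x) v)"
        by auto
    qed
    ultimately show ?case by simp
  qed
  show ?thesis
  proof (rule loc)
    fix x assume "x \<in> U"
    then obtain V F where V: "open V" "x \<in> V" "\<And>k. Ck_on k V F" "\<And>y. y \<in> U \<inter> V \<Longrightarrow> F y = f y"
      using assms(2) unfolding smooth_on_def by meson
    have "Ck_on k (U \<inter> V) F" using V(3) Ck_on_subset by blast
    then have "Ck_on k (U \<inter> V) f" by (rule Ck_on_cong[rotated 2]) (use V assms in auto)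
    then show "\<exists>V. open V \<and> x \<in> V \<and> Ck_on k V f" using V \<open>x \<in> U\<close> assms(1) by blast
  qed
qed

lemma smooth_on_cong:
  assumes "smooth_on S f" "\<And>x. x \<in> S \<Longrightarrow> f x = g x"
  shows "smooth_on S g"
  unfolding smooth_on_def
proof
  fix x assume "x \<in> S"
  then obtain U F where "open U" "x \<in> U" "\<forall>k. Ck_on k U F" "\<forall>y\<in>S \<inter> U. F y = f y"
    using assms(1) unfolding smooth_on_def by meson
  then show "\<exists>U F. open U \<and> x \<in> U \<and> (\<forall>k. Ck_on k U F) \<and> (\<forall>y\<in>S \<inter> U. F y = g y)"
    using assms(2) by (intro exI[of _ U] exI[of _ F]) simp
qed

lemma smooth_on_subset:
  assumes "smooth_on S f" "T \<subseteq> S"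
  shows "smooth_on T f"
  unfolding smooth_on_def
proof
  fix x assume "x \<in> T"
  then have "x \<in> S" using assms(2) by blast
  then obtain U F where "open U" "x \<in> U" "\<forall>k. Ck_on k U F" "\<forall>y\<in>S \<inter> U. F y = f y"
    using assms(1) unfolding smooth_on_def by meson
  then show "\<exists>U F. open U \<and> x \<in> U \<and> (\<forall>k. Ck_on k U F) \<and> (\<forall>y\<in>T \<inter> U. F y = f y)"
    using assms(2) by (intro exI[of _ U] exI[of _ F]) auto
qed

lemma smooth_on_local:
  assumes "\<And>x. x \<in> S \<Longrightarrow> \<exists>U. open U \<and> x \<in> U \<and> smooth_on (S \<inter> U) f"
  shows "smooth_on S f"
  unfolding smooth_on_def
proof
  fix x assume x: "x \<in> S"
  then obtain U where U: "open U" "x \<in> U" "smooth_on (S \<inter> U) f" using assms by blast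
  then obtain V F where "open V" "x \<in> V" "\<forall>k. Ck_on k V F" "\<forall>y\<in>(S \<inter> U) \<inter> V. F y = f y"
    using x unfolding smooth_on_def by (meson IntI)
  then show "\<exists>U F. open U \<and> x \<in> U \<and> (\<forall>k. Ck_on k U F) \<and> (\<forall>y\<in>S \<inter> U. F y = f y)"
    using U Ck_on_subset by (intro exI[of _ "U \<inter> V"] exI[of _ F]) (auto intro: Ck_on_subset)
qed

lemma smooth_on_imp_continuous_on:
  assumes "smooth_on S f"
  shows "continuous_on S f"
proof -
  have "continuous (at x within S) f" if "x \<in> S" for x
  proof -
    obtain U F where UF: "open U" "x \<in> U" "\<forall>k. Ck_on k U F" "\<forall>y\<in>S \<inter> U. F y = f y"
      using assms \<open>x \<in> S\<close> unfolding smooth_on_def by meson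
    have "continuous_on (S \<inter> U) F" using UF(3) by (meson Ck_on_imp_continuous_on continuous_on_subset inf_le2)
    then have "continuous_on (S \<inter> U) f" using UF(4) continuous_on_cong[of "S \<inter> U" "S \<inter> U" F f] by simp
    then have "continuous (at x within S \<inter> U) f"
      using UF(2) that by (simp add: continuous_on_eq_continuous_within)
    moreover have "at x within S = at x within S \<inter> U"
      by (rule at_within_nhd[OF UF(2,1)]) auto
    ultimately show ?thesis by (simp add: continuous_within)
  qed
  then show ?thesis by (simp add: continuous_on_eq_continuous_within)
qed

lemma smooth_on_compose:
  fixes f :: "'a::euclidean_space \<Rightarrow> 'b::euclidean_space" and g :: "'b \<Rightarrow> 'c::real_normed_vector"
  assumes "smooth_on T g" "smooth_on S f" "\<And>x. x \<in> S \<Longrightarrow> f x \<in> T"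
  shows "smooth_on S (\<lambda>x. g (f x))"
  unfolding smooth_on_def
proof
  fix x assume x: "x \<in> S"
  then obtain U F where U: "open U" "x \<in> U" "\<forall>k. Ck_on k U F" "\<forall>y\<in>S \<inter> U. F y = f y"
    using assms(2) unfolding smooth_on_def by meson
  obtain V G where V: "open V" "f x \<in> V" "\<forall>k. Ck_on k V G" "\<forall>y\<in>T \<inter> V. G y = g y"
    using assms(1,3) x unfolding smooth_on_def by meson
  let ?W = "U \<inter> F -` V"
  have "open ?W"
    using U(1,3) V(1) by (metis Ck_on.simps(1) continuous_on_open_vimage Int_commute)
  moreover have "Ck_on k ?W (\<lambda>x. G (F x))" for k
  proof (rule Ck_on_compose[OF \<open>open ?W\<close> V(1)])
    show "Ck_on k ?W F" by (rule Ck_on_subset) (use U in auto)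
    show "Ck_on k V G" using V by blast
  qed auto
  moreover have "F x = f x" using U x by blast
  ultimately show "\<exists>U F. open U \<and> x \<in> U \<and> (\<forall>k. Ck_on k U F) \<and> (\<forall>y\<in>S \<inter> U. F y = g (f y))"
    using U(2,4) V(2,4) assms(3) by (intro exI[of _ ?W] exI[of _ "\<lambda>x. G (F x)"]) force
qed

lemma smooth_on_Pair:
  assumes "smooth_on S f" "smooth_on S g"
  shows "smooth_on S (\<lambda>x. (f x, g x))"
  unfolding smooth_on_def
proof
  fix x assume x: "x \<in> S"
  then obtain U F where U: "open U" "x \<in> U" "\<forall>k. Ck_on k U F" "\<forall>y\<in>S \<inter> U. F y = f y"
    using assms(1) unfolding smooth_on_def by meson
  obtain V G where V: "open V" "x \<in> V" "\<forall>k. Ck_on k V G" "\<forall>y\<in>S \<inter> V. G y = g y"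
    using assms(2) x unfolding smooth_on_def by meson
  show "\<exists>U F. open U \<and> x \<in> U \<and> (\<forall>k. Ck_on k U F) \<and> (\<forall>y\<in>S \<inter> U. F y = (f y, g y))"
    using U V by (intro exI[of _ "U \<inter> V"] exI[of _ "\<lambda>x. (F x, G x)"])
       (auto intro!: Ck_on_Pair intro: Ck_on_subset)
qed

lemma smooth_on_bounded_linear: "bounded_linear f \<Longrightarrow> smooth_on S f"
  by (rule smooth_on_subset[OF smooth_onI_Ck[OF open_UNIV Ck_on_bounded_linear]]) auto

lemma smooth_on_linear_compose:
  fixes f :: "'a::euclidean_space \<Rightarrow> 'b::euclidean_space"
  assumes "bounded_linear L" "smooth_on S f"
  shows "smooth_on S (\<lambda>x. L (f x))"
  using smooth_on_compose[OF smooth_on_bounded_linear[OF assms(1), of UNIV] assms(2)] by simp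

lemma smooth_on_bilinear:
  fixes f :: "'a::euclidean_space \<Rightarrow> 'b::euclidean_space" and g :: "'a \<Rightarrow> 'c::euclidean_space"
  assumes "bounded_bilinear bop" "smooth_on S f" "smooth_on S g"
  shows "smooth_on S (\<lambda>x. bop (f x) (g x))"
proof -
  have "smooth_on UNIV (\<lambda>p. bop (fst p) (snd p))"
    by (intro smooth_onI_Ck Ck_on_bounded_bilinear[OF assms(1)] Ck_on_bounded_linear
        bounded_linear_fst bounded_linear_snd) auto
  from smooth_on_compose[OF this smooth_on_Pair[OF assms(2,3)]] show ?thesis by simp
qed

lemma smooth_on_const: "smooth_on S (\<lambda>x. c)"
  by (rule smooth_on_subset[OF smooth_onI_Ck[OF open_UNIV Ck_on_const]]) simp

lemma smooth_on_ident: "smooth_on S (\<lambda>x. x)"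
  by (rule smooth_on_bounded_linear[OF bounded_linear_ident])

lemma smooth_on_fst:
  fixes f :: "'a::euclidean_space \<Rightarrow> 'b::euclidean_space \<times> 'c::euclidean_space"
  shows "smooth_on S f \<Longrightarrow> smooth_on S (\<lambda>x. fst (f x))"
  by (rule smooth_on_linear_compose[OF bounded_linear_fst])

lemma smooth_on_snd:
  fixes f :: "'a::euclidean_space \<Rightarrow> 'b::euclidean_space \<times> 'c::euclidean_space"
  shows "smooth_on S f \<Longrightarrow> smooth_on S (\<lambda>x. snd (f x))"
  by (rule smooth_on_linear_compose[OF bounded_linear_snd])

lemma smooth_on_add:
  fixes f g :: "'a::euclidean_space \<Rightarrow> 'b::euclidean_space"
  assumes "smooth_on S f" "smooth_on S g"
  shows "smooth_on S (\<lambda>x. f x + g x)"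
  using smooth_on_linear_compose[OF bounded_linear_add[OF bounded_linear_fst bounded_linear_snd]
      smooth_on_Pair[OF assms]] by simp

lemma smooth_on_minus:
  fixes f :: "'a::euclidean_space \<Rightarrow> 'b::euclidean_space"
  shows "smooth_on S f \<Longrightarrow> smooth_on S (\<lambda>x. - f x)"
  by (rule smooth_on_linear_compose[OF bounded_linear_minus[OF bounded_linear_ident]])

lemma smooth_on_diff:
  fixes f g :: "'a::euclidean_space \<Rightarrow> 'b::euclidean_space"
  assumes "smooth_on S f" "smooth_on S g"
  shows "smooth_on S (\<lambda>x. f x - g x)"
  using smooth_on_add[OF assms(1) smooth_on_minus[OF assms(2)]] by simp

lemma smooth_on_mult:
  fixes f g :: "'a::euclidean_space \<Rightarrow> 'b::{euclidean_space, real_normed_algebra}"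
  shows "smooth_on S f \<Longrightarrow> smooth_on S g \<Longrightarrow> smooth_on S (\<lambda>x. f x * g x)"
  by (rule smooth_on_bilinear[OF bounded_bilinear_mult])

lemma smooth_on_scaleR:
  fixes g :: "'a::euclidean_space \<Rightarrow> 'b::euclidean_space"
  shows "smooth_on S f \<Longrightarrow> smooth_on S g \<Longrightarrow> smooth_on S (\<lambda>x. f x *\<^sub>R g x)"
  by (rule smooth_on_bilinear[OF bounded_bilinear_scaleR])

lemma smooth_on_inner:
  fixes f g :: "'a::euclidean_space \<Rightarrow> 'b::euclidean_space"
  shows "smooth_on S f \<Longrightarrow> smooth_on S g \<Longrightarrow> smooth_on S (\<lambda>x. f x \<bullet> g x)"
  by (rule smooth_on_bilinear[OF bounded_bilinear_inner])

lemma smooth_on_power: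
  fixes f :: "'a::euclidean_space \<Rightarrow> 'b::{euclidean_space, real_normed_algebra_1}"
  shows "smooth_on S f \<Longrightarrow> smooth_on S (\<lambda>x. f x ^ n)"
  by (induction n) (auto intro: smooth_on_const smooth_on_mult)

lemma smooth_on_sum:
  fixes f :: "'i \<Rightarrow> 'a::euclidean_space \<Rightarrow> 'b::euclidean_space"
  assumes "\<And>i. i \<in> I \<Longrightarrow> smooth_on S (f i)"
  shows "smooth_on S (\<lambda>x. \<Sum>i\<in>I. f i x)"
  using assms
  by (induction I rule: infinite_finite_induct) (auto intro: smooth_on_const smooth_on_add)

lemma smooth_on_sin: "smooth_on S f \<Longrightarrow> smooth_on S (\<lambda>x. sin (f x :: real))"
  and smooth_on_cos: "smooth_on S f \<Longrightarrow> smooth_on S (\<lambda>x. cos (f x :: real))"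
  and smooth_on_arctan: "smooth_on S f \<Longrightarrow> smooth_on S (\<lambda>x. arctan (f x :: real))"
  using smooth_on_compose[of UNIV _ S f] smooth_onI_Ck[OF open_UNIV] Ck_on_sin_cos Ck_on_arctan by auto

lemma smooth_on_inverse:
  fixes f :: "'a::euclidean_space \<Rightarrow> real"
  shows "smooth_on S f \<Longrightarrow> (\<And>x. x \<in> S \<Longrightarrow> f x \<noteq> 0) \<Longrightarrow> smooth_on S (\<lambda>x. inverse (f x))"
  by (rule smooth_on_compose[OF smooth_onI_Ck[OF _ Ck_on_inverse]]) auto

lemma smooth_on_divide:
  fixes f g :: "'a::euclidean_space \<Rightarrow> real"
  shows "smooth_on S f \<Longrightarrow> smooth_on S g \<Longrightarrow> (\<And>x. x \<in> S \<Longrightarrow> g x \<noteq> 0) \<Longrightarrow> smooth_on S (\<lambda>x. f x / g x)"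
  unfolding divide_inverse by (intro smooth_on_mult smooth_on_inverse)

lemma smooth_on_sqrt:
  fixes f :: "'a::euclidean_space \<Rightarrow> real"
  shows "smooth_on S f \<Longrightarrow> (\<And>x. x \<in> S \<Longrightarrow> f x > 0) \<Longrightarrow> smooth_on S (\<lambda>x. sqrt (f x))"
  by (rule smooth_on_compose[OF smooth_onI_Ck[OF _ Ck_on_sqrt]]) auto

lemma smooth_on_norm:
  fixes f :: "'a::euclidean_space \<Rightarrow> 'b::euclidean_space"
  shows "smooth_on S f \<Longrightarrow> (\<And>x. x \<in> S \<Longrightarrow> f x \<noteq> 0) \<Longrightarrow> smooth_on S (\<lambda>x. norm (f x))"
  unfolding norm_eq_sqrt_inner by (intro smooth_on_sqrt smooth_on_inner) auto

lemma smooth_on_cis: "smooth_on S f \<Longrightarrow> smooth_on S (\<lambda>x. cis (f x))"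
proof -
  assume f: "smooth_on S f"
  have "cis (f x) = cos (f x) *\<^sub>R 1 + sin (f x) *\<^sub>R \<i>" for x by (simp add: complex_eq_iff)
  then show ?thesis
    using f by (simp only:) (intro smooth_on_add smooth_on_scaleR smooth_on_cos smooth_on_sin smooth_on_const)
qed

lemma smooth_on_Re: "smooth_on S f \<Longrightarrow> smooth_on S (\<lambda>x. Re (f x))"
  and smooth_on_Im: "smooth_on S f \<Longrightarrow> smooth_on S (\<lambda>x. Im (f x))"
  and smooth_on_cnj: "smooth_on S f \<Longrightarrow> smooth_on S (\<lambda>x. cnj (f x))"
  by (rule smooth_on_linear_compose[OF bounded_linear_Re] smooth_on_linear_compose[OF bounded_linear_Im]
      smooth_on_linear_compose[OF bounded_linear_cnj]; assumption)+

lemma smooth_on_of_real: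
  "smooth_on S f \<Longrightarrow> smooth_on S (\<lambda>x. complex_of_real (f x))"
  by (rule smooth_on_linear_compose[OF bounded_linear_of_real])

lemmas smooth_intros = smooth_on_const smooth_on_ident smooth_on_Pair smooth_on_fst smooth_on_snd smooth_on_add
  smooth_on_minus smooth_on_diff smooth_on_mult smooth_on_scaleR smooth_on_inner smooth_on_power
  smooth_on_sum smooth_on_sin smooth_on_cos smooth_on_arctan smooth_on_inverse smooth_on_divide
  smooth_on_sqrt smooth_on_norm smooth_on_cis smooth_on_Re smooth_on_Im smooth_on_cnj smooth_on_of_real

lemma smooth_on_open_differentiable:
  assumes "open U" "smooth_on U f" "x \<in> U"
  shows "f differentiable (at x)"
  using smooth_on_openD[OF assms(1,2), of "Suc 0"] assms(3) by auto

lemma smooth_on_frechet_derivative: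
  assumes "open U" "smooth_on U f"
  shows "smooth_on U (\<lambda>x. frechet_derivative f (at x) v)"
  using smooth_on_openD[OF assms, of "Suc _"] assms(1) by (auto intro!: smooth_onI_Ck)

lemma smooth_on_vector_derivative:
  fixes f :: "real \<Rightarrow> 'a::real_normed_vector"
  assumes "open U" "smooth_on U f"
  shows "\<And>x. x \<in> U \<Longrightarrow> (f has_vector_derivative vector_derivative f (at x)) (at x)"
    and "smooth_on U (\<lambda>x. vector_derivative f (at x))"
proof -
  show vd: "(f has_vector_derivative vector_derivative f (at x)) (at x)" if "x \<in> U" for x
    using smooth_on_open_differentiable[OF assms that] vector_derivative_works by blast
  have "frechet_derivative f (at x) 1 = vector_derivative f (at x)" if "x \<in> U" for x
    using vd[OF that] by (metis frechet_derivative_at has_vector_derivative_def scaleR_one)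
  then show "smooth_on U (\<lambda>x. vector_derivative f (at x))"
    by (rule smooth_on_cong[OF smooth_on_frechet_derivative[OF assms, of 1]])
qed

lemma Ck_on_imp_has_derivative:
  "Ck_on (Suc k) U f \<Longrightarrow> x \<in> U \<Longrightarrow> (f has_derivative frechet_derivative f (at x)) (at x)"
  by (simp add: frechet_derivative_works)

section \<open>Symmetry of second derivatives\<close>

lemma line_has_real_derivative:
  fixes f :: "'a::euclidean_space \<Rightarrow> real"
  assumes "(f has_derivative f') (at (a + s *\<^sub>R v))"
  shows "((\<lambda>s. f (a + s *\<^sub>R v)) has_real_derivative f' v) (at s)"
proof -
  have "((\<lambda>s. a + s *\<^sub>R v) has_derivative (\<lambda>h. h *\<^sub>R v)) (at s)"
    by (auto intro!: derivative_eq_intros)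
  from has_derivative_compose[OF this assms]
  have "((\<lambda>s. f (a + s *\<^sub>R v)) has_derivative (\<lambda>h. f' (h *\<^sub>R v))) (at s)" .
  moreover have "(\<lambda>h. f' (h *\<^sub>R v)) = (*) (f' v)"
    using has_derivative_linear[OF assms] by (auto simp: linear_cmul fun_eq_iff)
  ultimately show ?thesis by (simp add: has_field_derivative_def)
qed

text \<open>Two applications of the mean value theorem: first along \<open>v\<close> to the
  difference of \<open>f\<close> on two opposite sides of the parallelogram, then along
  \<open>w\<close> to the derivative in direction \<open>v\<close>.\<close>

lemma second_difference_mvt:
  fixes f :: "'a::euclidean_space \<Rightarrow> real"
  assumes "Ck_on 2 U f" "0 < h"
    and "\<And>s t. 0 \<le> s \<Longrightarrow> s \<le> h \<Longrightarrow> 0 \<le> t \<Longrightarrow> t \<le> h \<Longrightarrow> a + s *\<^sub>R v + t *\<^sub>R w \<in> U"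
  shows "\<exists>s t. 0 < s \<and> s < h \<and> 0 < t \<and> t < h \<and>
     f (a + h *\<^sub>R v + h *\<^sub>R w) - f (a + h *\<^sub>R v) - f (a + h *\<^sub>R w) + f a =
     h * h * frechet_derivative (\<lambda>x. frechet_derivative f (at x) v) (at (a + s *\<^sub>R v + t *\<^sub>R w)) w"
proof -
  let ?D = "\<lambda>x. frechet_derivative f (at x) v"
  have f: "(f has_derivative frechet_derivative f (at x)) (at x)" if "x \<in> U" for x
    using assms(1) that by (auto simp: numeral_2_eq_2 frechet_derivative_works)
  have D: "(?D has_derivative frechet_derivative ?D (at x)) (at x)" if "x \<in> U" for x
    using assms(1) that by (auto simp: numeral_2_eq_2 frechet_derivative_works)
  have 1: "((\<lambda>s. f (a + h *\<^sub>R w + s *\<^sub>R v) - f (a + s *\<^sub>R v)) has_real_derivative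
      ?D (a + h *\<^sub>R w + s *\<^sub>R v) - ?D (a + s *\<^sub>R v)) (at s)" if "0 \<le> s" "s \<le> h" for s
    using that assms(2) assms(3)[of s h] assms(3)[of s 0]
    by (intro DERIV_diff line_has_real_derivative f) (auto simp: algebra_simps)
  obtain s where s: "0 < s" "s < h"
    "f (a + h *\<^sub>R w + h *\<^sub>R v) - f (a + h *\<^sub>R v) - (f (a + h *\<^sub>R w + 0 *\<^sub>R v) - f (a + 0 *\<^sub>R v)) =
     (h - 0) * (?D (a + h *\<^sub>R w + s *\<^sub>R v) - ?D (a + s *\<^sub>R v))"
    using MVT2[OF assms(2) 1] by blast
  have 2: "((\<lambda>t. ?D (a + s *\<^sub>R v + t *\<^sub>R w)) has_real_derivative
      frechet_derivative ?D (at (a + s *\<^sub>R v + t *\<^sub>R w)) w) (at t)" if "0 \<le> t" "t \<le> h" for t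
    using that s assms(3)[of s t] by (intro line_has_real_derivative D) auto
  obtain t where t: "0 < t" "t < h" "?D (a + s *\<^sub>R v + h *\<^sub>R w) - ?D (a + s *\<^sub>R v + 0 *\<^sub>R w) =
     (h - 0) * frechet_derivative ?D (at (a + s *\<^sub>R v + t *\<^sub>R w)) w"
    using MVT2[OF assms(2) 2] by blast
  have "f (a + h *\<^sub>R v + h *\<^sub>R w) - f (a + h *\<^sub>R v) - f (a + h *\<^sub>R w) + f a =
     h * (?D (a + s *\<^sub>R v + h *\<^sub>R w) - ?D (a + s *\<^sub>R v))"
    using s(3) by (simp add: algebra_simps)
  also have "\<dots> = h * (h * frechet_derivative ?D (at (a + s *\<^sub>R v + t *\<^sub>R w)) w)"
    using t(3) by simp
  finally show ?thesis using s t by (intro exI[of _ s] exI[of _ t]) (simp add: mult.assoc)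
qed

text \<open>The second difference is symmetric in \<open>v\<close> and \<open>w\<close>, so the two
  mixed derivatives take a common value at two points arbitrarily close to \<open>a\<close>;
  continuity carries the equality to \<open>a\<close>.\<close>

lemma symmetric_second_derivative_real:
  fixes f :: "'a::euclidean_space \<Rightarrow> real"
  assumes "open U" "Ck_on 2 U f" "a \<in> U"
  shows "frechet_derivative (\<lambda>x. frechet_derivative f (at x) v) (at a) w =
         frechet_derivative (\<lambda>x. frechet_derivative f (at x) w) (at a) v" (is "?A a = ?B a")
proof (rule ccontr)
  assume ne: "?A a \<noteq> ?B a"
  \<comment> \<open>Half the gap: the open intervals of radius \<open>e\<close> around the two
    values are disjoint.\<close>
  define e where "e = \<bar>?A a - ?B a\<bar> / 2"
  have e: "e > 0" using ne by (simp add: e_def)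
  have cont: "continuous_on U (\<lambda>x. frechet_derivative (\<lambda>x. frechet_derivative f (at x) v) (at x) w)" for v w
    using assms(2) by (simp add: numeral_2_eq_2)
  have near: "\<exists>r>0. \<forall>x. dist x a < r \<longrightarrow> x \<in> U \<and> dist (g x) (g a) < e" if "continuous_on U g" for g :: "'a \<Rightarrow> real"
  proof -
    have "continuous (at a) g" using that assms(1,3) continuous_on_eq_continuous_at by blast
    then obtain r where "r > 0" "\<And>x. dist x a < r \<Longrightarrow> dist (g x) (g a) < e"
      using e unfolding continuous_at_eps_delta by blast
    moreover obtain r' where "r' > 0" "\<And>x. dist x a < r' \<Longrightarrow> x \<in> U"
      using assms(1,3) unfolding open_dist by blast
    ultimately show ?thesis by (intro exI[of _ "min r r'"]) auto
  qed
  obtain r1 where r1: "r1 > 0" "\<And>x. dist x a < r1 \<Longrightarrow> x \<in> U \<and> dist (?A x) (?A a) < e"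
    using near[OF cont] by blast
  obtain r2 where r2: "r2 > 0" "\<And>x. dist x a < r2 \<Longrightarrow> x \<in> U \<and> dist (?B x) (?B a) < e"
    using near[OF cont] by blast
  define r where "r = min r1 r2"
  \<comment> \<open>Keeps the whole parallelogram within distance r / 2 of \<open>a\<close>; the
    summand 1 covers the case that both vectors vanish.\<close>
  define h where "h = r / (2 * (norm v + norm w + 1))"
  have pos: "norm v + norm w + 1 > 0" by (simp add: add_nonneg_pos)
  have h: "h > 0" using r1 r2 pos by (simp add: h_def r_def)
  have small: "dist (a + s *\<^sub>R v + t *\<^sub>R w) a < r" if "0 \<le> s" "s \<le> h" "0 \<le> t" "t \<le> h" for s t
  proof -
    have "dist (a + s *\<^sub>R v + t *\<^sub>R w) a \<le> s * norm v + t * norm w"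
      using that norm_triangle_ineq[of "s *\<^sub>R v" "t *\<^sub>R w"] by (simp add: dist_norm add.assoc)
    also have "\<dots> \<le> h * norm v + h * norm w" using that by (intro add_mono mult_right_mono) auto
    also have "\<dots> \<le> h * (norm v + norm w + 1)" using h by (simp add: algebra_simps)
    also have "\<dots> = r / 2"
      unfolding h_def using pos by (metis divide_divide_eq_left less_numeral_extra(3) mult.commute nonzero_eq_divide_eq times_divide_eq_left)
    also have "\<dots> < r" using \<open>r1 > 0\<close> \<open>r2 > 0\<close> unfolding r_def by linarith
    finally show ?thesis .
  qed
  have inU: "a + s *\<^sub>R v + t *\<^sub>R w \<in> U" if "0 \<le> s" "s \<le> h" "0 \<le> t" "t \<le> h" for s t
    using small[OF that] r1 by (simp add: r_def)
  obtain s t where st: "0 < s" "s < h" "0 < t" "t < h"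
     "f (a + h *\<^sub>R v + h *\<^sub>R w) - f (a + h *\<^sub>R v) - f (a + h *\<^sub>R w) + f a = h * h * ?A (a + s *\<^sub>R v + t *\<^sub>R w)"
    using second_difference_mvt[OF assms(2) h inU] by blast
  have "a + s *\<^sub>R w + t *\<^sub>R v \<in> U" if "0 \<le> s" "s \<le> h" "0 \<le> t" "t \<le> h" for s t
    using inU[of t s] that by (simp add: algebra_simps)
  from second_difference_mvt[OF assms(2) h this] obtain s' t' where st': "0 < s'" "s' < h" "0 < t'" "t' < h"
     "f (a + h *\<^sub>R w + h *\<^sub>R v) - f (a + h *\<^sub>R w) - f (a + h *\<^sub>R v) + f a = h * h * ?B (a + s' *\<^sub>R w + t' *\<^sub>R v)"
    by blast
  have "h * h * ?A (a + s *\<^sub>R v + t *\<^sub>R w) = h * h * ?B (a + s' *\<^sub>R w + t' *\<^sub>R v)"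
    using st(5) st'(5) by (simp add: algebra_simps)
  then have eq: "?A (a + s *\<^sub>R v + t *\<^sub>R w) = ?B (a + s' *\<^sub>R w + t' *\<^sub>R v)" using h by simp
  have "dist (?A (a + s *\<^sub>R v + t *\<^sub>R w)) (?A a) < e"
    using small[of s t] st r1 by (simp add: r_def)
  moreover have "dist (?B (a + s' *\<^sub>R w + t' *\<^sub>R v)) (?B a) < e"
    using small[of t' s'] st' r2(2)[of "a + s' *\<^sub>R w + t' *\<^sub>R v"] by (simp add: r_def algebra_simps)
  ultimately show False using eq unfolding e_def dist_real_def by argo
qed

lemma frechet_derivative_inner_left:
  fixes f :: "'a::euclidean_space \<Rightarrow> 'b::euclidean_space"
  assumes "f differentiable (at x)"
  shows "frechet_derivative (\<lambda>x. f x \<bullet> b) (at x) = (\<lambda>v. frechet_derivative f (at x) v \<bullet> b)"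
  using assms by (intro frechet_derivative_at[symmetric] has_derivative_inner_left)
    (simp add: frechet_derivative_works)

lemma symmetric_second_derivative:
  fixes f :: "'a::euclidean_space \<Rightarrow> 'b::euclidean_space"
  assumes "open U" "smooth_on U f" "a \<in> U"
  shows "frechet_derivative (\<lambda>x. frechet_derivative f (at x) v) (at a) w =
         frechet_derivative (\<lambda>x. frechet_derivative f (at x) w) (at a) v"
proof (rule euclidean_eqI)
  fix b :: 'b
  have *: "frechet_derivative (\<lambda>x. frechet_derivative (\<lambda>x. f x \<bullet> b) (at x) v) (at a) w =
      frechet_derivative (\<lambda>x. frechet_derivative f (at x) v) (at a) w \<bullet> b" for v w
  proof -
    have d: "(\<lambda>x. frechet_derivative f (at x) v) differentiable (at a)"
      using smooth_on_open_differentiable[OF assms(1) smooth_on_frechet_derivative[OF assms(1,2)] assms(3)] .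
    have "frechet_derivative (\<lambda>x. frechet_derivative (\<lambda>x. f x \<bullet> b) (at x) v) (at a) =
       frechet_derivative (\<lambda>x. frechet_derivative f (at x) v \<bullet> b) (at a)"
      using smooth_on_open_differentiable[OF assms(1,2)] d
      by (intro frechet_derivative_transform_within_open[OF _ assms(1,3), symmetric])
        (auto simp: frechet_derivative_inner_left intro!: differentiable_inner)
    then show ?thesis using frechet_derivative_inner_left[OF d] by simp
  qed
  have "Ck_on 2 U (\<lambda>x. f x \<bullet> b)"
    using assms(1,2) by (intro smooth_on_openD smooth_intros)
  from symmetric_second_derivative_real[OF assms(1) this assms(3)]
  show "frechet_derivative (\<lambda>x. frechet_derivative f (at x) v) (at a) w \<bullet> b =
    frechet_derivative (\<lambda>x. frechet_derivative f (at x) w) (at a) v \<bullet> b"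
    by (simp add: *)
qed

section \<open>Geodesics of \<open>S\<^sup>2 \<times> S\<^sup>1\<close>\<close>

lemma has_vector_derivative_compose:
  assumes "(f has_vector_derivative f') (at t)" "(g has_derivative g') (at (f t))"
  shows "((\<lambda>t. g (f t)) has_vector_derivative g' f') (at t)"
  using vector_derivative_diff_chain_within[OF assms(1) has_derivative_at_withinI[OF assms(2)]]
  by (simp add: o_def)

lemma has_vector_derivative_linear:
  assumes "bounded_linear L" "(f has_vector_derivative f') (at t)"
  shows "((\<lambda>t. L (f t)) has_vector_derivative L f') (at t)"
  by (rule has_vector_derivative_compose[OF assms(2) bounded_linear_imp_has_derivative[OF assms(1)]])

lemma has_vector_derivative_shift:
  assumes "(f has_vector_derivative f') (at (t - t0))"
  shows "((\<lambda>t. f (t - t0)) has_vector_derivative f') (at t)"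
proof -
  have "((\<lambda>t. t - t0) has_vector_derivative 1) (at t)" by (auto intro!: derivative_eq_intros)
  from has_vector_derivative_compose[OF this, of f "\<lambda>x. x *\<^sub>R f'"] assms
  show ?thesis by (simp add: has_vector_derivative_def)
qed

lemma has_vector_derivative_inner:
  assumes "(f has_vector_derivative f') (at t)" "(g has_vector_derivative g') (at t)"
  shows "((\<lambda>t. f t \<bullet> g t) has_vector_derivative (f t \<bullet> g' + f' \<bullet> g t)) (at t)"
  by (rule bounded_bilinear.has_vector_derivative[OF bounded_bilinear_inner assms])

lemma has_vector_derivative_locally_const:
  assumes "(f has_vector_derivative f') (at t)" "open U" "t \<in> U" "\<And>s. s \<in> U \<Longrightarrow> f s = c"
  shows "f' = 0"
proof -
  have "((\<lambda>_. c) has_vector_derivative f') (at t)"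
    by (rule has_vector_derivative_transform_within_open[OF assms(1,2,3)]) (use assms in auto)
  then show ?thesis using vector_derivative_at has_vector_derivative_const by metis
qed

lemma constant_inner_imp_orthogonal:
  fixes f :: "real \<Rightarrow> 'a::real_inner"
  assumes "(f has_vector_derivative f') (at t)" "open U" "t \<in> U" "\<And>s. s \<in> U \<Longrightarrow> f s \<bullet> f s = c"
  shows "f' \<bullet> f t = 0"
proof -
  have "f t \<bullet> f' + f' \<bullet> f t = 0"
    by (rule has_vector_derivative_locally_const[OF has_vector_derivative_inner[OF assms(1,1)] assms(2,3,4)])
  then show ?thesis by (simp add: inner_commute)
qed

text \<open>For \<open>v = 0\<close> the convention \<open>sgn 0 = 0\<close> gives the constant curve.\<close>

definition circ :: "'a::euclidean_space \<Rightarrow> 'a \<Rightarrow> real \<Rightarrow> 'a" where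
  "circ x v s = cos (norm v * s) *\<^sub>R x + sin (norm v * s) *\<^sub>R sgn v"

lemma circ_0 [simp]: "circ x v 0 = x"
  by (simp add: circ_def)

lemma norm_scaleR_sgn: "norm v *\<^sub>R sgn v = (v :: 'a::real_normed_vector)"
  by (cases "v = 0") (auto simp: sgn_div_norm)

lemma smooth_on_circ: "smooth_on S (circ x v)"
  unfolding circ_def by (intro smooth_intros)

lemma smooth_on_circ_compose: "smooth_on S f \<Longrightarrow> smooth_on S (\<lambda>t. circ x v (f t))"
  unfolding circ_def by (intro smooth_intros)

lemma circ_has_vector_derivative:
  "(circ x v has_vector_derivative
     (- (norm v * sin (norm v * s))) *\<^sub>R x + cos (norm v * s) *\<^sub>R v) (at s)"
proof -
  have "(circ x v has_vector_derivative
     (- (norm v * sin (norm v * s))) *\<^sub>R x + (norm v * cos (norm v * s)) *\<^sub>R sgn v) (at s)"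
    unfolding circ_def
    by (auto intro!: derivative_eq_intros simp: algebra_simps)
  moreover have "(norm v * cos (norm v * s)) *\<^sub>R sgn v = cos (norm v * s) *\<^sub>R v"
    by (metis mult.commute norm_scaleR_sgn scaleR_scaleR)
  ultimately show ?thesis by simp
qed

lemma circ_has_vector_derivative_2:
  "((\<lambda>s. (- (norm v * sin (norm v * s))) *\<^sub>R x + cos (norm v * s) *\<^sub>R v) has_vector_derivative
     - (norm v)\<^sup>2 *\<^sub>R circ x v s) (at s)"
proof -
  have "((\<lambda>s. (- (norm v * sin (norm v * s))) *\<^sub>R x + cos (norm v * s) *\<^sub>R v) has_vector_derivative
     (- (norm v * (norm v * cos (norm v * s)))) *\<^sub>R x + (- (norm v * sin (norm v * s))) *\<^sub>R v) (at s)"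
    by (auto intro!: derivative_eq_intros simp: algebra_simps)
  moreover have "(norm v)\<^sup>2 *\<^sub>R sgn v = norm v *\<^sub>R v"
    by (metis norm_scaleR_sgn power2_eq_square scaleR_scaleR)
  ultimately show ?thesis
    by (simp add: circ_def scaleR_add_right mult.commute power2_eq_square[symmetric])
       (metis (no_types, lifting) mult.assoc mult.commute power2_eq_square scaleR_scaleR)
qed

lemma circ_in_sphere:
  assumes "norm x = 1" "v \<bullet> x = 0"
  shows "norm (circ x v s) = 1"
proof (cases "v = 0")
  case True
  then show ?thesis using assms by (simp add: circ_def)
next
  case False
  have "norm (sgn v) = 1" using False by (simp add: norm_sgn)
  then have "sgn v \<bullet> sgn v = 1" using norm_eq_1 by blast
  moreover have "x \<bullet> sgn v = 0" "x \<bullet> x = 1"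
    using assms by (auto simp: norm_eq_1 sgn_div_norm inner_commute)
  ultimately have "circ x v s \<bullet> circ x v s = (cos (norm v * s))\<^sup>2 + (sin (norm v * s))\<^sup>2"
    by (simp add: circ_def inner_add_left inner_add_right inner_commute power2_eq_square)
  then show ?thesis by (simp add: norm_eq_1)
qed

text \<open>The energy |f'|^2 + K |f|^2 is constant and vanishes at \<open>t0\<close>. Since K = 0
  is allowed, it only gives f' = 0, and f = 0 follows from the initial value.\<close>

lemma harmonic_oscillator_zero:
  fixes f :: "real \<Rightarrow> 'a::real_inner"
  assumes "open I" "is_interval I" "t0 \<in> I" "K \<ge> 0"
    and f: "\<And>t. t \<in> I \<Longrightarrow> (f has_vector_derivative f' t) (at t)"
    and f': "\<And>t. t \<in> I \<Longrightarrow> (f' has_vector_derivative - K *\<^sub>R f t) (at t)"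
    and "f t0 = 0" "f' t0 = 0" "t \<in> I"
  shows "f t = 0"
proof -
  have cvx: "convex I" using assms(2) by (simp add: is_interval_convex)
  have "((\<lambda>t. f' t \<bullet> f' t + K * (f t \<bullet> f t)) has_vector_derivative 0) (at t within I)" if "t \<in> I" for t
  proof -
    have "((\<lambda>t. f' t \<bullet> f' t + K * (f t \<bullet> f t)) has_vector_derivative
       (f' t \<bullet> (- K *\<^sub>R f t) + (- K *\<^sub>R f t) \<bullet> f' t) + K * (f t \<bullet> f' t + f' t \<bullet> f t)) (at t)"
      by (intro has_vector_derivative_add has_vector_derivative_inner f f' that
          has_vector_derivative_linear[OF bounded_linear_mult_right])
    then have "((\<lambda>t. f' t \<bullet> f' t + K * (f t \<bullet> f t)) has_vector_derivative 0) (at t)"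
      by (simp add: inner_commute)
    then show ?thesis by (rule has_vector_derivative_at_within)
  qed
  from has_vector_derivative_zero_constant[OF cvx this]
  obtain E where E: "\<And>t. t \<in> I \<Longrightarrow> f' t \<bullet> f' t + K * (f t \<bullet> f t) = E" by blast
  have "E = 0" using E[OF assms(3)] assms(7,8) by simp
  have "f' t = 0" if "t \<in> I" for t
  proof -
    have "f' t \<bullet> f' t \<ge> 0" "K * (f t \<bullet> f t) \<ge> 0" using assms(4) by auto
    then have "f' t \<bullet> f' t = 0" using E[OF that] \<open>E = 0\<close> by linarith
    then show ?thesis by simp
  qed
  then have "(f has_vector_derivative 0) (at t within I)" if "t \<in> I" for t
    using f[OF that] that by (metis has_vector_derivative_at_within)
  from has_vector_derivative_zero_constant[OF cvx this]
  obtain C where "\<And>t. t \<in> I \<Longrightarrow> f t = C" by blast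
  then show ?thesis using assms(3,7,9) by metis
qed

text \<open>Differentiating f . f = 1 twice gives f'' . f = - |f'|^2. The acceleration is normal, so
  the speed is constant and f'' = - k f with k = |f'|^2. The circle solves the same equation with
  the same initial data, and the difference vanishes by conservation of energy.\<close>

lemma circ_unique:
  fixes f :: "real \<Rightarrow> 'a::euclidean_space"
  assumes "open I" "is_interval I" "t0 \<in> I"
    and f: "\<And>t. t \<in> I \<Longrightarrow> (f has_vector_derivative f' t) (at t)"
    and f': "\<And>t. t \<in> I \<Longrightarrow> (f' has_vector_derivative f'' t) (at t)"
    and par: "\<And>t. t \<in> I \<Longrightarrow> f'' t = (f'' t \<bullet> f t) *\<^sub>R f t"
    and sph: "\<And>t. t \<in> I \<Longrightarrow> norm (f t) = 1"
    and "t \<in> I"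
  shows "f t = circ (f t0) (f' t0) (t - t0)"
proof -
  have cvx: "convex I" using assms(2) by (simp add: is_interval_convex)
  have orth: "f' t \<bullet> f t = 0" if "t \<in> I" for t
    by (rule constant_inner_imp_orthogonal[OF f[OF that] assms(1) that]) (use sph norm_eq_1 in blast)
  have acc: "f'' t \<bullet> f t = - (f' t \<bullet> f' t)" if "t \<in> I" for t
  proof -
    have "f' t \<bullet> f' t + f'' t \<bullet> f t = 0"
      by (rule has_vector_derivative_locally_const[OF has_vector_derivative_inner[OF f'[OF that] f[OF that]] assms(1) that orth])
    then show ?thesis by simp
  qed
  have "((\<lambda>t. f' t \<bullet> f' t) has_vector_derivative 0) (at t within I)" if "t \<in> I" for t
  proof -
    have "f'' t \<bullet> f' t = 0"
      by (subst par[OF that]) (use orth[OF that] in \<open>simp add: inner_commute\<close>)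
    then have "((\<lambda>t. f' t \<bullet> f' t) has_vector_derivative 0) (at t)"
      using has_vector_derivative_inner[OF f'[OF that] f'[OF that]] by (simp add: inner_commute)
    then show ?thesis by (rule has_vector_derivative_at_within)
  qed
  from has_vector_derivative_zero_constant[OF cvx this]
  obtain k where k: "\<And>t. t \<in> I \<Longrightarrow> f' t \<bullet> f' t = k" by blast
  let ?v = "f' t0" and ?x = "f t0"
  let ?g' = "\<lambda>t. (- (norm ?v * sin (norm ?v * (t - t0)))) *\<^sub>R ?x + cos (norm ?v * (t - t0)) *\<^sub>R ?v"
  have kv: "(norm ?v)\<^sup>2 = k" using k[OF assms(3)] by (simp add: power2_norm_eq_inner)
  have "f t - circ ?x ?v (t - t0) = 0"
  proof (rule harmonic_oscillator_zero[OF assms(1-3), where K = k and f = "\<lambda>t. f t - circ ?x ?v (t - t0)" and f' = "\<lambda>t. f' t - ?g' t"])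
    fix t assume t: "t \<in> I"
    show "((\<lambda>t. f t - circ ?x ?v (t - t0)) has_vector_derivative f' t - ?g' t) (at t)"
      by (intro has_vector_derivative_diff f t has_vector_derivative_shift circ_has_vector_derivative)
    have "f'' t = - k *\<^sub>R f t" using par[OF t] acc[OF t] k[OF t] by simp
    then show "((\<lambda>t. f' t - ?g' t) has_vector_derivative - k *\<^sub>R (f t - circ ?x ?v (t - t0))) (at t)"
      using has_vector_derivative_diff[OF f'[OF t] has_vector_derivative_shift[OF circ_has_vector_derivative_2[of ?v ?x]]]
      by (simp add: kv algebra_simps)
  qed (use k[OF assms(3)] assms in auto)
  then show ?thesis by simp
qed

section \<open>Tangent vectors, candidate geodesics and the ambient bilinear form\<close>

abbreviation S2S1 :: "((real^3) \<times> complex) set" where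
  "S2S1 \<equiv> sphere 0 1 \<times> sphere 0 1"

definition geo :: "(real^3) \<times> complex \<Rightarrow> (real^3) \<times> complex \<Rightarrow> real \<Rightarrow> (real^3) \<times> complex" where
  "geo p w s = (circ (fst p) (fst w) s, circ (snd p) (snd w) s)"

lemma geo_0 [simp]: "geo p w 0 = p"
  by (simp add: geo_def)

lemma smooth_on_geo: "smooth_on S (geo p w)"
  unfolding geo_def by (intro smooth_intros smooth_on_circ)

definition tangent :: "(real^3) \<times> complex \<Rightarrow> (real^3) \<times> complex \<Rightarrow> bool" where
  "tangent p w \<longleftrightarrow> fst w \<bullet> fst p = 0 \<and> snd w \<bullet> snd p = 0"

lemma geo_in_S2S1: "p \<in> S2S1 \<Longrightarrow> tangent p w \<Longrightarrow> geo p w s \<in> S2S1"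
  by (auto simp: geo_def tangent_def circ_in_sphere)

definition geo' :: "(real^3) \<times> complex \<Rightarrow> (real^3) \<times> complex \<Rightarrow> real \<Rightarrow> (real^3) \<times> complex" where
  "geo' p w s = ((- (norm (fst w) * sin (norm (fst w) * s))) *\<^sub>R fst p + cos (norm (fst w) * s) *\<^sub>R fst w,
     (- (norm (snd w) * sin (norm (snd w) * s))) *\<^sub>R snd p + cos (norm (snd w) * s) *\<^sub>R snd w)"

lemma geo_has_vector_derivative: "(geo p w has_vector_derivative geo' p w s) (at s)"
  unfolding geo_def geo'_def by (intro has_vector_derivative_Pair circ_has_vector_derivative)

lemma geo'_has_vector_derivative:
  "(geo' p w has_vector_derivative
     (- (norm (fst w))\<^sup>2 *\<^sub>R fst (geo p w s), - (norm (snd w))\<^sup>2 *\<^sub>R snd (geo p w s))) (at s)"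
  unfolding geo_def geo'_def fst_conv snd_conv
  by (intro has_vector_derivative_Pair circ_has_vector_derivative_2)

lemma vector_derivative_geo [simp]: "vector_derivative (geo p w) (at s) = geo' p w s"
  using geo_has_vector_derivative vector_derivative_at by blast

lemma geo'_0 [simp]: "geo' p w 0 = w"
  by (simp add: geo'_def)

lemma S2S1_velocity_tangent:
  assumes "open I" "s \<in> I" "\<And>t. t \<in> I \<Longrightarrow> \<gamma> t \<in> S2S1" "(\<gamma> has_vector_derivative w) (at s)"
  shows "tangent (\<gamma> s) w"
  unfolding tangent_def
proof
  have *: "fst (\<gamma> t) \<bullet> fst (\<gamma> t) = 1" "snd (\<gamma> t) \<bullet> snd (\<gamma> t) = 1" if "t \<in> I" for t
    using assms(3)[OF that] by (auto simp: norm_eq_1[symmetric] mem_Times_iff)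
  show "fst w \<bullet> fst (\<gamma> s) = 0"
    by (rule constant_inner_imp_orthogonal[OF has_vector_derivative_linear[OF bounded_linear_fst assms(4)] assms(1,2)])
       (use * in auto)
  show "snd w \<bullet> snd (\<gamma> s) = 0"
    by (rule constant_inner_imp_orthogonal[OF has_vector_derivative_linear[OF bounded_linear_snd assms(4)] assms(1,2)])
       (use * in auto)
qed

lemma tangent_vectors_S2S1:
  assumes "p \<in> S2S1"
  shows "tangent_vectors S2S1 p = {w. tangent p w}"
proof (intro equalityI subsetI; simp)
  fix w assume "w \<in> tangent_vectors S2S1 p"
  then obtain \<alpha> where \<alpha>: "w = vector_derivative \<alpha> (at 0)" "smooth_on UNIV \<alpha>" "range \<alpha> \<subseteq> S2S1" "\<alpha> 0 = p"
    unfolding tangent_vectors_def by blast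
  have "(\<alpha> has_vector_derivative w) (at 0)"
    using smooth_on_vector_derivative(1)[OF open_UNIV \<alpha>(2)] \<alpha>(1) by simp
  from S2S1_velocity_tangent[OF open_UNIV UNIV_I _ this] \<alpha> show "tangent p w" by blast
next
  fix w assume "tangent p w"
  then show "w \<in> tangent_vectors S2S1 p"
    unfolding tangent_vectors_def using geo_in_S2S1[OF assms, of w] smooth_on_geo[of UNIV p w]
    by (intro CollectI exI[of _ "geo p w"]) (simp add: image_subset_iff)
qed

definition gform :: "nat \<Rightarrow> nat \<Rightarrow> (real^3) \<times> complex \<Rightarrow> (real^3) \<times> complex \<Rightarrow> real" where
  "gform c d v w = fst v \<bullet> fst w - (real d)\<^sup>2 / (real c)\<^sup>2 * (snd v \<bullet> snd w)"

lemma bounded_bilinear_gform: "bounded_bilinear (gform c d)"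
  unfolding bilinear_conv_bounded_bilinear[symmetric] bilinear_def gform_def
  by (auto intro!: linearI simp: inner_add_left inner_add_right add_divide_distrib algebra_simps)

lemma gform_commute: "gform c d v w = gform c d w v"
  by (simp add: gform_def inner_commute)

text \<open>Lagrange's identity in the plane: the product equals |z|^2 times the inner product, up
  to a correction containing the vanishing factor \<tau> . z. This makes the metric a restriction of
  \<open>gform\<close>.\<close>

lemma dt_mult_dt:
  assumes "norm z = 1" "\<tau> \<bullet> z = 0" "\<sigma> \<bullet> z = 0"
  shows "dt z \<tau> * dt z \<sigma> = \<tau> \<bullet> \<sigma>"
proof -
  have 1: "(Re z)\<^sup>2 + (Im z)\<^sup>2 = 1" using assms(1) by (simp add: cmod_def)
  have 2: "Re \<tau> * Re z + Im \<tau> * Im z = 0" using assms(2) by (simp add: inner_complex_def)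
  have "dt z \<tau> * dt z \<sigma> = (\<tau> \<bullet> \<sigma>) * ((Re z)\<^sup>2 + (Im z)\<^sup>2) -
      (Re \<tau> * Re z + Im \<tau> * Im z) * (\<sigma> \<bullet> z)"
    by (simp add: dt_def inner_complex_def power2_eq_square algebra_simps)
  then show ?thesis using 1 2 by simp
qed

lemma metric_eq_gform:
  assumes "p \<in> S2S1" "tangent p v" "tangent p w"
  shows "metric (S2xS1 c d) p v w = gform c d v w"
  using assms dt_mult_dt[of "snd p" "snd v" "snd w"]
  by (cases p; cases v; cases w) (auto simp: S2xS1_def gform_def tangent_def mult.assoc)

lemma points_S2xS1 [simp]: "points (S2xS1 c d) = S2S1" and charts_S2xS1: "charts (S2xS1 c d) = local_params S2S1"
  by (auto simp: S2xS1_def)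

section \<open>The geodesic equation in a chart\<close>

context
  fixes U :: "(real^3) set" and \<phi> :: "real^3 \<Rightarrow> (real^3) \<times> complex"
  assumes chart: "(U, \<phi>) \<in> local_params S2S1"
begin

lemma chart_open: "open U" and chart_smooth: "smooth_on U \<phi>" and chart_inj: "inj_on \<phi> U"
  and chart_image_openin: "openin (top_of_set S2S1) (\<phi> ` U)"
  and chart_inverse_smooth: "smooth_on (\<phi> ` U) (the_inv_into U \<phi>)"
  using chart by (auto simp: local_params_def)

lemma chart_in_S2S1: "u \<in> U \<Longrightarrow> \<phi> u \<in> S2S1"
  using chart_image_openin openin_imp_subset by blast

lemma chart_has_derivative: "u \<in> U \<Longrightarrow> (\<phi> has_derivative frechet_derivative \<phi> (at u)) (at u)"
  using smooth_on_open_differentiable[OF chart_open chart_smooth] frechet_derivative_works by blast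

lemma chart_derivative_tangent:
  assumes "u \<in> U"
  shows "tangent (\<phi> u) (frechet_derivative \<phi> (at u) v)"
proof -
  let ?l = "\<lambda>t. u + t *\<^sub>R v"
  have "open (?l -` U)"
    by (intro open_vimage chart_open continuous_intros)
  moreover have "((\<lambda>t. \<phi> (?l t)) has_vector_derivative frechet_derivative \<phi> (at u) v) (at 0)"
    by (rule has_vector_derivative_compose[where f = ?l and g = \<phi>])
       (auto intro!: derivative_eq_intros simp: chart_has_derivative assms)
  ultimately show ?thesis
    using S2S1_velocity_tangent[of "?l -` U" 0 "\<lambda>t. \<phi> (?l t)"] assms chart_in_S2S1 by auto
qed

abbreviation D2 :: "real^3 \<Rightarrow> real^3 \<Rightarrow> real^3 \<Rightarrow> (real^3) \<times> complex" where
  "D2 u j i \<equiv> frechet_derivative (\<lambda>u. frechet_derivative \<phi> (at u) j) (at u) i"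

lemma D2_has_derivative:
  "u \<in> U \<Longrightarrow> ((\<lambda>u. frechet_derivative \<phi> (at u) j) has_derivative D2 u j) (at u)"
  using smooth_on_open_differentiable[OF chart_open smooth_on_frechet_derivative[OF chart_open chart_smooth]]
    frechet_derivative_works by blast

lemma metric_coeff_eq:
  assumes "u \<in> U"
  shows "metric_coeff (S2xS1 c d) \<phi> i j u =
    gform c d (frechet_derivative \<phi> (at u) i) (frechet_derivative \<phi> (at u) j)"
  unfolding metric_coeff_def
  by (rule metric_eq_gform[OF chart_in_S2S1[OF assms] chart_derivative_tangent[OF assms] chart_derivative_tangent[OF assms]])

lemma metric_coeff_derivative:
  assumes "u \<in> U"
  shows "frechet_derivative (metric_coeff (S2xS1 c d) \<phi> j k) (at u) i =
    gform c d (frechet_derivative \<phi> (at u) j) (D2 u k i) + gform c d (D2 u j i) (frechet_derivative \<phi> (at u) k)"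
proof -
  let ?g = "\<lambda>u. gform c d (frechet_derivative \<phi> (at u) j) (frechet_derivative \<phi> (at u) k)"
  have d: "(?g has_derivative (\<lambda>i. gform c d (frechet_derivative \<phi> (at u) j) (D2 u k i) +
      gform c d (D2 u j i) (frechet_derivative \<phi> (at u) k))) (at u)"
    by (intro bounded_bilinear.FDERIV[OF bounded_bilinear_gform] D2_has_derivative assms)
  then have "(metric_coeff (S2xS1 c d) \<phi> j k has_derivative (\<lambda>i. gform c d (frechet_derivative \<phi> (at u) j) (D2 u k i) +
      gform c d (D2 u j i) (frechet_derivative \<phi> (at u) k))) (at u)"
    by (rule has_derivative_transform_within_open[OF _ chart_open assms]) (simp only: metric_coeff_eq)
  from frechet_derivative_at[OF this, symmetric] show ?thesis by simp
qed

text \<open>By the product rule the three metric derivatives contribute six terms. Symmetry of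
  \<open>D2\<close> cancels four of them and makes the other two equal, which absorbs the division
  by 2.\<close>

lemma christoffel_eq:
  assumes "u \<in> U"
  shows "christoffel (S2xS1 c d) \<phi> i j k u = gform c d (D2 u j i) (frechet_derivative \<phi> (at u) k)"
proof -
  have "D2 u a b = D2 u b a" for a b
    by (rule symmetric_second_derivative[OF chart_open chart_smooth assms])
  then show ?thesis
    unfolding christoffel_def metric_coeff_derivative[OF assms]
    by (simp add: gform_commute[of c d "frechet_derivative \<phi> (at u) _"])
qed

text \<open>Openness of \<open>V\<close> comes from relative openness of chart images, and
  differentiating \<phi> o x = \<gamma> expands the velocity in the coordinate frame. The last
  clause serves twice: to compute the acceleration, and to show that the frame spans every tangent
  vector.\<close>

lemma chart_coordinates:
  assumes "open I" "smooth_on I \<gamma>" "\<gamma> ` I \<subseteq> S2S1"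
  defines "V \<equiv> I \<inter> \<gamma> -` (\<phi> ` U)" and "x \<equiv> the_inv_into U \<phi> \<circ> \<gamma>"
  shows "open V" "smooth_on V x" "\<And>t. t \<in> V \<Longrightarrow> x t \<in> U \<and> \<phi> (x t) = \<gamma> t"
    "\<And>t. t \<in> V \<Longrightarrow> (\<gamma> has_vector_derivative
        (\<Sum>j\<in>Basis. (vector_derivative x (at t) \<bullet> j) *\<^sub>R frechet_derivative \<phi> (at (x t)) j)) (at t)"
proof -
  obtain W where W: "open W" "\<phi> ` U = S2S1 \<inter> W"
    using chart_image_openin by (auto simp: openin_open)
  have "V = I \<inter> \<gamma> -` W" using assms(3) W by (auto simp: V_def)
  then show op: "open V"
    using W(1) assms(1) smooth_on_imp_continuous_on[OF assms(2)] by (simp add: continuous_open_preimage)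
  show sm: "smooth_on V x"
    unfolding x_def o_def
    by (rule smooth_on_compose[OF chart_inverse_smooth smooth_on_subset[OF assms(2)]]) (auto simp: V_def)
  show x: "x t \<in> U \<and> \<phi> (x t) = \<gamma> t" if "t \<in> V" for t
    using that f_the_inv_into_f[OF chart_inj] the_inv_into_into[OF chart_inj]
    by (auto simp: V_def x_def the_inv_into_f_f[OF chart_inj])
  show "(\<gamma> has_vector_derivative
        (\<Sum>j\<in>Basis. (vector_derivative x (at t) \<bullet> j) *\<^sub>R frechet_derivative \<phi> (at (x t)) j)) (at t)"
    if "t \<in> V" for t
  proof -
    let ?D = "frechet_derivative \<phi> (at (x t))" and ?x' = "vector_derivative x (at t)"
    have "((\<lambda>t. \<phi> (x t)) has_vector_derivative ?D ?x') (at t)"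
      by (rule has_vector_derivative_compose[OF smooth_on_vector_derivative(1)[OF op sm that] chart_has_derivative])
         (use x that in auto)
    then have "(\<gamma> has_vector_derivative ?D ?x') (at t)"
      by (rule has_vector_derivative_transform_within_open[OF _ op that]) (use x in auto)
    moreover have "?D ?x' = (\<Sum>j\<in>Basis. (?x' \<bullet> j) *\<^sub>R ?D j)"
      using linear_basis_expansion[OF has_derivative_linear[OF chart_has_derivative]] x that by blast
    ultimately show ?thesis by simp
  qed
qed

text \<open>Since \<open>gform\<close> has constant coefficients, the Christoffel symbols are
  \<open>gform (\<partial>\<^sub>i \<partial>\<^sub>j \<phi>) (\<partial>\<^sub>k \<phi>)\<close>, and the geodesic equation says that the ambient acceleration is
  orthogonal to the tangent space.\<close>

lemma geodesic_equation_ambient: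
  assumes "open I" "smooth_on I \<gamma>" "\<gamma> ` I \<subseteq> S2S1" "s \<in> I" "\<gamma> s \<in> \<phi> ` U"
  defines "x \<equiv> the_inv_into U \<phi> \<circ> \<gamma>"
  defines "x' \<equiv> \<lambda>s. vector_derivative x (at s)"
  defines "x'' \<equiv> \<lambda>s. vector_derivative x' (at s)"
  shows "(\<Sum>j\<in>Basis. metric_coeff (S2xS1 c d) \<phi> j k (x s) * (x'' s \<bullet> j))
       + (\<Sum>i\<in>Basis. \<Sum>j\<in>Basis. christoffel (S2xS1 c d) \<phi> i j k (x s) * (x' s \<bullet> i) * (x' s \<bullet> j))
       = gform c d (vector_derivative (\<lambda>t. vector_derivative \<gamma> (at t)) (at s)) (frechet_derivative \<phi> (at (x s)) k)"
proof -
  define V where "V = I \<inter> \<gamma> -` (\<phi> ` U)"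
  note co = chart_coordinates[OF assms(1-3), folded x_def V_def]
  have s: "s \<in> V" using assms(4,5) by (simp add: V_def)
  have xU: "x s \<in> U" using co(3)[OF s] by blast
  have dx: "(x has_vector_derivative x' s) (at s)"
    using smooth_on_vector_derivative(1)[OF co(1,2) s] by (simp add: x'_def)
  have dx': "(x' has_vector_derivative x'' s) (at s)"
    using smooth_on_vector_derivative(1)[OF co(1) smooth_on_vector_derivative(2)[OF co(1,2)] s]
    by (simp add: x'_def x''_def)
  let ?D = "\<lambda>u j. frechet_derivative \<phi> (at u) j"
  let ?acc = "\<Sum>j\<in>Basis. (x' s \<bullet> j) *\<^sub>R D2 (x s) j (x' s) + (x'' s \<bullet> j) *\<^sub>R ?D (x s) j"
  have "((\<lambda>t. \<Sum>j\<in>Basis. (x' t \<bullet> j) *\<^sub>R ?D (x t) j) has_vector_derivative ?acc) (at s)"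
  proof (intro has_vector_derivative_sum bounded_bilinear.has_vector_derivative[OF bounded_bilinear_scaleR])
    fix j :: "real^3"
    show "((\<lambda>t. ?D (x t) j) has_vector_derivative D2 (x s) j (x' s)) (at s)"
      by (rule has_vector_derivative_compose[OF dx D2_has_derivative[OF xU]])
    show "((\<lambda>t. x' t \<bullet> j) has_vector_derivative x'' s \<bullet> j) (at s)"
      using has_vector_derivative_linear[OF bounded_linear_inner_left dx'] .
  qed
  then have "((\<lambda>t. vector_derivative \<gamma> (at t)) has_vector_derivative ?acc) (at s)"
  proof (rule has_vector_derivative_transform_within_open[OF _ co(1) s])
    fix t assume "t \<in> V"
    from vector_derivative_at[OF co(4)[OF this]]
    show "(\<Sum>j\<in>Basis. (x' t \<bullet> j) *\<^sub>R ?D (x t) j) = vector_derivative \<gamma> (at t)" by (simp add: x'_def)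
  qed
  then have acc: "vector_derivative (\<lambda>t. vector_derivative \<gamma> (at t)) (at s) = ?acc"
    by (rule vector_derivative_at)
  interpret g: bounded_bilinear "gform c d" by (rule bounded_bilinear_gform)
  have lin: "D2 (x s) j (x' s) = (\<Sum>i\<in>Basis. (x' s \<bullet> i) *\<^sub>R D2 (x s) j i)" for j
    by (rule linear_basis_expansion[OF has_derivative_linear[OF D2_has_derivative[OF xU]]])
  have "gform c d ?acc (?D (x s) k) =
     (\<Sum>j\<in>Basis. (x' s \<bullet> j) * gform c d (D2 (x s) j (x' s)) (?D (x s) k) + (x'' s \<bullet> j) * gform c d (?D (x s) j) (?D (x s) k))"
    by (simp add: g.sum_left g.add_left g.scaleR_left)
  also have "\<dots> = (\<Sum>j\<in>Basis. (x'' s \<bullet> j) * gform c d (?D (x s) j) (?D (x s) k)) +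
      (\<Sum>j\<in>Basis. \<Sum>i\<in>Basis. (x' s \<bullet> j) * ((x' s \<bullet> i) * gform c d (D2 (x s) j i) (?D (x s) k)))"
    unfolding lin by (simp only: g.sum_left g.scaleR_left sum.distrib sum_distrib_left real_scaleR_def add.commute)
  also have "\<dots> = (\<Sum>j\<in>Basis. metric_coeff (S2xS1 c d) \<phi> j k (x s) * (x'' s \<bullet> j))
       + (\<Sum>i\<in>Basis. \<Sum>j\<in>Basis. christoffel (S2xS1 c d) \<phi> i j k (x s) * (x' s \<bullet> i) * (x' s \<bullet> j))"
    unfolding metric_coeff_eq[OF xU] christoffel_eq[OF xU]
    by (subst (2) sum.swap) (simp add: mult_ac)
  finally show ?thesis unfolding acc by simp
qed

end

text \<open>The remainder \<open>r\<close> is orthogonal to all three vectors. Then r x (x x u) = 0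
  by the triple product formula, and |r x n|^2 + (r . n)^2 = |r|^2 |n|^2 forces r = 0.\<close>

lemma orthonormal_frame:
  fixes x u y :: "real^3"
  assumes "norm x = 1" "norm u = 1" "x \<bullet> u = 0"
  shows "y = (y \<bullet> x) *\<^sub>R x + (y \<bullet> u) *\<^sub>R u + (y \<bullet> cross3 x u) *\<^sub>R cross3 x u"
proof -
  let ?n = "cross3 x u"
  define r where "r = y - ((y \<bullet> x) *\<^sub>R x + (y \<bullet> u) *\<^sub>R u + (y \<bullet> ?n) *\<^sub>R ?n)"
  have n: "x \<bullet> ?n = 0" "u \<bullet> ?n = 0" "?n \<bullet> x = 0" "?n \<bullet> u = 0"
    by (simp_all add: dot_cross_self)
  have "(norm ?n)\<^sup>2 = 1" using norm_cross[of x u] assms by simp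
  then have nn: "?n \<bullet> ?n = 1" by (simp add: power2_norm_eq_inner)
  have xx: "x \<bullet> x = 1" "u \<bullet> u = 1" "u \<bullet> x = 0" using assms by (auto simp: norm_eq_1 inner_commute)
  have r: "r \<bullet> x = 0" "r \<bullet> u = 0" "r \<bullet> ?n = 0"
    unfolding r_def by (simp_all add: inner_diff_left inner_add_left xx nn n assms(3))
  have "cross3 r ?n = 0" using r by (simp add: Lagrange)
  then have "(norm r)\<^sup>2 * (norm ?n)\<^sup>2 = 0" using norm_cross[of r ?n] r(3) by simp
  then have "r = 0" using \<open>(norm ?n)\<^sup>2 = 1\<close> by simp
  then show ?thesis by (simp add: r_def)
qed

lemma norm_cross3_orthonormal:
  assumes "norm x = 1" "norm u = 1" "x \<bullet> u = 0"
  shows "norm (cross3 x u) = 1"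
proof -
  have "(norm (cross3 x u))\<^sup>2 = 1\<^sup>2" using norm_cross[of x u] assms by simp
  then show ?thesis by (rule power2_eq_imp_eq) auto
qed

lemma smooth_on_sgn:
  fixes f :: "'a::euclidean_space \<Rightarrow> 'b::euclidean_space"
  assumes "smooth_on S f" "\<And>x. x \<in> S \<Longrightarrow> f x \<noteq> 0"
  shows "smooth_on S (\<lambda>x. sgn (f x))"
  unfolding sgn_div_norm by (intro smooth_intros assms) (use assms in auto)

lemma circle_frame:
  assumes "norm z = 1"
  shows "w = (w \<bullet> z) *\<^sub>R z + (w \<bullet> (\<i> * z)) *\<^sub>R (\<i> * z)"
proof -
  have "(Re z)\<^sup>2 + (Im z)\<^sup>2 = 1" using assms by (simp add: cmod_def)
  then show ?thesis
    by (simp add: complex_eq_iff inner_complex_def power2_eq_square) algebra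
qed

text \<open>Central projection from the tangent plane gives a chart at each point.\<close>

lemma S2S1_chart_exists:
  assumes p: "p \<in> S2S1"
  obtains U :: "(real^3) set" and \<phi> where "(U, \<phi>) \<in> local_params S2S1" "p \<in> \<phi> ` U"
proof -
  obtain x z where xz: "p = (x, z)" "norm x = 1" "norm z = 1" using p by auto
  obtain e0 where "e0 \<noteq> 0" "orthogonal x e0"
    using orthogonal_to_vector_exists[of x] by auto
  define e where "e = sgn e0"
  have e: "norm e = 1" "x \<bullet> e = 0"
    using \<open>e0 \<noteq> 0\<close> \<open>orthogonal x e0\<close> by (auto simp: e_def norm_sgn orthogonal_def sgn_div_norm)
  define n where "n = cross3 x e"
  have n: "norm n = 1" "x \<bullet> n = 0" "e \<bullet> n = 0"
    using norm_cross3_orthonormal[OF xz(2) e] by (auto simp: n_def dot_cross_self)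
  have sq: "x \<bullet> x = 1" "e \<bullet> e = 1" "n \<bullet> n = 1" "z \<bullet> z = 1" "z \<bullet> (\<i> * z) = 0" "(\<i> * z) \<bullet> (\<i> * z) = 1"
    using xz e n norm_mult[of \<i> z] by (auto simp only: norm_eq_1[symmetric]) (auto simp: inner_complex_def)
  define a where "a u = x + (u$1) *\<^sub>R e + (u$2) *\<^sub>R n" for u :: "real^3"
  define b where "b u = z + (u$3) *\<^sub>R (\<i> * z)" for u :: "real^3"
  define \<phi> where "\<phi> u = (sgn (a u), sgn (b u))" for u
  define \<psi> where "\<psi> q = ((fst q \<bullet> e) / (fst q \<bullet> x)) *\<^sub>R axis 1 (1::real) + ((fst q \<bullet> n) / (fst q \<bullet> x)) *\<^sub>R axis 2 1 +
      ((snd q \<bullet> (\<i> * z)) / (snd q \<bullet> z)) *\<^sub>R (axis 3 1 :: real^3)" for q :: "(real^3) \<times> complex"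
  have ab: "a u \<bullet> x = 1" "a u \<bullet> e = u$1" "a u \<bullet> n = u$2" "b u \<bullet> z = 1" "b u \<bullet> (\<i> * z) = u$3" for u
    using e n by (simp_all only: a_def b_def inner_add_left inner_scaleR_left sq inner_commute[of e x] inner_commute[of n x]
      inner_commute[of n e] inner_commute[of "\<i> * z" z]) simp_all?
  have ne: "a u \<noteq> 0" "b u \<noteq> 0" for u using ab[of u] by auto
  have smooth: "smooth_on UNIV \<phi>"
    unfolding \<phi>_def a_def b_def
    by (intro smooth_intros smooth_on_sgn smooth_on_linear_compose[OF bounded_linear_vec_nth])
       (use ne in \<open>auto simp: a_def b_def\<close>)
  \<comment> \<open>On these open half-spaces the projection can be inverted by dividing by the
    components along \<open>x\<close> and \<open>z\<close>; they cut out of \<open>S2S1\<close>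
    exactly the image of the chart.\<close>
  define W where "W = {q :: (real^3) \<times> complex. fst q \<bullet> x > 0 \<and> snd q \<bullet> z > 0}"
  have "open W" unfolding W_def by (intro open_Collect_conj open_Collect_less continuous_intros)
  have \<psi>\<phi>: "\<psi> (\<phi> u) = u" for u
  proof -
    have "norm (a u) \<noteq> 0" "norm (b u) \<noteq> 0" using ne by auto
    then show ?thesis
      unfolding \<psi>_def \<phi>_def sgn_div_norm fst_conv snd_conv
      by (simp only: inner_scaleR_left ab) (simp add: vec_eq_iff forall_3 axis_def)
  qed
  have \<phi>W: "\<phi> u \<in> S2S1 \<inter> W" for u
    using ne[of u] by (simp add: \<phi>_def W_def norm_sgn sgn_div_norm ab)
  have \<phi>\<psi>: "\<phi> (\<psi> q) = q" if q: "q \<in> S2S1 \<inter> W" for q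
  proof -
    obtain y w where yw: "q = (y, w)" "norm y = 1" "norm w = 1" "y \<bullet> x > 0" "w \<bullet> z > 0"
      using q by (auto simp: W_def)
    have comp: "\<psi> q $ 1 = (y \<bullet> e) / (y \<bullet> x)" "\<psi> q $ 2 = (y \<bullet> n) / (y \<bullet> x)" "\<psi> q $ 3 = (w \<bullet> (\<i> * z)) / (w \<bullet> z)"
      by (auto simp: \<psi>_def yw axis_def)
    have "(y \<bullet> x) *\<^sub>R a (\<psi> q) = (y \<bullet> x) *\<^sub>R x + (y \<bullet> e) *\<^sub>R e + (y \<bullet> n) *\<^sub>R n"
      using yw(4) by (simp add: a_def comp scaleR_add_right)
    also have "\<dots> = y" using orthonormal_frame[OF xz(2) e, of y] by (simp add: n_def)
    finally have 1: "sgn y = sgn (a (\<psi> q))" using yw(4) by (metis sgn_scaleR sgn_pos scaleR_one)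
    have "(w \<bullet> z) *\<^sub>R b (\<psi> q) = (w \<bullet> z) *\<^sub>R z + (w \<bullet> (\<i> * z)) *\<^sub>R (\<i> * z)"
      using yw(5) by (simp add: b_def comp scaleR_add_right)
    also have "\<dots> = w" using circle_frame[OF xz(3), of w] by simp
    finally have 2: "sgn w = sgn (b (\<psi> q))" using yw(5) by (metis sgn_scaleR sgn_pos scaleR_one)
    show ?thesis using 1 2 yw by (simp add: \<phi>_def sgn_div_norm)
  qed
  have im: "range \<phi> = S2S1 \<inter> W" 
  proof (intro equalityI subsetI)
    show "q \<in> S2S1 \<inter> W" if "q \<in> range \<phi>" for q using that \<phi>W by (auto simp del: mem_sphere)
    show "q \<in> range \<phi>" if "q \<in> S2S1 \<inter> W" for q using \<phi>\<psi>[OF that] by (metis rangeI)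
  qed
  have inj: "inj \<phi>" using \<psi>\<phi> by (metis injI)
  have "smooth_on (range \<phi>) \<psi>"
    unfolding \<psi>_def im by (intro smooth_intros) (auto simp: W_def)
  then have "smooth_on (range \<phi>) (the_inv_into UNIV \<phi>)"
    by (rule smooth_on_cong) (use inj \<psi>\<phi> in \<open>auto simp: the_inv_f_f\<close>)
  then have "(UNIV, \<phi>) \<in> local_params S2S1"
    using smooth inj im \<open>open W\<close> by (auto simp: local_params_def openin_open)
  moreover have "p \<in> range \<phi>" unfolding im using p sq by (auto simp: W_def xz)
  ultimately show ?thesis using that by blast
qed

section \<open>Classification of the geodesics\<close>

abbreviation acceleration :: "(real \<Rightarrow> (real^3) \<times> complex) \<Rightarrow> real \<Rightarrow> (real^3) \<times> complex" where
  "acceleration \<gamma> s \<equiv> vector_derivative (\<lambda>t. vector_derivative \<gamma> (at t)) (at s)"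

lemma geodesic_chart_iff:
  "is_geodesic (S2xS1 c d) I \<gamma> \<longleftrightarrow> open I \<and> is_interval I \<and> I \<noteq> {} \<and> smooth_on I \<gamma> \<and> \<gamma> ` I \<subseteq> S2S1 \<and>
     (\<forall>(U :: (real^3) set, \<phi>)\<in>local_params S2S1. \<forall>s\<in>I. \<gamma> s \<in> \<phi> ` U \<longrightarrow>
       (\<forall>k\<in>Basis. gform c d (acceleration \<gamma> s) (frechet_derivative \<phi> (at (the_inv_into U \<phi> (\<gamma> s))) k) = 0))"
  unfolding is_geodesic_def charts_S2xS1 points_S2xS1
proof (intro conj_cong refl ball_cong, goal_cases)
  case (1 x)
  obtain U \<phi> where x: "x = (U, \<phi>)" by (cases x)
  note eq = geodesic_equation_ambient[OF 1(6)[unfolded x] 1(1,4,5), unfolded o_apply]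
  show ?case
    unfolding x prod.case Let_def o_apply by (intro ball_cong refl imp_cong) (simp only: eq)
qed

text \<open>Testing against coordinate frames and against all tangent vectors is the same: frame
  vectors are tangent, and conversely a tangent \<open>w\<close> is the initial velocity of the
  curve \<open>geo (\<gamma> s) w\<close>, whose expression in the chart writes \<open>w\<close> in
  the frame.\<close>

lemma geodesic_ambient_iff:
  "is_geodesic (S2xS1 c d) I \<gamma> \<longleftrightarrow> open I \<and> is_interval I \<and> I \<noteq> {} \<and> smooth_on I \<gamma> \<and> \<gamma> ` I \<subseteq> S2S1 \<and>
     (\<forall>s\<in>I. \<forall>w. tangent (\<gamma> s) w \<longrightarrow> gform c d (acceleration \<gamma> s) w = 0)"
  unfolding geodesic_chart_iff
proof (intro conj_cong refl iffI)
  assume I: "open I" "smooth_on I \<gamma>" "\<gamma> ` I \<subseteq> S2S1"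
    and L: "\<forall>(U :: (real^3) set, \<phi>)\<in>local_params S2S1. \<forall>s\<in>I. \<gamma> s \<in> \<phi> ` U \<longrightarrow>
       (\<forall>k\<in>Basis. gform c d (acceleration \<gamma> s) (frechet_derivative \<phi> (at (the_inv_into U \<phi> (\<gamma> s))) k) = 0)"
  show "\<forall>s\<in>I. \<forall>w. tangent (\<gamma> s) w \<longrightarrow> gform c d (acceleration \<gamma> s) w = 0"
  proof (intro ballI allI impI)
    fix s w
    assume s: "s \<in> I" and w: "tangent (\<gamma> s) w"
    interpret g: bounded_bilinear "gform c d" by (rule bounded_bilinear_gform)
    have p: "\<gamma> s \<in> S2S1" using I s by blast
    obtain U :: "(real^3) set" and \<phi> where \<phi>: "(U, \<phi>) \<in> local_params S2S1" "\<gamma> s \<in> \<phi> ` U"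
      using S2S1_chart_exists[OF p] .
    let ?u = "the_inv_into U \<phi> (\<gamma> s)"
    have eq: "gform c d (acceleration \<gamma> s) (frechet_derivative \<phi> (at ?u) k) = 0" if "k \<in> Basis" for k
      using bspec[OF L \<phi>(1), unfolded prod.case, rule_format, OF s \<phi>(2) that] .
    have "(geo (\<gamma> s) w has_vector_derivative (\<Sum>j\<in>Basis. (vector_derivative (the_inv_into U \<phi> \<circ> geo (\<gamma> s) w) (at 0) \<bullet> j)
       *\<^sub>R frechet_derivative \<phi> (at ((the_inv_into U \<phi> \<circ> geo (\<gamma> s) w) 0)) j)) (at 0)"
      by (rule chart_coordinates(4)[OF \<phi>(1) open_UNIV smooth_on_geo])
         (use geo_in_S2S1[OF p w] \<phi>(2) in \<open>simp_all add: image_subset_iff\<close>)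
    from vector_derivative_at[OF this]
    have "w = (\<Sum>j\<in>Basis. (vector_derivative (the_inv_into U \<phi> \<circ> geo (\<gamma> s) w) (at 0) \<bullet> j)
       *\<^sub>R frechet_derivative \<phi> (at ?u) j)" by simp
    then obtain f where "w = (\<Sum>j\<in>Basis. f j *\<^sub>R frechet_derivative \<phi> (at ?u) j)" by blast
    then show "gform c d (acceleration \<gamma> s) w = 0" using eq by (simp add: g.sum_right g.scaleR_right)
  qed
next
  assume R: "\<forall>s\<in>I. \<forall>w. tangent (\<gamma> s) w \<longrightarrow> gform c d (acceleration \<gamma> s) w = 0"
  have "gform c d (acceleration \<gamma> s) (frechet_derivative \<phi> (at (the_inv_into U \<phi> (\<gamma> s))) k) = 0"
    if \<phi>: "(U, \<phi>) \<in> local_params S2S1" and s: "s \<in> I" and im: "\<gamma> s \<in> \<phi> ` U"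
    for U :: "(real^3) set" and \<phi> s k
  proof -
    have "the_inv_into U \<phi> (\<gamma> s) \<in> U" "\<phi> (the_inv_into U \<phi> (\<gamma> s)) = \<gamma> s"
      using chart_inj[OF \<phi>] im by (auto simp: the_inv_into_f_f)
    then have "tangent (\<gamma> s) (frechet_derivative \<phi> (at (the_inv_into U \<phi> (\<gamma> s))) k)"
      using chart_derivative_tangent[OF \<phi>] by metis
    then show ?thesis by (rule R[THEN bspec, OF s, THEN spec, THEN mp])
  qed
  then show "\<forall>(U :: (real^3) set, \<phi>)\<in>local_params S2S1. \<forall>s\<in>I. \<gamma> s \<in> \<phi> ` U \<longrightarrow>
       (\<forall>k\<in>Basis. gform c d (acceleration \<gamma> s) (frechet_derivative \<phi> (at (the_inv_into U \<phi> (\<gamma> s))) k) = 0)"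
    by blast
qed

lemma geo_shift_is_geodesic:
  assumes "p \<in> S2S1" "tangent p w" "open I" "is_interval I" "I \<noteq> {}"
  shows "is_geodesic (S2xS1 c d) I (\<lambda>s. geo p w (s - s0))"
  unfolding geodesic_ambient_iff
proof (intro conjI ballI allI impI)
  show "smooth_on I (\<lambda>s. geo p w (s - s0))"
    unfolding geo_def by (intro smooth_intros smooth_on_circ_compose)
  show "(\<lambda>s. geo p w (s - s0)) ` I \<subseteq> S2S1" using geo_in_S2S1[OF assms(1,2)] by blast
  fix s v
  assume "s \<in> I" and v: "tangent (geo p w (s - s0)) v"
  have vd: "vector_derivative (\<lambda>s. geo p w (s - s0)) (at t) = geo' p w (t - s0)" for t
    by (rule vector_derivative_at[OF has_vector_derivative_shift[OF geo_has_vector_derivative]])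
  have "vector_derivative (\<lambda>t. vector_derivative (\<lambda>s. geo p w (s - s0)) (at t)) (at s) =
    (- (norm (fst w))\<^sup>2 *\<^sub>R fst (geo p w (s - s0)), - (norm (snd w))\<^sup>2 *\<^sub>R snd (geo p w (s - s0)))"
    unfolding vd by (rule vector_derivative_at[OF has_vector_derivative_shift[OF geo'_has_vector_derivative]])
  then show "gform c d (vector_derivative (\<lambda>t. vector_derivative (\<lambda>s. geo p w (s - s0)) (at t)) (at s)) v = 0"
    using v by (simp add: gform_def tangent_def inner_commute)
qed (use assms in auto)

lemma geo_is_geodesic:
  assumes "p \<in> S2S1" "tangent p w"
  shows "is_geodesic (S2xS1 c d) UNIV (geo p w)"
  using geo_shift_is_geodesic[OF assms, of UNIV c d 0] by simp

lemma orthogonal_complement_sphere: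
  fixes a x :: "'a::real_inner"
  assumes "norm x = 1" "\<And>v. v \<bullet> x = 0 \<Longrightarrow> a \<bullet> v = 0"
  shows "a = (a \<bullet> x) *\<^sub>R x"
proof -
  let ?v = "a - (a \<bullet> x) *\<^sub>R x"
  have vx: "?v \<bullet> x = 0" using assms(1) by (simp add: inner_diff_left norm_eq_1)
  then have "a \<bullet> ?v = 0" by (rule assms(2))
  then have "?v \<bullet> ?v = 0" using vx by (simp add: inner_diff_left inner_diff_right inner_commute)
  then show ?thesis by simp
qed

text \<open>Tangent vectors of the forms (v, 0) and (0, v) split the equation into its two factors;
  the second factor needs d^2 / c^2 to be nonzero. Each component then has acceleration parallel to
  its position, so \<open>circ_unique\<close> applies.\<close>

lemma geodesic_imp_geo:
  assumes "is_geodesic (S2xS1 c d) I \<gamma>" "s0 \<in> I" "c \<ge> 1" "d \<ge> 1"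
  defines "w \<equiv> vector_derivative \<gamma> (at s0)"
  shows "\<gamma> s0 \<in> S2S1" "tangent (\<gamma> s0) w" "\<And>s. s \<in> I \<Longrightarrow> \<gamma> s = geo (\<gamma> s0) w (s - s0)"
proof -
  have I: "open I" "is_interval I" "smooth_on I \<gamma>" "\<gamma> ` I \<subseteq> S2S1"
    and eq: "\<And>s w. s \<in> I \<Longrightarrow> tangent (\<gamma> s) w \<Longrightarrow> gform c d (vector_derivative (\<lambda>t. vector_derivative \<gamma> (at t)) (at s)) w = 0"
    using assms(1) unfolding geodesic_ambient_iff by auto
  define \<gamma>' where "\<gamma>' t = vector_derivative \<gamma> (at t)" for t
  define \<gamma>'' where "\<gamma>'' t = vector_derivative \<gamma>' (at t)" for t
  have d1: "(\<gamma> has_vector_derivative \<gamma>' t) (at t)" if "t \<in> I" for t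
    unfolding \<gamma>'_def by (rule smooth_on_vector_derivative(1)[OF I(1,3) that])
  have d2: "(\<gamma>' has_vector_derivative \<gamma>'' t) (at t)" if "t \<in> I" for t
    unfolding \<gamma>'_def[abs_def] \<gamma>''_def
    by (rule smooth_on_vector_derivative(1)[OF I(1) smooth_on_vector_derivative(2)[OF I(1,3)] that])
  have n: "norm (fst (\<gamma> t)) = 1" "norm (snd (\<gamma> t)) = 1" if "t \<in> I" for t
    using I(4) that by (auto simp: mem_Times_iff image_subset_iff)
  have eq': "gform c d (\<gamma>'' t) v = 0" if "t \<in> I" "tangent (\<gamma> t) v" for t v
    using eq[OF that] by (simp add: \<gamma>''_def \<gamma>'_def[abs_def])
  have par1: "fst (\<gamma>'' t) = (fst (\<gamma>'' t) \<bullet> fst (\<gamma> t)) *\<^sub>R fst (\<gamma> t)" if t: "t \<in> I" for t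
  proof (rule orthogonal_complement_sphere[OF n(1)[OF t]])
    show "fst (\<gamma>'' t) \<bullet> v = 0" if "v \<bullet> fst (\<gamma> t) = 0" for v
      using eq'[OF t, of "(v, 0)"] that by (simp add: tangent_def gform_def)
  qed
  have par2: "snd (\<gamma>'' t) = (snd (\<gamma>'' t) \<bullet> snd (\<gamma> t)) *\<^sub>R snd (\<gamma> t)" if t: "t \<in> I" for t
  proof (rule orthogonal_complement_sphere[OF n(2)[OF t]])
    show "snd (\<gamma>'' t) \<bullet> v = 0" if "v \<bullet> snd (\<gamma> t) = 0" for v
      using eq'[OF t, of "(0, v)"] that assms(3,4) by (simp add: tangent_def gform_def)
  qed
  show "\<gamma> s0 \<in> S2S1" using I assms(2) by blast
  show "tangent (\<gamma> s0) w"
    unfolding w_def \<gamma>'_def[symmetric] by (rule S2S1_velocity_tangent[OF I(1) assms(2) _ d1[OF assms(2)]]) (use I in blast)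
  fix s assume s: "s \<in> I"
  have "fst (\<gamma> s) = circ (fst (\<gamma> s0)) (fst (\<gamma>' s0)) (s - s0)"
    by (rule circ_unique[OF I(1,2) assms(2) has_vector_derivative_linear[OF bounded_linear_fst d1]
          has_vector_derivative_linear[OF bounded_linear_fst d2] par1 n(1) s])
  moreover have "snd (\<gamma> s) = circ (snd (\<gamma> s0)) (snd (\<gamma>' s0)) (s - s0)"
    by (rule circ_unique[OF I(1,2) assms(2) has_vector_derivative_linear[OF bounded_linear_snd d1]
          has_vector_derivative_linear[OF bounded_linear_snd d2] par2 n(2) s])
  ultimately show "\<gamma> s = geo (\<gamma> s0) w (s - s0)"
    by (simp add: geo_def prod_eq_iff w_def \<gamma>'_def)
qed

text \<open>Every geodesic is the restriction of a curve \<open>geo\<close> defined on the whole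
  line, so maximality forces the full domain.\<close>

lemma maximal_geodesic_iff:
  assumes "c \<ge> 1" "d \<ge> 1"
  shows "maximal_geodesic (S2xS1 c d) I \<gamma> \<longleftrightarrow> I = UNIV \<and> (\<exists>p w. p \<in> S2S1 \<and> tangent p w \<and> \<gamma> = geo p w)"
proof
  assume L: "maximal_geodesic (S2xS1 c d) I \<gamma>"
  then have g: "is_geodesic (S2xS1 c d) I \<gamma>" by (simp add: maximal_geodesic_def)
  then obtain s0 where s0: "s0 \<in> I" unfolding is_geodesic_def by blast
  note geo = geodesic_imp_geo[OF g s0 assms]
  let ?w = "vector_derivative \<gamma> (at s0)"
  have "is_geodesic (S2xS1 c d) UNIV (\<lambda>s. geo (\<gamma> s0) ?w (s - s0))"
    by (rule geo_shift_is_geodesic[OF geo(1,2)]) auto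
  then have ex: "is_geodesic (S2xS1 c d) UNIV (\<lambda>s. geo (\<gamma> s0) ?w (s - s0)) \<and> I \<subseteq> UNIV \<and>
      (\<forall>s\<in>I. geo (\<gamma> s0) ?w (s - s0) = \<gamma> s)" using geo(3) by simp
  have "\<forall>J \<delta>. is_geodesic (S2xS1 c d) J \<delta> \<and> I \<subseteq> J \<and> (\<forall>s\<in>I. \<delta> s = \<gamma> s) \<longrightarrow> J = I"
    using L by (simp add: maximal_geodesic_def)
  from this[THEN spec, THEN spec, THEN mp, OF ex] have U: "I = UNIV" by (rule sym)
  then have 0: "0 \<in> I" by simp
  note geo' = geodesic_imp_geo[OF g 0 assms]
  have "\<gamma> = geo (\<gamma> 0) (vector_derivative \<gamma> (at 0))"
    by (rule ext, rule geo'(3)[unfolded diff_zero]) (simp add: U)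
  with U geo'(1,2) show "I = UNIV \<and> (\<exists>p w. p \<in> S2S1 \<and> tangent p w \<and> \<gamma> = geo p w)"
    by (intro conjI exI)
next
  assume "I = UNIV \<and> (\<exists>p w. p \<in> S2S1 \<and> tangent p w \<and> \<gamma> = geo p w)"
  then show "maximal_geodesic (S2xS1 c d) I \<gamma>"
    unfolding maximal_geodesic_def using geo_is_geodesic by blast
qed

lemma geodesic_of_eq:
  assumes "c \<ge> 1" "d \<ge> 1" "p \<in> S2S1" "tangent p w"
  shows "geodesic_of (S2xS1 c d) (p, w) = range (geo p w)"
  unfolding geodesic_of_def prod.case
proof (rule the_equality)
  show "\<exists>I \<gamma>. maximal_geodesic (S2xS1 c d) I \<gamma> \<and> 0 \<in> I \<and> \<gamma> 0 = p \<and>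
     vector_derivative \<gamma> (at 0) = w \<and> range (geo p w) = \<gamma> ` I"
  proof -
    have "maximal_geodesic (S2xS1 c d) UNIV (geo p w)"
      unfolding maximal_geodesic_iff[OF assms(1,2)] using assms(3,4) by blast
    then show ?thesis by (intro exI[of _ UNIV] exI[of _ "geo p w"]) simp
  qed
next
  fix \<Gamma>
  assume "\<exists>I \<gamma>. maximal_geodesic (S2xS1 c d) I \<gamma> \<and> 0 \<in> I \<and> \<gamma> 0 = p \<and>
     vector_derivative \<gamma> (at 0) = w \<and> \<Gamma> = \<gamma> ` I"
  then obtain q v where "geo q v 0 = p" "vector_derivative (geo q v) (at 0) = w" "\<Gamma> = range (geo q v)"
    using maximal_geodesic_iff[OF assms(1,2)] by auto
  then show "\<Gamma> = range (geo p w)" by simp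
qed

section \<open>The space of null geodesics\<close>

definition STS :: "((real^3) \<times> (real^3)) set" where
  "STS = {(x, u). norm x = 1 \<and> norm u = 1 \<and> x \<bullet> u = 0}"

lemma STS_iff [simp]: "(x, u) \<in> STS \<longleftrightarrow> norm x = 1 \<and> norm u = 1 \<and> x \<bullet> u = 0"
  by (simp add: STS_def)

lemma pts_STS2 [simp]: "pts STS2 = STS" and funs_STS2 [simp]: "funs STS2 = {f. smooth_on STS f}"
  by (auto simp: STS2_def embedded_def STS_def)

lemma rot_0 [simp]: "rot 0 w = w"
  by (simp add: rot_def split_beta)

lemma rot_rot: "rot a (rot b w) = rot (a + b) w"
  by (simp add: rot_def split_beta cos_add sin_add scaleR_add_left scaleR_add_right scaleR_diff_left algebra_simps)

lemma rot_2pi_int: "rot (a + 2 * pi * of_int j) w = rot a w"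
proof -
  have "sin (a + 2 * pi * of_int j) = sin a" "cos (a + 2 * pi * of_int j) = cos a"
    by (simp_all add: sin_add cos_add)
  then show ?thesis by (simp add: rot_def)
qed

lemma rot_in_STS: "w \<in> STS \<Longrightarrow> rot \<theta> w \<in> STS"
proof -
  assume "w \<in> STS"
  then obtain x u where w: "w = (x, u)" "x \<bullet> x = 1" "u \<bullet> u = 1" "x \<bullet> u = 0" "u \<bullet> x = 0"
    by (cases w) (auto simp: norm_eq_1 inner_commute)
  have cs: "cos \<theta> * cos \<theta> + sin \<theta> * sin \<theta> = 1" using sin_cos_squared_add3[of \<theta>] by simp
  show ?thesis
    using w cs by (simp add: rot_def norm_eq_1 inner_add_left inner_add_right inner_diff_left inner_diff_right) 
qed

text \<open>\<open>rot\<close> turns x and u within the plane they span, so the unit normal stays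
  fixed along a geodesic. This is why all skies along it can be described with the single vector
  \<open>nvec w\<close>.\<close>

lemma cross3_rot: "cross3 (fst (rot \<theta> w)) (snd (rot \<theta> w)) = cross3 (fst w) (snd w)"
proof -
  obtain x u where w: "w = (x, u)" by (cases w)
  have "cross3 (fst (rot \<theta> w)) (snd (rot \<theta> w)) =
      (cos \<theta> * cos \<theta>) *\<^sub>R cross3 x u + (sin \<theta> * sin \<theta>) *\<^sub>R cross3 x u"
    using cross_skew[of u x]
    by (simp add: w rot_def cross_add_left cross_add_right cross_mult_left cross_mult_right
        cross_minus_left cross_minus_right power2_eq_square scaleR_add_left cross_refl
        Cross3.left_diff_distrib Cross3.right_diff_distrib)
  also have "\<dots> = cross3 x u"
    using sin_cos_squared_add3[of \<theta>] by (simp add: scaleR_add_left[symmetric])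
  finally show ?thesis by (simp add: w)
qed

lemma smooth_on_rot:
  assumes "smooth_on S \<theta>" "smooth_on S f"
  shows "smooth_on S (\<lambda>t. rot (\<theta> t) (f t))"
  unfolding rot_def split_beta by (intro smooth_intros assms)

lemma range_shift:
  fixes f :: "'a::group_add \<Rightarrow> 'b"
  shows "range (\<lambda>j. f (j + k)) = range f"
proof (intro equalityI image_subsetI)
  show "f j \<in> range (\<lambda>j. f (j + k))" for j by (rule image_eqI[of _ _ "j - k"]) auto
qed auto

text \<open>Reparametrising by \<theta> moves the rotation of the initial data into a shift of the
  circle coordinate, so geodesics over the same great circle differ only by a phase.\<close>

lemma to_null_rot:
  "to_null c d (rot \<theta> w) = range (\<lambda>s. (fst (rot s w), cis (real c / real d * (s - \<theta>))))"
proof -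
  have *: "to_null c d w = range (\<lambda>s. (fst (rot s w), cis (real c / real d * s)))" for w
    by (auto simp: to_null_def rot_def split_beta)
  have "range (\<lambda>s. (fst (rot (s + \<theta>) w), cis (real c / real d * s))) =
        range (\<lambda>s. (fst (rot s w), cis (real c / real d * (s - \<theta>))))"
    using range_shift[of "\<lambda>s. (fst (rot s w), cis (real c / real d * (s - \<theta>)))" \<theta>] by simp
  then show ?thesis by (simp add: * rot_rot)
qed

lemma to_null_alt: "to_null c d w = range (\<lambda>s. (fst (rot s w), cis (real c / real d * s)))"
  using to_null_rot[of c d 0 w] by simp

lemma cis_eq_iff: "cis a = cis b \<longleftrightarrow> (\<exists>j::int. a = b + 2 * pi * of_int j)"
proof
  assume "cis a = cis b"
  then have "cis (a - b) = 1" by (simp add: cis_divide[symmetric])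
  then have "cos (a - b) = 1" by (metis cis.simps(1) one_complex.simps(1))
  then obtain j :: int where "a - b = of_int j * 2 * pi" using cos_one_2pi_int by blast
  then show "\<exists>j::int. a = b + 2 * pi * of_int j" by (intro exI[of _ j]) (simp add: algebra_simps)
next
  assume "\<exists>j::int. a = b + 2 * pi * of_int j"
  then show "cis a = cis b" by (auto simp: cis_mult[symmetric])
qed

section \<open>Fibres of \<open>to_null\<close>\<close>

locale coprime_pair =
  fixes c d :: nat
  assumes c: "c \<ge> 1" and d: "d \<ge> 1" and coprime: "gcd c d = 1"
begin

lemma cd_pos [simp]: "0 < c" "0 < d" "c \<noteq> 0" "d \<noteq> 0" "real c \<noteq> 0" "real d \<noteq> 0" "real c > 0" "real d > 0"
  using c d by auto

text \<open>By Bezout d is invertible modulo c, so its multiples meet all residues. The angles 2 pi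
  d j / c are those at which the circle factor returns to its starting point.\<close>

lemma Zc_orbit_eq: "Zc_orbit c w = range (\<lambda>j::int. rot (2 * pi * real d * of_int j / real c) w)"
proof (unfold Zc_orbit_def, intro equalityI image_subsetI)
  fix j :: int
  obtain a b where "a * int d + b * int c = gcd (int d) (int c)" using bezout_int by blast
  moreover have "gcd (int d) (int c) = 1" using coprime by (simp add: gcd_int_int_eq gcd.commute)
  ultimately have ab: "a * int d + b * int c = 1" by simp
  have j: "real_of_int j = real d * of_int (j * a) + real c * of_int (j * b)"
    using arg_cong[OF ab, of "\<lambda>k. of_int (j * k) :: real"] by (simp add: algebra_simps)
  have "2 * pi * real_of_int j / real c = 2 * pi * real d * of_int (j * a) / real c + 2 * pi * of_int (j * b)"
    using arg_cong[OF j, of "\<lambda>r. 2 * pi * r / real c"]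
    by (simp only:) (simp add: add_divide_distrib distrib_left mult.assoc)
  then have "rot (2 * pi * of_int j / real c) w = rot (2 * pi * real d * of_int (j * a) / real c) w"
    by (simp only: rot_2pi_int)
  then show "rot (2 * pi * of_int j / real c) w \<in> range (\<lambda>j::int. rot (2 * pi * real d * of_int j / real c) w)"
    by blast
  show "rot (2 * pi * real d * of_int j / real c) w \<in> range (\<lambda>j::int. rot (2 * pi * of_int j / real c) w)"
    by (rule image_eqI[of _ _ "int d * j"]) (auto simp: mult.assoc)
qed

lemma Zc_orbit_self: "w \<in> Zc_orbit c w"
  unfolding Zc_orbit_def by (rule image_eqI[of _ _ 0]) auto

lemma Zc_orbit_eqI:
  assumes "w' \<in> Zc_orbit c w"
  shows "Zc_orbit c w' = Zc_orbit c w"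
proof -
  obtain k :: int where w': "w' = rot (2 * pi * of_int k / real c) w" using assms unfolding Zc_orbit_def by blast
  have *: "2 * pi * of_int j / real c + 2 * pi * of_int k / real c = 2 * pi * of_int (j + k) / real c" for j k
    by (simp add: add_divide_distrib distrib_left)
  show ?thesis
    unfolding Zc_orbit_def w' rot_rot *
    by (rule range_shift[of "\<lambda>j. rot (2 * pi * of_int j / real c) w"])
qed

lemma to_null_Zc_orbit:
  assumes "w' \<in> Zc_orbit c w"
  shows "to_null c d w' = to_null c d w"
proof -
  obtain j :: int where w': "w' = rot (2 * pi * real d * of_int j / real c) w" using assms unfolding Zc_orbit_eq by blast
  have "cis (real c / real d * (s - 2 * pi * real d * of_int j / real c)) = cis (real c / real d * s)" for s
    unfolding cis_eq_iff by (rule exI[of _ "- j"]) (simp add: field_simps)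
  then show ?thesis unfolding w' to_null_rot by (simp only: to_null_alt[of c d w])
qed

text \<open>Comparing the two geodesics at the parameter \<open>\<pi> / (2 c)\<close> excludes that they run through the
  same points in opposite directions.\<close>

lemma to_null_same_base:
  assumes "(x, u) \<in> STS" "(x, v) \<in> STS" "to_null c d (x, u) = to_null c d (x, v)"
  shows "u = v"
proof -
  define s where "s = pi / (2 * real c)"
  have "(cos s *\<^sub>R x + sin s *\<^sub>R u, cis (real c / real d * s)) \<in> to_null c d (x, u)"
    unfolding to_null_def prod.case by (rule rangeI)
  then have "(cos s *\<^sub>R x + sin s *\<^sub>R u, cis (real c / real d * s)) \<in> to_null c d (x, v)"
    using assms(3) by simp
  then obtain t where t: "cos s *\<^sub>R x + sin s *\<^sub>R u = cos t *\<^sub>R x + sin t *\<^sub>R v"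
    "cis (real c / real d * t) = cis (real c / real d * s)"
    unfolding to_null_def by auto
  obtain j :: int where "real c / real d * t = real c / real d * s + 2 * pi * of_int j"
    using t(2) cis_eq_iff by blast
  then have tj: "t = s + 2 * pi * real d * of_int j / real c"
    by (simp add: field_simps)
  have "cos s = cos t"
  proof -
    have "(cos s *\<^sub>R x + sin s *\<^sub>R u) \<bullet> x = (cos t *\<^sub>R x + sin t *\<^sub>R v) \<bullet> x" using t by simp
    then show ?thesis using assms(1,2) by (simp add: inner_add_left inner_add_right inner_commute norm_eq_1)
  qed
  then obtain n where n: "n \<in> \<int>" "s = t + 2 * n * pi \<or> s = - t + 2 * n * pi" using cos_eq by blast
  then obtain m :: int where m: "n = of_int m" by (auto elim: Ints_cases)
  \<comment> \<open>Equal cosines leave t = s or t = - s modulo 2 pi. For s = pi / (2 c) the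
    reflected case would give 1 = 2 (m c - d j), contradicting parity.\<close>
  have "s \<noteq> - t + 2 * n * pi"
  proof
    assume "s = - t + 2 * n * pi"
    then have "2 * s = 2 * pi * (of_int m - real d * of_int j / real c)" unfolding tj m by (simp add: algebra_simps)
    then have "pi = pi * (2 * (of_int m * real c - real d * of_int j))" unfolding s_def by (simp add: field_simps)
    then have "real_of_int 1 = of_int (2 * (m * int c - int d * j))" by simp
    then have "1 = 2 * (m * int c - int d * j)" by (simp only: of_int_eq_iff)
    then show False by presburger
  qed
  then have "s = t + 2 * pi * of_int m" using n m by simp
  then have "sin s = sin t" by (simp add: sin_add)
  then have "sin s *\<^sub>R u = sin s *\<^sub>R v" using t(1) \<open>cos s = cos t\<close> by simp
  moreover have "sin s > 0"
    using c by (intro sin_gt_zero) (auto simp: s_def field_simps)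
  ultimately show ?thesis by simp
qed

text \<open>The geodesic of w' passes over its base point at circle coordinate 1. The geodesic of w
  does so only at a parameter 2 pi d j / c, that is, at an element of the orbit of w; with equal
  base points \<open>to_null_same_base\<close> identifies the directions.\<close>

lemma to_null_eq_iff:
  assumes "w \<in> STS" "w' \<in> STS"
  shows "to_null c d w' = to_null c d w \<longleftrightarrow> w' \<in> Zc_orbit c w"
proof
  assume eq: "to_null c d w' = to_null c d w"
  have "(fst w', 1) \<in> to_null c d w'"
    unfolding to_null_alt by (rule image_eqI[of _ _ 0]) auto
  then have "(fst w', 1) \<in> to_null c d w" using eq by simp
  then obtain s where s: "fst w' = fst (rot s w)" "cis (real c / real d * s) = 1"
    unfolding to_null_alt by auto
  then obtain j :: int where "real c / real d * s = 2 * pi * of_int j"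
    using cis_eq_iff[of _ 0] by auto
  then have sj: "s = 2 * pi * real d * of_int j / real c" by (simp add: field_simps)
  then have orb: "rot s w \<in> Zc_orbit c w" unfolding Zc_orbit_eq by blast
  have "snd w' = snd (rot s w)"
  proof (rule to_null_same_base)
    show "(fst w', snd w') \<in> STS" "(fst w', snd (rot s w)) \<in> STS"
      using assms rot_in_STS[OF assms(1), of s] s by (auto simp: STS_def split_beta)
    show "to_null c d (fst w', snd w') = to_null c d (fst w', snd (rot s w))"
    proof -
      have "(fst w', snd (rot s w)) = rot s w" using s(1) by (simp add: prod_eq_iff)
      then show ?thesis using eq to_null_Zc_orbit[OF orb] by simp
    qed
  qed
  then have "w' = rot s w" using s(1) by (simp add: prod_eq_iff)
  then show "w' \<in> Zc_orbit c w" using orb by simp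
qed (rule to_null_Zc_orbit)

section \<open>Null vectors and smooth functions on the space of null geodesics\<close>

lemma future_null_iff:
  "(p, w) \<in> future_null (S2xS1 c d) \<longleftrightarrow> p \<in> S2S1 \<and> tangent p w \<and> gform c d w w = 0 \<and> dt (snd p) (snd w) > 0"
proof -
  have "metric (S2xS1 c d) p w (future (S2xS1 c d) p) < 0 \<longleftrightarrow> dt (snd p) (snd w) > 0" if "p \<in> S2S1"
  proof -
    have "norm (snd p) = 1" using that by auto
    then have "(Re (snd p))\<^sup>2 + (Im (snd p))\<^sup>2 = 1" by (simp add: cmod_def)
    then have "dt (snd p) (\<i> * snd p) = 1"
      by (simp add: dt_def power2_eq_square add.commute)
    moreover have "metric (S2xS1 c d) p w (future (S2xS1 c d) p) =
        - ((real d)\<^sup>2 / (real c)\<^sup>2 * (dt (snd p) (snd w) * dt (snd p) (\<i> * snd p)))"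
      by (cases p; cases w) (simp add: S2xS1_def mult.assoc)
    ultimately have "metric (S2xS1 c d) p w (future (S2xS1 c d) p) =
        - ((real d)\<^sup>2 / (real c)\<^sup>2 * dt (snd p) (snd w))" by simp
    moreover have "- (k * t) < 0 \<longleftrightarrow> t > 0" if "k > 0" for k t :: real
      using that by (simp add: zero_less_mult_iff)
    moreover have "(real d)\<^sup>2 / (real c)\<^sup>2 > 0" using c d by simp
    ultimately show ?thesis by metis
  qed
  moreover have "metric (S2xS1 c d) p w w = gform c d w w" if "p \<in> S2S1" "tangent p w"
    using metric_eq_gform that by blast
  ultimately show ?thesis
    unfolding future_null_def by (auto simp: tangent_vectors_S2S1 simp del: mem_sphere)
qed

text \<open>Nullity forces |v| = (d / c) |\<tau>|, so after rescaling time the spatial speed is 1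
  and the circle speed c / d. Rotating back by (d / c) \<theta> moves the starting point to circle
  coordinate 1. The argument \<theta> of z is left free so that a locally smooth choice can be
  inserted later.\<close>

lemma geodesic_of_future_null:
  assumes "((x, z), (v, \<tau>)) \<in> future_null (S2xS1 c d)" "cis \<theta> = z"
  shows "(x, sgn v) \<in> STS" "v \<noteq> 0"
    "geodesic_of (S2xS1 c d) ((x, z), (v, \<tau>)) = to_null c d (rot (- (real d / real c * \<theta>)) (x, sgn v))"
proof -
  have p: "(x, z) \<in> S2S1" "tangent (x, z) (v, \<tau>)" and g: "gform c d (v, \<tau>) (v, \<tau>) = 0" and a: "dt z \<tau> > 0"
    using assms(1) future_null_iff by auto
  have z: "norm z = 1" using p by simp
  have tz: "\<tau> \<bullet> z = 0" using p by (simp add: tangent_def)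
  have "dt z \<tau> = \<tau> \<bullet> (\<i> * z)" by (simp add: dt_def inner_complex_def)
  then have \<tau>: "\<tau> = dt z \<tau> *\<^sub>R (\<i> * z)" using circle_frame[OF z, of \<tau>] tz by simp
  then have n\<tau>: "norm \<tau> = dt z \<tau>" using a z by (metis abs_of_pos mult.right_neutral mult_1 norm_ii norm_mult norm_scaleR)
  then have ntpos: "norm \<tau> > 0" using a by simp
  have "norm (\<i> * z) = 1" using z by (simp add: norm_mult)
  then have st: "sgn \<tau> = \<i> * z" using a by (subst \<tau>) (simp add: sgn_scaleR sgn_div_norm)
  have "norm v * norm v = (real d / real c * norm \<tau>) * (real d / real c * norm \<tau>)"
    using g by (simp add: gform_def power2_norm_eq_inner[symmetric] power2_eq_square)
  then have nv: "norm v = real d / real c * norm \<tau>"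
    using ntpos c d by (simp add: power2_eq_square[symmetric] power2_eq_iff_nonneg)
  then show "v \<noteq> 0" using ntpos c d by auto
  then have sv: "norm (sgn v) = 1" by (simp add: norm_sgn)
  have "x \<bullet> sgn v = 0" using p by (simp add: tangent_def sgn_div_norm inner_commute)
  with sv p show "(x, sgn v) \<in> STS" by simp
  have "geodesic_of (S2xS1 c d) ((x, z), (v, \<tau>)) = range (geo (x, z) (v, \<tau>))"
    by (rule geodesic_of_eq[OF c d p])
  also have "\<dots> = range (\<lambda>s. (fst (rot s (x, sgn v)), z * cis (real c / real d * s)))"
  proof -
    have *: "geo (x, z) (v, \<tau>) s = (fst (rot (norm v * s) (x, sgn v)), z * cis (real c / real d * (norm v * s)))" for s
    proof -
      have "real c / real d * (norm v * s) = norm \<tau> * s" using nv by simp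
      moreover have "circ z \<tau> s = z * cis (norm \<tau> * s)"
        unfolding circ_def st by (simp add: complex_eq_iff algebra_simps)
      ultimately show ?thesis by (simp add: geo_def circ_def rot_def)
    qed
    show ?thesis
    proof (intro equalityI image_subsetI)
      fix s
      show "geo (x, z) (v, \<tau>) s \<in> range (\<lambda>s. (fst (rot s (x, sgn v)), z * cis (real c / real d * s)))"
        unfolding * by blast
      show "(fst (rot s (x, sgn v)), z * cis (real c / real d * s)) \<in> range (geo (x, z) (v, \<tau>))"
        by (rule image_eqI[of _ _ "s / norm v"]) (simp_all add: * \<open>v \<noteq> 0\<close>)
    qed
  qed
  also have "\<dots> = to_null c d (rot (- (real d / real c * \<theta>)) (x, sgn v))"
  proof -
    have "cis (real c / real d * (s - - (real d / real c * \<theta>))) = z * cis (real c / real d * s)" for s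
    proof -
      have "real c / real d * (s - - (real d / real c * \<theta>)) = \<theta> + real c / real d * s" by (simp add: distrib_left)
      then show ?thesis using assms(2) by (simp add: cis_mult[symmetric])
    qed
    then show ?thesis unfolding to_null_rot by simp
  qed
  finally show "geodesic_of (S2xS1 c d) ((x, z), (v, \<tau>)) = to_null c d (rot (- (real d / real c * \<theta>)) (x, sgn v))" .
qed

text \<open>The form weights the circle by d^2 / c^2, so unit spatial speed requires circle speed c
  / d. These vectors give a smooth section of the future null bundle over the slice with circle
  coordinate 1.\<close>

lemma STS_to_future_null:
  assumes "(x, u) \<in> STS"
  shows "((x, 1), (u, \<i> * of_real (real c / real d))) \<in> future_null (S2xS1 c d)"
  unfolding future_null_iff using assms
  by (auto simp: tangent_def gform_def dt_def inner_complex_def norm_eq_1 inner_commute power2_eq_square)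

lemma geodesic_of_STS:
  assumes "(x, u) \<in> STS"
  shows "geodesic_of (S2xS1 c d) ((x, 1), (u, \<i> * of_real (real c / real d))) = to_null c d (x, u)"
  using geodesic_of_future_null(3)[OF STS_to_future_null[OF assms], of 0] assms by (simp add: sgn_div_norm)

lemma geo_future_null:
  fixes s :: real
  assumes w: "(x, u) \<in> STS"
  defines "p \<equiv> (x, 1)" and "v \<equiv> (u, \<i> * of_real (real c / real d))"
  shows "(geo p v s, geo' p v s) \<in> future_null (S2xS1 c d)"
proof -
  define k where "k = real c / real d"
  have k: "k > 0" "real d * k = real c" by (simp_all add: k_def)
  have nv: "norm (\<i> * of_real k) = k" using k(1) by (simp add: norm_mult)
  have sgn: "sgn (\<i> * of_real k) = \<i>" using k(1) by (simp add: sgn_div_norm nv complex_eq_iff)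
  have pv: "p \<in> S2S1" "tangent p v"
    using STS_to_future_null[OF w] unfolding future_null_iff p_def v_def by auto
  have geo: "snd (geo p v s) = cis (k * s)"
    by (simp add: geo_def circ_def p_def v_def k_def[symmetric] nv sgn complex_eq_iff)
  have geo': "geo' p v s = (snd (rot s (x, u)), k *\<^sub>R (\<i> * cis (k * s)))"
    using w by (simp add: geo'_def p_def v_def k_def[symmetric] nv rot_def complex_eq_iff)
  have "tangent (geo p v s) (geo' p v s)"
    by (rule S2S1_velocity_tangent[OF open_UNIV _ _ geo_has_vector_derivative]) (use geo_in_S2S1[OF pv] in auto)
  moreover have "gform c d (geo' p v s) (geo' p v s) = 0"
  proof -
    have "norm (snd (rot s (x, u))) = 1" using rot_in_STS[OF w, of s] by (auto simp: STS_def)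
    moreover have "norm (k *\<^sub>R (\<i> * cis (k * s))) = k" using k(1) by (simp add: norm_mult)
    ultimately show ?thesis
      using k(2) by (simp add: geo' gform_def power2_norm_eq_inner[symmetric] power_mult_distrib[symmetric])
  qed
  moreover have "dt (snd (geo p v s)) (snd (geo' p v s)) = k"
    by (simp add: geo geo' dt_def sin_cos_squared_add3 flip: distrib_left power2_eq_square)
  ultimately show ?thesis unfolding future_null_iff using geo_in_S2S1[OF pv] k(1) by simp
qed

lemma null_geodesics_eq: "null_geodesics (S2xS1 c d) = to_null c d ` STS"
proof (intro equalityI subsetI)
  fix \<Gamma> assume "\<Gamma> \<in> null_geodesics (S2xS1 c d)"
  then obtain I \<gamma> where \<gamma>: "maximal_geodesic (S2xS1 c d) I \<gamma>"
    "\<forall>s\<in>I. (\<gamma> s, vector_derivative \<gamma> (at s)) \<in> future_null (S2xS1 c d)" "\<Gamma> = \<gamma> ` I"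
    unfolding null_geodesics_def by blast
  then obtain p w where pw: "I = UNIV" "p \<in> S2S1" "tangent p w" "\<gamma> = geo p w"
    using maximal_geodesic_iff[OF c d] by auto
  have 0: "(p, w) \<in> future_null (S2xS1 c d)" using bspec[OF \<gamma>(2), of 0] pw by simp
  obtain x z v \<tau> where xz: "p = (x, z)" "w = (v, \<tau>)" by (cases p; cases w)
  have "cis (Arg z) = z" using pw xz by (simp add: cis_Arg_unique cis_Arg sgn_div_norm) (metis cis_Arg norm_zero scaleR_one sgn_div_norm inverse_1 zero_neq_one)
  note * = geodesic_of_future_null[OF 0[unfolded xz] this]
  have "\<Gamma> = geodesic_of (S2xS1 c d) (p, w)" using geodesic_of_eq[OF c d pw(2,3)] \<gamma> pw by simp
  then have "\<Gamma> = to_null c d (rot (- (real d / real c * Arg z)) (x, sgn v))" by (simp only: xz *(3))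
  then show "\<Gamma> \<in> to_null c d ` STS" using imageI[OF rot_in_STS[OF *(1)]] by (simp only:)
next
  fix \<Gamma> assume "\<Gamma> \<in> to_null c d ` STS"
  then obtain x u where xu: "(x, u) \<in> STS" "\<Gamma> = to_null c d (x, u)" by force
  let ?p = "(x, 1)" and ?w = "(u, \<i> * of_real (real c / real d))"
  have f: "(?p, ?w) \<in> future_null (S2xS1 c d)" by (rule STS_to_future_null[OF xu(1)])
  then have pw: "?p \<in> S2S1" "tangent ?p ?w" using future_null_iff by auto
  have "\<Gamma> = range (geo ?p ?w)" using geodesic_of_STS[OF xu(1)] geodesic_of_eq[OF c d pw] xu(2) by simp
  moreover have "maximal_geodesic (S2xS1 c d) UNIV (geo ?p ?w)"
    unfolding maximal_geodesic_iff[OF c d] using pw by blast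
  ultimately show "\<Gamma> \<in> null_geodesics (S2xS1 c d)"
    unfolding null_geodesics_def using geo_future_null[OF xu(1)]
    by (intro CollectI exI[of _ "geo ?p ?w"] exI[of _ UNIV]) auto
qed

text \<open>The smooth structure inherited from the null bundle is the one descending from STS^2.
  One direction pulls back along the section over the slice with circle coordinate 1; the other
  flows null vectors back to that slice, which depends smoothly on them once a local branch of the
  argument is fixed.\<close>

lemma funs_null_space:
  "f \<in> funs (null_space (S2xS1 c d)) \<longleftrightarrow> smooth_on STS (f \<circ> to_null c d)"
proof -
  have "smooth_on STS (f \<circ> to_null c d)" if f: "smooth_on (future_null (S2xS1 c d)) (f \<circ> geodesic_of (S2xS1 c d))"
  proof -
    let ?\<sigma> = "\<lambda>w. ((fst w, 1), (snd w, \<i> * of_real (real c / real d))) :: ((real^3) \<times> complex) \<times> ((real^3) \<times> complex)"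
    have "smooth_on STS (\<lambda>w. (f \<circ> geodesic_of (S2xS1 c d)) (?\<sigma> w))"
      by (rule smooth_on_compose[OF f]) (use STS_to_future_null in \<open>auto intro!: smooth_intros simp del: STS_iff\<close>)
    then show ?thesis by (rule smooth_on_cong) (use geodesic_of_STS in \<open>auto simp del: STS_iff\<close>)
  qed
  moreover have "smooth_on (future_null (S2xS1 c d)) (f \<circ> geodesic_of (S2xS1 c d))"
    if f: "smooth_on STS (f \<circ> to_null c d)"
  proof (rule smooth_on_local)
    fix q assume q: "q \<in> future_null (S2xS1 c d)"
    let ?z0 = "snd (fst q)"
    define U where "U = {r :: ((real^3) \<times> complex) \<times> ((real^3) \<times> complex). Re (snd (fst r) * cnj ?z0) > 0}"
    \<comment> \<open>A branch of the argument that is smooth on the half circle around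
      \<open>?z0\<close>: \<open>Arg\<close> is evaluated only at the fixed point, since it jumps
      elsewhere, and the arctangent measures the deviation.\<close>
    define \<theta> where "\<theta> r = Arg ?z0 + arctan (Im (snd (fst r) * cnj ?z0) / Re (snd (fst r) * cnj ?z0))"
      for r :: "((real^3) \<times> complex) \<times> ((real^3) \<times> complex)"
    have nz: "norm (snd (fst r)) = 1" if "r \<in> future_null (S2xS1 c d)" for r
      using that future_null_iff[of "fst r" "snd r"] by (auto simp: mem_Times_iff)
    have \<theta>: "cis (\<theta> r) = snd (fst r)" if r: "r \<in> future_null (S2xS1 c d)" "r \<in> U" for r
    proof -
      define \<zeta> where "\<zeta> = snd (fst r) * cnj ?z0"
      have pos: "Re \<zeta> > 0" using r by (simp add: U_def \<zeta>_def)
      have "norm \<zeta> = 1" using nz[OF r(1)] nz[OF q] by (simp add: \<zeta>_def norm_mult)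
      then have "(Re \<zeta>)\<^sup>2 + (Im \<zeta>)\<^sup>2 = 1" by (simp add: cmod_def)
      then have "1 + (Im \<zeta> / Re \<zeta>)\<^sup>2 = (1 / Re \<zeta>)\<^sup>2" using pos by (simp add: field_simps)
      then have "sqrt (1 + (Im \<zeta> / Re \<zeta>)\<^sup>2) = 1 / Re \<zeta>" using pos by simp
      then have "cis (arctan (Im \<zeta> / Re \<zeta>)) = \<zeta>"
        using pos by (simp add: complex_eq_iff cos_arctan sin_arctan)
      moreover have "cis (Arg ?z0) = ?z0"
        using nz[OF q] by (metis cis_Arg norm_zero scaleR_one sgn_div_norm inverse_1 zero_neq_one)
      moreover have "?z0 * cnj ?z0 = 1" using nz[OF q] by (simp add: complex_norm_square[symmetric])
      ultimately show ?thesis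
        unfolding \<theta>_def \<zeta>_def[symmetric] cis_mult[symmetric] by (simp add: \<zeta>_def mult.left_commute)
    qed
    define \<rho> where "\<rho> r = rot (- (real d / real c * \<theta> r)) (fst (fst r), sgn (fst (snd r)))" for r
    have \<rho>: "\<rho> r \<in> STS" "to_null c d (\<rho> r) = geodesic_of (S2xS1 c d) r" "fst (snd r) \<noteq> 0"
      if r: "r \<in> future_null (S2xS1 c d) \<inter> U" for r
    proof -
      obtain x z v \<tau> where rr: "r = ((x, z), (v, \<tau>))" by (metis surj_pair)
      have "cis (\<theta> r) = z" using \<theta> r rr by auto
      note * = geodesic_of_future_null[OF _ this, of x v \<tau>]
      show "\<rho> r \<in> STS" "to_null c d (\<rho> r) = geodesic_of (S2xS1 c d) r" "fst (snd r) \<noteq> 0"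
        using * r rot_in_STS[of "(x, sgn v)"] by (auto simp: \<rho>_def rr)
    qed
    have "smooth_on (future_null (S2xS1 c d) \<inter> U) (\<lambda>r. (f \<circ> to_null c d) (\<rho> r))"
    proof (rule smooth_on_compose[OF f])
      show "smooth_on (future_null (S2xS1 c d) \<inter> U) \<rho>"
        unfolding \<rho>_def \<theta>_def
        by (intro smooth_on_rot smooth_intros smooth_on_sgn) (use \<rho>(3) in \<open>auto simp: U_def\<close>)
    qed (use \<rho> in blast)
    then have "smooth_on (future_null (S2xS1 c d) \<inter> U) (f \<circ> geodesic_of (S2xS1 c d))"
      by (rule smooth_on_cong) (use \<rho>(2) in auto)
    moreover have "open U" unfolding U_def by (intro open_Collect_less continuous_intros)
    moreover have "q \<in> U"
    proof -
      have "(Re ?z0)\<^sup>2 + (Im ?z0)\<^sup>2 = 1" using nz[OF q] by (simp add: cmod_def)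
      then show ?thesis by (simp add: U_def power2_eq_square)
    qed
    ultimately show "\<exists>U. open U \<and> q \<in> U \<and> smooth_on (future_null (S2xS1 c d) \<inter> U) (f \<circ> geodesic_of (S2xS1 c d))"
      by blast
  qed
  ultimately show ?thesis unfolding null_space_def by auto
qed

lemma pts_null_space: "pts (null_space (S2xS1 c d)) = to_null c d ` STS"
  by (simp add: null_space_def null_geodesics_eq)

end

section \<open>Tangent vectors\<close>

lemma pts_embedded [simp]: "pts (embedded M) = M" and funs_embedded [simp]: "funs (embedded M) = {f. smooth_on M f}"
  by (auto simp: embedded_def)

lemma STS2_eq: "STS2 = embedded STS"
  by (simp add: STS2_def STS_def)

lemma smooth_on_componentwise:
  fixes f :: "'a::euclidean_space \<Rightarrow> 'b::euclidean_space"
  assumes "\<And>b. b \<in> Basis \<Longrightarrow> smooth_on S (\<lambda>x. f x \<bullet> b)"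
  shows "smooth_on S f"
proof -
  have "smooth_on S (\<lambda>x. \<Sum>b\<in>Basis. (f x \<bullet> b) *\<^sub>R b)"
    by (intro smooth_intros assms)
  then show ?thesis by (simp add: euclidean_representation)
qed

text \<open>The coordinate functions are smooth on \<open>M\<close>, so testing against them already
  gives smoothness of all components; the converse is composition.\<close>

lemma smooth_curve_embedded:
  "smooth_curve (embedded M) \<alpha> \<longleftrightarrow> range \<alpha> \<subseteq> M \<and> smooth_on UNIV \<alpha>"
proof
  assume L: "smooth_curve (embedded M) \<alpha>"
  have "smooth_on UNIV (\<lambda>t. \<alpha> t \<bullet> b)" for b
  proof -
    have "smooth_on M (\<lambda>x. x \<bullet> b)" by (intro smooth_intros)
    with L have "smooth_on UNIV ((\<lambda>x. x \<bullet> b) \<circ> \<alpha>)" by (auto simp: smooth_curve_def)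
    then show ?thesis by (simp add: o_def)
  qed
  with L show "range \<alpha> \<subseteq> M \<and> smooth_on UNIV \<alpha>"
    by (auto simp: smooth_curve_def intro: smooth_on_componentwise)
next
  assume R: "range \<alpha> \<subseteq> M \<and> smooth_on UNIV \<alpha>"
  then show "smooth_curve (embedded M) \<alpha>"
    unfolding smooth_curve_def o_def by (auto intro!: smooth_on_compose[of M _ UNIV \<alpha>])
qed

lemma smooth_curve_has_vector_derivative:
  "smooth_on UNIV \<alpha> \<Longrightarrow> (\<alpha> has_vector_derivative vector_derivative \<alpha> (at t)) (at t)"
  using smooth_on_vector_derivative(1)[OF open_UNIV] by blast

lemma deriv_eq_vector_derivative:
  fixes f :: "real \<Rightarrow> real"
  shows "(f has_vector_derivative D) (at t) \<Longrightarrow> deriv f t = D"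
  by (simp add: DERIV_imp_deriv has_real_derivative_iff_has_vector_derivative)

text \<open>On vectors tangent to \<open>M\<close> the choice of the extension does not matter.\<close>

definition ext_derivative :: "'a::euclidean_space set \<Rightarrow> ('a \<Rightarrow> real) \<Rightarrow> 'a \<Rightarrow> 'a \<Rightarrow> real" where
  "ext_derivative M g w =
     frechet_derivative (SOME F. \<exists>U. open U \<and> w \<in> U \<and> (\<forall>k. Ck_on k U F) \<and> (\<forall>y\<in>M \<inter> U. F y = g y)) (at w)"

text \<open>Along a curve that stays in \<open>M\<close> the chosen extension and \<open>g\<close>
  agree near 0, so the chain rule for the extension differentiates \<open>g\<close> itself.\<close>

lemma ext_derivative:
  assumes "smooth_on M g" "w \<in> M"
  shows "linear (ext_derivative M g w)"
    and "\<And>\<beta> v. range \<beta> \<subseteq> M \<Longrightarrow> \<beta> 0 = w \<Longrightarrow> (\<beta> has_vector_derivative v) (at 0) \<Longrightarrow>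
          smooth_on UNIV \<beta> \<Longrightarrow> ((\<lambda>t. g (\<beta> t)) has_vector_derivative ext_derivative M g w v) (at 0)"
proof -
  let ?P = "\<lambda>F. \<exists>U. open U \<and> w \<in> U \<and> (\<forall>k. Ck_on k U F) \<and> (\<forall>y\<in>M \<inter> U. F y = g y)"
  define F where "F = (SOME F. ?P F)"
  have "\<exists>F. ?P F" using assms unfolding smooth_on_def by blast
  then have "?P F" unfolding F_def by (rule someI_ex)
  then obtain U where U: "open U" "w \<in> U" "\<forall>k. Ck_on k U F" "\<forall>y\<in>M \<inter> U. F y = g y" by blast
  have d: "(F has_derivative ext_derivative M g w) (at w)"
    using Ck_on_imp_has_derivative[of 0 U F w] U unfolding ext_derivative_def F_def by blast
  then show "linear (ext_derivative M g w)" by (rule has_derivative_linear)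
  fix \<beta> v assume \<beta>: "range \<beta> \<subseteq> M" "\<beta> 0 = w" "(\<beta> has_vector_derivative v) (at 0)" "smooth_on UNIV \<beta>"
  have \<beta>M: "\<beta> t \<in> M" for t using \<beta>(1) by blast
  have 1: "open (\<beta> -` U)"
    using U(1) smooth_on_imp_continuous_on[OF \<beta>(4)] by (simp add: open_vimage)
  have "((\<lambda>t. F (\<beta> t)) has_vector_derivative ext_derivative M g w v) (at 0)"
    by (rule has_vector_derivative_compose[OF \<beta>(3)]) (simp add: \<beta>(2) d)
  then show "((\<lambda>t. g (\<beta> t)) has_vector_derivative ext_derivative M g w v) (at 0)"
    by (rule has_vector_derivative_transform_within_open[OF _ 1]) (use U \<beta>M \<beta>(2) in auto)
qed

text \<open>The derivation at \<open>w\<close> in direction \<open>v\<close>. The default value 0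
  matches that in \<open>velocity\<close>, so that both agree as functionals on all
  functions.\<close>

definition embedded_vector :: "'a::euclidean_space set \<Rightarrow> 'a \<Rightarrow> 'a \<Rightarrow> 'a tvec" where
  "embedded_vector M w v = (\<lambda>f. if smooth_on M f then ext_derivative M f w v else 0)"

lemma velocity_embedded:
  assumes "range \<beta> \<subseteq> M" "\<beta> 0 = w" "(\<beta> has_vector_derivative v) (at 0)" "smooth_on UNIV \<beta>"
  shows "velocity (embedded M) \<beta> = embedded_vector M w v"
proof -
  have "w \<in> M" using assms by blast
  then show ?thesis
    using ext_derivative(2)[OF _ _ assms]
    by (auto simp: velocity_def embedded_vector_def o_def fun_eq_iff intro!: deriv_eq_vector_derivative)
qed

text \<open>Coordinate functions are smooth on \<open>M\<close>, so the derivation determines every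
  component of the ambient velocity.\<close>

lemma velocity_embedded_eqD:
  assumes "smooth_on UNIV \<alpha>" "smooth_on UNIV \<beta>" "velocity (embedded M) \<alpha> = velocity (embedded M) \<beta>"
  shows "vector_derivative \<alpha> (at 0) = vector_derivative \<beta> (at 0)"
proof (rule euclidean_eqI)
  fix b :: 'a
  have *: "velocity (embedded M) \<gamma> (\<lambda>x. x \<bullet> b) = vector_derivative \<gamma> (at 0) \<bullet> b" if "smooth_on UNIV \<gamma>" for \<gamma>
  proof -
    have "smooth_on M (\<lambda>x. x \<bullet> b)" by (intro smooth_intros)
    moreover have "((\<lambda>t. \<gamma> t \<bullet> b) has_vector_derivative vector_derivative \<gamma> (at 0) \<bullet> b) (at 0)"
      by (rule has_vector_derivative_linear[OF bounded_linear_inner_left smooth_curve_has_vector_derivative[OF that]])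
    ultimately show ?thesis by (simp add: velocity_def o_def deriv_eq_vector_derivative)
  qed
  show "vector_derivative \<alpha> (at 0) \<bullet> b = vector_derivative \<beta> (at 0) \<bullet> b"
    using *[OF assms(1)] *[OF assms(2)] assms(3) by simp
qed

text \<open>A curve through \<open>(x, u)\<close> with velocity \<open>(a n, b n)\<close>, where \<open>n = x \<times> u\<close>: the composition of
  a rotation in the plane of \<open>u, n\<close> and one in the plane of \<open>x, n\<close>.\<close>

definition frame_curve :: "(real^3) \<times> (real^3) \<Rightarrow> real \<Rightarrow> real \<Rightarrow> real \<Rightarrow> (real^3) \<times> (real^3)" where
  "frame_curve w a b t = (let n = cross3 (fst w) (snd w) in
     (cos (a * t) *\<^sub>R fst w + sin (a * t) *\<^sub>R n,
      cos (b * t) *\<^sub>R snd w + sin (b * t) *\<^sub>R (- sin (a * t) *\<^sub>R fst w + cos (a * t) *\<^sub>R n)))"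

abbreviation nvec :: "(real^3) \<times> (real^3) \<Rightarrow> real^3" where
  "nvec w \<equiv> cross3 (fst w) (snd w)"

lemma STS_frame:
  assumes "w \<in> STS"
  shows "fst w \<bullet> fst w = 1" "snd w \<bullet> snd w = 1" "fst w \<bullet> snd w = 0" "snd w \<bullet> fst w = 0"
    "nvec w \<bullet> nvec w = 1" "nvec w \<bullet> fst w = 0" "fst w \<bullet> nvec w = 0" "nvec w \<bullet> snd w = 0" "snd w \<bullet> nvec w = 0"
    "nvec w \<noteq> 0"
proof -
  obtain x u where w: "w = (x, u)" by (cases w)
  have *: "norm (nvec w) = 1" using assms norm_cross3_orthonormal[of x u] by (simp add: w)
  then show "nvec w \<noteq> 0" by auto
  show "nvec w \<bullet> nvec w = 1" using * norm_eq_1 by blast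
qed (use assms in \<open>auto simp: STS_def norm_eq_1 inner_commute dot_cross_self\<close>)

lemma frame_curve:
  assumes w: "w \<in> STS"
  shows "range (frame_curve w a b) \<subseteq> STS" "frame_curve w a b 0 = w" "smooth_on UNIV (frame_curve w a b)"
    "(frame_curve w a b has_vector_derivative (a *\<^sub>R nvec w, b *\<^sub>R nvec w)) (at 0)"
proof -
  have cs: "cos \<theta> * cos \<theta> + sin \<theta> * sin \<theta> = 1" for \<theta> :: real by (rule sin_cos_squared_add3)
  have "frame_curve w a b t \<in> STS" for t
  proof -
    define C S c' s' where "C = cos (a * t)" "S = sin (a * t)" "c' = cos (b * t)" "s' = sin (b * t)"
    have e: "C * C + S * S = 1" "c' * c' + s' * s' = 1" using cs by (auto simp: C_S_c'_s'_def)
    have "c' * c' + (s' * (C * (s' * C)) + s' * (S * (s' * S))) = c' * c' + (s' * s') * (C * C + S * S)"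
      by (simp add: algebra_simps)
    then have e3: "c' * c' + (s' * (C * (s' * C)) + s' * (S * (s' * S))) = 1" using e by simp
    show ?thesis
      unfolding frame_curve_def Let_def C_S_c'_s'_def[symmetric]
      using STS_frame[OF w] e e3
      by (simp add: norm_eq_1 inner_add_left inner_add_right inner_diff_left inner_diff_right algebra_simps)
  qed
  then show "range (frame_curve w a b) \<subseteq> STS" by blast
  show "frame_curve w a b 0 = w" by (simp add: frame_curve_def)
  show "smooth_on UNIV (frame_curve w a b)"
    unfolding frame_curve_def Let_def by (intro smooth_intros)
  show "(frame_curve w a b has_vector_derivative (a *\<^sub>R nvec w, b *\<^sub>R nvec w)) (at 0)"
    unfolding frame_curve_def Let_def
    by (intro has_vector_derivative_Pair) (auto intro!: derivative_eq_intros)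
qed

lemma STS_velocity:
  assumes "range \<beta> \<subseteq> STS" "(\<beta> has_vector_derivative v) (at 0)"
  shows "fst v \<bullet> fst (\<beta> 0) = 0" "snd v \<bullet> snd (\<beta> 0) = 0" "fst (\<beta> 0) \<bullet> snd v + fst v \<bullet> snd (\<beta> 0) = 0"
proof -
  have *: "fst (\<beta> t) \<bullet> fst (\<beta> t) = 1" "snd (\<beta> t) \<bullet> snd (\<beta> t) = 1" "fst (\<beta> t) \<bullet> snd (\<beta> t) = 0" for t
    using assms(1) STS_frame by blast+
  note f = has_vector_derivative_linear[OF bounded_linear_fst assms(2)]
    and s = has_vector_derivative_linear[OF bounded_linear_snd assms(2)]
  show "fst v \<bullet> fst (\<beta> 0) = 0" by (rule constant_inner_imp_orthogonal[OF f open_UNIV]) (use * in auto)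
  show "snd v \<bullet> snd (\<beta> 0) = 0" by (rule constant_inner_imp_orthogonal[OF s open_UNIV]) (use * in auto)
  show "fst (\<beta> 0) \<bullet> snd v + fst v \<bullet> snd (\<beta> 0) = 0"
    by (rule has_vector_derivative_locally_const[OF has_vector_derivative_inner[OF f s] open_UNIV]) (use * in auto)
qed

lemma perp_frame:
  assumes "w \<in> STS" "y \<bullet> fst w = 0" "y \<bullet> snd w = 0"
  shows "y = (y \<bullet> nvec w) *\<^sub>R nvec w"
  using orthonormal_frame[of "fst w" "snd w" y] assms by (cases w) auto

text \<open>The contact condition makes the first component of a velocity orthogonal to u.
  Differentiating x . u = 0 then makes the second orthogonal to x, and the unit length constraints
  leave only multiples of \<open>nvec w\<close> in both. Conversely \<open>frame_curve\<close>
  realises every such pair.\<close>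

lemma chi_contact_eq:
  assumes w: "w \<in> STS"
  shows "chi_contact w = {embedded_vector STS w (a *\<^sub>R nvec w, b *\<^sub>R nvec w) | a b. True}"
proof -
  have dfst: "differential S2 fst (velocity STS2 \<beta>) = velocity S2 (\<lambda>t. fst (\<beta> t))"
    for \<beta> :: "real \<Rightarrow> (real^3) \<times> (real^3)"
  proof -
    have "smooth_on STS (f \<circ> fst)" if "smooth_on (sphere 0 1) f" for f :: "real^3 \<Rightarrow> real"
      unfolding o_def by (rule smooth_on_compose[OF that]) (auto intro: smooth_intros simp: STS_def)
    then show ?thesis by (auto simp: differential_def velocity_def S2_def STS2_eq o_def fun_eq_iff)
  qed
  have curve: "smooth_on UNIV \<beta>" "range \<beta> \<subseteq> STS" if "smooth_curve STS2 \<beta>" for \<beta>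
    using that smooth_curve_embedded by (auto simp: STS2_eq)
  show ?thesis
  proof (intro equalityI subsetI)
    fix D assume D: "D \<in> chi_contact w"
    then obtain \<beta> where \<beta>: "D = velocity STS2 \<beta>" "smooth_curve STS2 \<beta>" "\<beta> 0 = w"
      by (auto simp: chi_contact_def tangent_space_def)
    note sm = curve[OF \<beta>(2)]
    obtain \<alpha> where \<alpha>: "velocity S2 (\<lambda>t. fst (\<beta> t)) = velocity S2 \<alpha>" "smooth_curve S2 \<alpha>"
      "vector_derivative \<alpha> (at 0) \<bullet> snd w = 0"
    proof -
      have "differential S2 fst D \<in> perp w" using D by (simp add: chi_contact_def)
      then have "velocity S2 (\<lambda>t. fst (\<beta> t)) \<in> perp w" by (simp only: \<beta>(1) dfst)
      then show ?thesis using that by (auto simp: perp_def split_beta)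
    qed
    define v where "v = vector_derivative \<beta> (at 0)"
    have v: "(\<beta> has_vector_derivative v) (at 0)"
      unfolding v_def by (rule smooth_curve_has_vector_derivative[OF sm(1)])
    have "vector_derivative (\<lambda>t. fst (\<beta> t)) (at 0) = vector_derivative \<alpha> (at 0)"
      by (rule velocity_embedded_eqD[where M = "sphere 0 1"])
         (use \<alpha> sm smooth_curve_embedded in \<open>auto simp: S2_def intro: smooth_intros\<close>)
    moreover have "vector_derivative (\<lambda>t. fst (\<beta> t)) (at 0) = fst v"
      by (rule vector_derivative_at[OF has_vector_derivative_linear[OF bounded_linear_fst v]])
    ultimately have "fst v \<bullet> snd w = 0" using \<alpha>(3) by simp
    moreover note STS_velocity[OF sm(2) v, unfolded \<beta>(3)]
    ultimately have "fst v = (fst v \<bullet> nvec w) *\<^sub>R nvec w" "snd v = (snd v \<bullet> nvec w) *\<^sub>R nvec w"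
      by (auto intro!: perp_frame[OF w] simp: inner_commute)
    then obtain a b where "v = (a *\<^sub>R nvec w, b *\<^sub>R nvec w)" by (metis prod.collapse)
    moreover have "D = embedded_vector STS w v"
      unfolding \<beta>(1) STS2_eq by (rule velocity_embedded[OF sm(2) \<beta>(3) v sm(1)])
    ultimately show "D \<in> {embedded_vector STS w (a *\<^sub>R nvec w, b *\<^sub>R nvec w) | a b. True}" by blast
  next
    fix D assume "D \<in> {embedded_vector STS w (a *\<^sub>R nvec w, b *\<^sub>R nvec w) | a b. True}"
    then obtain a b where D: "D = embedded_vector STS w (a *\<^sub>R nvec w, b *\<^sub>R nvec w)" by blast
    let ?\<beta> = "frame_curve w a b"
    note fc = frame_curve[OF w, of a b]
    have D': "D = velocity STS2 ?\<beta>"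
      unfolding D STS2_eq by (rule velocity_embedded[OF fc(1,2,4,3), symmetric])
    have sc: "smooth_curve STS2 ?\<beta>" unfolding STS2_eq smooth_curve_embedded using fc by blast
    have "vector_derivative (\<lambda>t. fst (?\<beta> t)) (at 0) = a *\<^sub>R nvec w"
      using vector_derivative_at[OF has_vector_derivative_linear[OF bounded_linear_fst fc(4)]] by simp
    moreover have "smooth_curve S2 (\<lambda>t. fst (?\<beta> t))"
      unfolding S2_def smooth_curve_embedded using fc(1) by (auto intro: smooth_intros fc(3) simp: STS_def)
    ultimately have "differential S2 fst D \<in> perp w"
      unfolding D' dfst perp_def using STS_frame[OF w] fc(2)
      by (auto simp: split_beta intro!: exI[of _ "\<lambda>t. fst (?\<beta> t)"])
    then show "D \<in> chi_contact w"
      unfolding chi_contact_def tangent_space_def using sc fc D' by (auto simp: STS2_eq)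
  qed
qed

text \<open>With \<open>\<zeta> = x + \<i> u\<close> the rotation by \<open>\<theta>\<close> is multiplication of \<open>\<zeta>\<close> by \<open>e\<^sup>-\<^sup>i\<^sup>\<theta>\<close>, so monomials of degree
  \<open>c\<close> in the components of \<open>\<zeta>\<close> descend to the space of null geodesics.\<close>

definition zcomp :: "real^3 \<Rightarrow> (real^3) \<times> (real^3) \<Rightarrow> complex" where
  "zcomp b w = Complex (fst w \<bullet> b) (snd w \<bullet> b)"

lemma zcomp_rot: "zcomp b (rot \<theta> w) = cis (- \<theta>) * zcomp b w"
  by (simp add: zcomp_def rot_def split_beta complex_eq_iff inner_add_left inner_diff_left algebra_simps)

lemma zcomp_linear: "bounded_linear (zcomp b)"
proof -
  have "zcomp b = (\<lambda>w. (fst w \<bullet> b) *\<^sub>R 1 + (snd w \<bullet> b) *\<^sub>R \<i>)"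
    by (simp add: fun_eq_iff zcomp_def complex_eq_iff)
  moreover have "bounded_linear (\<lambda>w :: (real^3) \<times> (real^3). (fst w \<bullet> b) *\<^sub>R (1::complex) + (snd w \<bullet> b) *\<^sub>R \<i>)"
    by (intro bounded_linear_intros)
  ultimately show ?thesis by simp
qed

section \<open>Invariant monomials and tangent vectors of the space of null geodesics\<close>

context coprime_pair
begin

abbreviation "N \<equiv> null_space (S2xS1 c d)"
abbreviation "Q \<equiv> to_null c d"

text \<open>Total degree c, with only one factor depending on \<open>b\<close>: wherever
  \<open>zcomp a\<close> equals 1 the value is \<open>zcomp b\<close>, from which all components can
  be read.\<close>

definition monomial :: "real^3 \<Rightarrow> real^3 \<Rightarrow> (real^3) \<times> (real^3) \<Rightarrow> complex" where
  "monomial a b w = zcomp a w ^ (c - 1) * zcomp b w"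

lemma monomial_rot: "monomial a b (rot \<theta> w) = cis (- (real c * \<theta>)) * monomial a b w"
proof -
  have "cis (- \<theta>) ^ (c - 1) * cis (- \<theta>) = cis (- \<theta>) ^ c"
    using c by (metis power_minus_mult less_le_trans zero_less_one)
  then have "cis (- \<theta>) ^ (c - 1) * cis (- \<theta>) = cis (- (real c * \<theta>))" by (simp only: Complex.DeMoivre mult_minus_right)
  then show ?thesis
    by (simp add: monomial_def zcomp_rot power_mult_distrib)
qed

lemma monomial_Zc: "w' \<in> Zc_orbit c w \<Longrightarrow> monomial a b w' = monomial a b w"
proof -
  assume "w' \<in> Zc_orbit c w"
  then obtain j :: int where w': "w' = rot (2 * pi * of_int j / real c) w" unfolding Zc_orbit_def by blast
  have "cis (- (real c * (2 * pi * of_int j / real c))) = cis 0"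
    unfolding cis_eq_iff by (rule exI[of _ "- j"]) simp
  then show ?thesis unfolding w' monomial_rot by simp
qed

text \<open>An arbitrary choice of preimages without any continuity. It is used only inside
  monomials, which are constant on the fibres of \<open>Q\<close>.\<close>

definition Qinv :: "((real^3) \<times> complex) set \<Rightarrow> (real^3) \<times> (real^3)" where
  "Qinv = inv_into STS Q"

lemma Qinv: "w \<in> STS \<Longrightarrow> Qinv (Q w) \<in> STS \<and> Q (Qinv (Q w)) = Q w"
  using inv_into_into[of "Q w" Q STS] f_inv_into_f[of "Q w" Q STS] by (simp add: Qinv_def)

lemma monomial_Qinv: "w \<in> STS \<Longrightarrow> monomial a b (Qinv (Q w)) = monomial a b w"
  using Qinv to_null_eq_iff monomial_Zc by blast

lemma smooth_on_monomial: "smooth_on S f \<Longrightarrow> smooth_on S (\<lambda>t. monomial a b (f t))"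
  unfolding monomial_def by (intro smooth_intros smooth_on_linear_compose[OF zcomp_linear])

lemma monomial_funs:
  "(\<lambda>\<Gamma>. Re (k * monomial a b (Qinv \<Gamma>))) \<in> funs N" "(\<lambda>\<Gamma>. Im (k * monomial a b (Qinv \<Gamma>))) \<in> funs N"
proof -
  have *: "smooth_on STS (\<lambda>w. Re (k * monomial a b w))" "smooth_on STS (\<lambda>w. Im (k * monomial a b w))"
    by (intro smooth_intros smooth_on_monomial)+
  show "(\<lambda>\<Gamma>. Re (k * monomial a b (Qinv \<Gamma>))) \<in> funs N" "(\<lambda>\<Gamma>. Im (k * monomial a b (Qinv \<Gamma>))) \<in> funs N"
    unfolding funs_null_space o_def by (rule smooth_on_cong[OF *(1)] smooth_on_cong[OF *(2)], simp add: monomial_Qinv)+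
qed

text \<open>The image of the direction \<open>v\<close> at \<open>w\<close> under the differential
  of \<open>Q\<close>, written without a curve so that additivity in \<open>v\<close> is
  immediate.\<close>

definition null_vector :: "(real^3) \<times> (real^3) \<Rightarrow> (real^3) \<times> (real^3) \<Rightarrow> ((real^3) \<times> complex) set tvec" where
  "null_vector w v = (\<lambda>f. if f \<in> funs N then ext_derivative STS (f \<circ> Q) w v else 0)"

lemma velocity_null:
  assumes "range \<beta> \<subseteq> STS" "\<beta> 0 = w" "(\<beta> has_vector_derivative v) (at 0)" "smooth_on UNIV \<beta>"
  shows "velocity N (Q \<circ> \<beta>) = null_vector w v"
proof -
  have "w \<in> STS" using assms by blast
  then show ?thesis
    using ext_derivative(2)[OF _ _ assms]
    by (auto simp: velocity_def null_vector_def funs_null_space o_def fun_eq_iff intro!: deriv_eq_vector_derivative)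
qed

lemma null_vector_linear:
  assumes "w \<in> STS"
  shows "null_vector w (u + v) = (\<lambda>f. null_vector w u f + null_vector w v f)" "null_vector w 0 = (\<lambda>_. 0)"
  using ext_derivative(1)[OF _ assms]
  by (auto simp: null_vector_def funs_null_space fun_eq_iff linear_add linear_0)

lemma smooth_curve_null:
  assumes "range \<beta> \<subseteq> STS" "smooth_on UNIV \<beta>"
  shows "smooth_curve N (Q \<circ> \<beta>)"
  unfolding smooth_curve_def
proof (intro conjI ballI)
  show "range (Q \<circ> \<beta>) \<subseteq> pts N" using assms unfolding pts_null_space by auto
  fix f assume "f \<in> funs N"
  then have "smooth_on STS (f \<circ> Q)" by (simp add: funs_null_space)
  from smooth_on_compose[OF this assms(2)] assms(1)
  show "smooth_on UNIV (f \<circ> (Q \<circ> \<beta>))" by (auto simp: o_def)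
qed

text \<open>\<open>Q\<close> is an immersion. With x = \<open>fst w\<close> one has
  \<open>zcomp x w = 1\<close>, so the derivative of the monomial for x and b in direction z is (c -
  1) \<zeta>_x(z) \<zeta>_b(w) + \<zeta>_b(z), where \<zeta>_b is \<open>zcomp b\<close>. Taking b =
  x gives c \<zeta>_x(z), which determines \<zeta>_x(z), and then every \<zeta>_b(z).\<close>

lemma velocity_null_inj:
  assumes \<alpha>: "range \<alpha> \<subseteq> STS" "\<alpha> 0 = w" "(\<alpha> has_vector_derivative u) (at 0)"
    and \<beta>: "range \<beta> \<subseteq> STS" "\<beta> 0 = w" "(\<beta> has_vector_derivative v) (at 0)"
    and eq: "velocity N (Q \<circ> \<alpha>) = velocity N (Q \<circ> \<beta>)"
  shows "u = v"
proof -
  let ?x = "fst w"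
  have w: "w \<in> STS" using \<alpha> by blast
  have cx: "zcomp ?x w = 1" using STS_frame[OF w] by (simp add: zcomp_def complex_eq_iff)
  have der: "((\<lambda>t. monomial ?x b (\<gamma> t)) has_vector_derivative
       (of_nat (c - 1) * zcomp ?x z * zcomp b w + zcomp b z)) (at 0)"
    if "\<gamma> 0 = w" "(\<gamma> has_vector_derivative z) (at 0)" for \<gamma> z b
  proof -
    have l: "((\<lambda>t. zcomp a (\<gamma> t)) has_vector_derivative zcomp a z) (at 0)" for a
      by (rule has_vector_derivative_linear[OF zcomp_linear that(2)])
    have "((\<lambda>t. zcomp ?x (\<gamma> t) ^ (c - 1)) has_vector_derivative of_nat (c - 1) * zcomp ?x z) (at 0)"
    proof -
      have "((\<lambda>z. z ^ (c - 1)) has_derivative (\<lambda>h. of_nat (c - 1) * h)) (at (zcomp ?x (\<gamma> 0)))"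
        by (auto intro!: derivative_eq_intros simp: that cx)
      from has_vector_derivative_compose[OF l this] show ?thesis .
    qed
    from has_vector_derivative_mult[OF this l[of b]]
    show ?thesis unfolding monomial_def by (simp add: that cx add.commute)
  qed
  have vel: "velocity N (Q \<circ> \<gamma>) (\<lambda>\<Gamma>. Re (1 * monomial ?x b (Qinv \<Gamma>))) = Re (of_nat (c - 1) * zcomp ?x z * zcomp b w + zcomp b z)"
    "velocity N (Q \<circ> \<gamma>) (\<lambda>\<Gamma>. Im (1 * monomial ?x b (Qinv \<Gamma>))) = Im (of_nat (c - 1) * zcomp ?x z * zcomp b w + zcomp b z)"
    if "range \<gamma> \<subseteq> STS" "\<gamma> 0 = w" "(\<gamma> has_vector_derivative z) (at 0)" for \<gamma> z b
  proof -
    have "monomial ?x b (Qinv (Q (\<gamma> t))) = monomial ?x b (\<gamma> t)" for t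
      using monomial_Qinv that(1) by blast
    then show "velocity N (Q \<circ> \<gamma>) (\<lambda>\<Gamma>. Re (1 * monomial ?x b (Qinv \<Gamma>))) = Re (of_nat (c - 1) * zcomp ?x z * zcomp b w + zcomp b z)"
      "velocity N (Q \<circ> \<gamma>) (\<lambda>\<Gamma>. Im (1 * monomial ?x b (Qinv \<Gamma>))) = Im (of_nat (c - 1) * zcomp ?x z * zcomp b w + zcomp b z)"
      using monomial_funs(1)[of 1 ?x b] monomial_funs(2)[of 1 ?x b]
        deriv_eq_vector_derivative[OF has_vector_derivative_linear[OF bounded_linear_Re der[OF that(2,3)]]]
        deriv_eq_vector_derivative[OF has_vector_derivative_linear[OF bounded_linear_Im der[OF that(2,3)]]]
      by (simp_all add: velocity_def o_def)
  qed
  have key: "of_nat (c - 1) * zcomp ?x u * zcomp b w + zcomp b u = of_nat (c - 1) * zcomp ?x v * zcomp b w + zcomp b v" for b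
    using vel[OF \<alpha>, of b] vel[OF \<beta>, of b] eq by (simp only: complex_eq_iff)
  have "of_nat c * zcomp ?x u = of_nat c * zcomp ?x v"
    using key[of ?x] c by (simp add: cx of_nat_diff algebra_simps)
  then have "zcomp ?x u = zcomp ?x v" by simp
  then have "zcomp b u = zcomp b v" for b using key[of b] by simp
  then have "fst u \<bullet> b = fst v \<bullet> b" "snd u \<bullet> b = snd v \<bullet> b" for b by (auto simp: zcomp_def)
  then show "u = v" by (simp add: prod_eq_iff euclidean_eq_iff[where 'a = "real^3"])
qed

lemma null_vector_inj:
  assumes "w \<in> STS" "null_vector w (a *\<^sub>R nvec w, b *\<^sub>R nvec w) = null_vector w (a' *\<^sub>R nvec w, b' *\<^sub>R nvec w)"
  shows "a = a' \<and> b = b'"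
proof -
  note f = frame_curve[OF assms(1)]
  have "velocity N (Q \<circ> frame_curve w a b) = velocity N (Q \<circ> frame_curve w a' b')"
    using velocity_null[OF f(1,2,4,3)] assms(2) by simp
  from velocity_null_inj[OF f(1,2,4) f(1,2,4) this] show ?thesis using STS_frame(10)[OF assms(1)] by simp
qed

end

section \<open>Skies and the contact structure\<close>

lemma bounded_linear_rot: "bounded_linear (rot \<theta>)"
proof -
  have "rot \<theta> = (\<lambda>w. (cos \<theta> *\<^sub>R fst w + sin \<theta> *\<^sub>R snd w, - sin \<theta> *\<^sub>R fst w + cos \<theta> *\<^sub>R snd w))"
    by (simp add: rot_def fun_eq_iff)
  moreover have "bounded_linear (\<lambda>w :: (real^3) \<times> (real^3). (cos \<theta> *\<^sub>R fst w + sin \<theta> *\<^sub>R snd w, - sin \<theta> *\<^sub>R fst w + cos \<theta> *\<^sub>R snd w))"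
    by (intro bounded_linear_Pair bounded_linear_intros)
  ultimately show ?thesis by simp
qed

text \<open>\<open>circ\<close> sees only the length of its velocity, but for negative k the sign
  survives in \<open>sgn\<close>, and cosine is even while sine is odd. Both signs occur, as the
  second of two points may precede the first.\<close>

lemma circ_scale:
  assumes "norm v = 1"
  shows "circ p (k *\<^sub>R v) \<tau> = cos (k * \<tau>) *\<^sub>R p + sin (k * \<tau>) *\<^sub>R v"
proof -
  have "sgn v = v" using assms by (simp add: sgn_div_norm)
  then show ?thesis
    using assms by (cases "k = 0"; cases "k > 0") (auto simp: circ_def sgn_scaleR)
qed

lemma countable_cos_zero: "countable {k :: real. cos k = 0}"
proof -
  have "{k :: real. cos k = 0} \<subseteq> range (\<lambda>i::int. of_int i * (pi / 2))" using cos_zero_iff_int by auto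
  then show ?thesis by (rule countable_subset) simp
qed

section \<open>Skies, pairs joined by families, and the canonical contact structure\<close>

context coprime_pair
begin

definition point_at :: "(real^3) \<times> (real^3) \<Rightarrow> real \<Rightarrow> (real^3) \<times> complex" where
  "point_at w s = (fst (rot s w), cis (real c / real d * s))"

lemma Q_eq_range: "Q w = range (point_at w)"
  by (simp add: to_null_alt point_at_def[abs_def])

lemma Q_rot: "Q (rot (- s) w) = range (\<lambda>t. (fst (rot t w), cis (real c / real d * t) * cis (real c / real d * s)))"
  unfolding to_null_rot by (simp add: cis_mult distrib_left add_divide_distrib)

text \<open>A null geodesic may reach the point at another parameter t, but \<open>Q_rot\<close>
  depends on the backward shift only through its phase, and the phases at s and t agree. Hence all
  of them can be rotated back by the same s.\<close>

lemma sky_point_at: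
  assumes w: "w \<in> STS"
  shows "sky (S2xS1 c d) (point_at w s) = {Q (rot (- s) (fst (rot s w), v)) | v. norm v = 1 \<and> fst (rot s w) \<bullet> v = 0}"
    (is "_ = ?R")
proof -
  let ?p = "fst (rot s w)"
  have np: "norm ?p = 1" using rot_in_STS[OF w, of s] by (auto simp: STS_def)
  show ?thesis
  proof (intro equalityI subsetI)
    fix \<Gamma> assume "\<Gamma> \<in> sky (S2xS1 c d) (point_at w s)"
    then obtain w' where w': "\<Gamma> = Q w'" "w' \<in> STS" "point_at w s \<in> Q w'"
      by (auto simp: sky_def null_geodesics_eq)
    then obtain t where t: "?p = fst (rot t w')" "cis (real c / real d * s) = cis (real c / real d * t)"
      by (auto simp: Q_eq_range point_at_def)
    define v where "v = snd (rot t w')"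
    have pv: "rot t w' = (?p, v)" by (simp add: v_def t(1))
    have "w' = rot (- t) (?p, v)" using pv[symmetric] by (simp add: rot_rot)
    then have "\<Gamma> = Q (rot (- s) (?p, v))" unfolding w'(1) by (simp only: Q_rot t(2))
    moreover have "(?p, v) \<in> STS" using rot_in_STS[OF w'(2), of t] pv by simp
    ultimately show "\<Gamma> \<in> ?R" by auto
  next
    fix \<Gamma> assume "\<Gamma> \<in> ?R"
    then obtain v where v: "\<Gamma> = Q (rot (- s) (?p, v))" "norm v = 1" "?p \<bullet> v = 0" by blast
    have "(?p, v) \<in> STS" using v np by simp
    then have "\<Gamma> \<in> null_geodesics (S2xS1 c d)" unfolding null_geodesics_eq v(1) by (intro imageI rot_in_STS)
    moreover have "point_at w s \<in> Q (rot (- s) (?p, v))"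
      unfolding Q_rot by (rule image_eqI[of _ _ 0]) (auto simp: point_at_def)
    ultimately show "\<Gamma> \<in> sky (S2xS1 c d) (point_at w s)" by (simp add: sky_def v(1))
  qed
qed

text \<open>On the sky of \<open>p\<close> the monomials \<open>(\<zeta> \<cdot> p)\<^sup>c\<^sup>-\<^sup>1 (\<zeta> \<cdot> b)\<close> recover the direction of a geodesic at \<open>p\<close>, so
  every smooth curve in a sky lifts to \<open>STS\<^sup>2\<close>.\<close>

lemma tangent_space_sky:
  assumes w: "w \<in> STS"
  shows "tangent_space N (sky (S2xS1 c d) (point_at w s)) (Q w) =
    {null_vector w ((- (a * sin s)) *\<^sub>R nvec w, (a * cos s) *\<^sub>R nvec w) | a. True}"
proof -
  define p where "p = fst (rot s w)"
  define v0 where "v0 = snd (rot s w)"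
  have pv0: "rot s w = (p, v0)" by (simp add: p_def v0_def)
  then have pv0S: "(p, v0) \<in> STS" using rot_in_STS[OF w, of s] by simp
  have n: "nvec w = cross3 p v0" using cross3_rot[of s w] by (simp add: p_def v0_def)
  have pp: "p \<bullet> p = 1" using pv0S by (simp add: norm_eq_1)
  have vel: "((\<lambda>t. rot (- s) (p, v t)) has_vector_derivative ((- (a * sin s)) *\<^sub>R nvec w, (a * cos s) *\<^sub>R nvec w)) (at 0)"
    if "(v has_vector_derivative a *\<^sub>R nvec w) (at 0)" for v a
  proof -
    have "((\<lambda>t. rot (- s) (p, v t)) has_vector_derivative rot (- s) (0, a *\<^sub>R nvec w)) (at 0)"
      by (intro has_vector_derivative_linear[OF bounded_linear_rot] has_vector_derivative_Pair
          has_vector_derivative_const that)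
    then show ?thesis by (simp add: rot_def mult.commute)
  qed
  have range: "range (\<lambda>t. rot (- s) (p, v t)) \<subseteq> STS" if "\<And>t. norm (v t) = 1 \<and> p \<bullet> v t = 0" for v :: "real \<Rightarrow> real^3"
    using rot_in_STS that pv0S by (simp add: image_subset_iff)
  have start: "rot (- s) (p, v0) = w" unfolding pv0[symmetric] rot_rot by simp
  show ?thesis
  proof (intro equalityI subsetI)
    fix D assume "D \<in> tangent_space N (sky (S2xS1 c d) (point_at w s)) (Q w)"
    then obtain \<alpha> where \<alpha>: "D = velocity N \<alpha>" "smooth_curve N \<alpha>" "range \<alpha> \<subseteq> sky (S2xS1 c d) (point_at w s)" "\<alpha> 0 = Q w"
      by (auto simp: tangent_space_def)
    have "\<forall>t. \<exists>v. \<alpha> t = Q (rot (- s) (p, v)) \<and> norm v = 1 \<and> p \<bullet> v = 0"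
      using \<alpha>(3) unfolding sky_point_at[OF w] p_def by blast
    then obtain v where v: "\<And>t. \<alpha> t = Q (rot (- s) (p, v t))" "\<And>t. norm (v t) = 1 \<and> p \<bullet> v t = 0"
      by metis
    \<comment> \<open>The factor \<open>cis (- (real c * s))\<close> undoes the effect of the
      rotation by - s on a monomial of degree c. What remains is p . b + i (u . b), whose imaginary
      part is the component of the direction.\<close>
    have recover: "Im (cis (- (real c * s)) * monomial p b (Qinv (Q (rot (- s) (p, u))))) = u \<bullet> b"
      if "norm u = 1" "p \<bullet> u = 0" for u b
    proof -
      have "(p, u) \<in> STS" using that pv0S by simp
      then have "monomial p b (Qinv (Q (rot (- s) (p, u)))) = monomial p b (rot (- s) (p, u))"
        by (intro monomial_Qinv rot_in_STS)
      moreover have "zcomp p (p, u) = 1" using that pp by (simp add: zcomp_def complex_eq_iff inner_commute)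
      ultimately have "monomial p b (Qinv (Q (rot (- s) (p, u)))) = cis (real c * s) * zcomp b (p, u)"
        by (simp only: monomial_rot) (simp add: monomial_def)
      then show ?thesis by (simp only: mult.assoc[symmetric] cis_mult) (simp add: zcomp_def)
    qed
    have "smooth_on UNIV (\<lambda>t. v t \<bullet> b)" for b
    proof -
      have "smooth_on UNIV ((\<lambda>\<Gamma>. Im (cis (- (real c * s)) * monomial p b (Qinv \<Gamma>))) \<circ> \<alpha>)"
        using \<alpha>(2) monomial_funs(2) unfolding smooth_curve_def by blast
      then show ?thesis using recover v by (simp add: o_def)
    qed
    then have smv: "smooth_on UNIV v" by (rule smooth_on_componentwise)
    have "Q (rot (- s) (p, v 0)) = Q (rot (- s) (p, v0))" using v(1)[of 0] \<alpha>(4) start by simp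
    \<comment> \<open>The directions were chosen separately for each t; \<open>recover\<close> shows
      that the geodesic determines them, so at 0 the choice must be the direction of
      \<open>w\<close>.\<close>
    then have "v 0 \<bullet> b = v0 \<bullet> b" for b using recover[of "v 0" b] recover[of v0 b] v(2)[of 0] pv0S by simp
    then have v00: "v 0 = v0" by (simp add: euclidean_eq_iff[where 'a = "real^3"])
    define v' where "v' = vector_derivative v (at 0)"
    have v': "(v has_vector_derivative v') (at 0)"
      unfolding v'_def by (rule smooth_curve_has_vector_derivative[OF smv])
    have pvr: "range (\<lambda>t. (p, v t)) \<subseteq> STS" using v(2) pv0S by auto
    have "((\<lambda>t. (p, v t)) has_vector_derivative (0, v')) (at 0)"
      by (intro has_vector_derivative_Pair has_vector_derivative_const v')
    from STS_velocity[OF pvr this] have "v' \<bullet> v0 = 0" "v' \<bullet> p = 0" by (simp_all add: v00 inner_commute)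
    then have "v' = (v' \<bullet> nvec w) *\<^sub>R nvec w"
      unfolding n using perp_frame[OF pv0S, of v'] by simp
    then obtain a where a: "v' = a *\<^sub>R nvec w" by blast
    have "\<alpha> = Q \<circ> (\<lambda>t. rot (- s) (p, v t))" using v(1) by auto
    moreover have "velocity N (Q \<circ> (\<lambda>t. rot (- s) (p, v t))) =
        null_vector w ((- (a * sin s)) *\<^sub>R nvec w, (a * cos s) *\<^sub>R nvec w)"
      by (rule velocity_null[OF range[OF v(2)] _ vel[OF v'[unfolded a]]])
         (auto simp: v00 start intro!: smooth_on_rot smooth_intros smv)
    ultimately show "D \<in> {null_vector w ((- (a * sin s)) *\<^sub>R nvec w, (a * cos s) *\<^sub>R nvec w) | a. True}"
      using \<alpha>(1) by blast
  next
    fix D assume "D \<in> {null_vector w ((- (a * sin s)) *\<^sub>R nvec w, (a * cos s) *\<^sub>R nvec w) | a. True}"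
    then obtain a where D: "D = null_vector w ((- (a * sin s)) *\<^sub>R nvec w, (a * cos s) *\<^sub>R nvec w)" by blast
    define v where "v t = cos (a * t) *\<^sub>R v0 + sin (a * t) *\<^sub>R nvec w" for t
    note fr = STS_frame[OF pv0S, unfolded fst_conv snd_conv, folded n]
    have v: "norm (v t) = 1 \<and> p \<bullet> v t = 0" for t
      using fr sin_cos_squared_add3[of "a * t"] by (simp add: v_def norm_eq_1 inner_add_left inner_add_right)
    have v': "(v has_vector_derivative a *\<^sub>R nvec w) (at 0)"
      unfolding v_def by (auto intro!: derivative_eq_intros)
    have smv: "smooth_on UNIV v" unfolding v_def by (intro smooth_intros)
    let ?\<beta> = "\<lambda>t. rot (- s) (p, v t)"
    have v00: "v 0 = v0" by (simp add: v_def)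
    have sm\<beta>: "smooth_on UNIV ?\<beta>" by (intro smooth_on_rot smooth_intros smv)
    have "D = velocity N (Q \<circ> ?\<beta>)"
      unfolding D by (rule velocity_null[OF range[OF v] _ vel[OF v'] sm\<beta>, symmetric]) (simp add: v00 start)
    moreover have "smooth_curve N (Q \<circ> ?\<beta>)" by (rule smooth_curve_null[OF range[OF v] sm\<beta>])
    moreover have "range (Q \<circ> ?\<beta>) \<subseteq> sky (S2xS1 c d) (point_at w s)"
      unfolding sky_point_at[OF w] p_def[symmetric] using v by auto
    moreover have "(Q \<circ> ?\<beta>) 0 = Q w" by (simp add: v00 start)
    ultimately show "D \<in> tangent_space N (sky (S2xS1 c d) (point_at w s)) (Q w)"
      unfolding tangent_space_def by blast
  qed
qed

text \<open>Here t - s = k is a multiple of pi, and nonzero because the points differ. Turning the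
  initial direction at p about p does not move the end point, since its coefficient sin k vanishes,
  and the circle factor is common to all members. The speed k puts both ends at parameters 0 and
  1.\<close>

lemma point_at_joined:
  assumes w: "w \<in> STS" and sin: "sin (s - t) = 0" and ne: "point_at w s \<noteq> point_at w t"
  shows "joined_by_family (S2xS1 c d) (point_at w s) (point_at w t)"
proof -
  have "sin (t - s) = 0" using sin by (metis minus_diff_eq sin_minus neg_equal_0_iff_equal)
  then obtain m :: int where m: "t - s = of_int m * pi" using sin_zero_iff_int2 by blast
  define k where "k = of_int m * pi"
  have t: "t = s + k" using m by (simp add: k_def)
  have k0: "k \<noteq> 0" using ne t by auto
  define p where "p = fst (rot s w)"
  define v0 where "v0 = snd (rot s w)"
  define z where "z = cis (real c / real d * s)"
  have pv0: "rot s w = (p, v0)" by (simp add: p_def v0_def)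
  then have S: "(p, v0) \<in> STS" using rot_in_STS[OF w, of s] by simp
  note fr = STS_frame[OF S, unfolded fst_conv snd_conv]
  define n where "n = cross3 p v0"
  define v where "v \<sigma> = cos \<sigma> *\<^sub>R v0 + sin \<sigma> *\<^sub>R n" for \<sigma>
  have v: "norm (v \<sigma>) = 1" "p \<bullet> v \<sigma> = 0" for \<sigma>
    using fr sin_cos_squared_add3[of \<sigma>] by (simp_all add: v_def n_def norm_eq_1 inner_add_left inner_add_right)
  define F where "F \<sigma> \<tau> = (cos (k * \<tau>) *\<^sub>R p + sin (k * \<tau>) *\<^sub>R v \<sigma>, z * cis (real c / real d * k * \<tau>))" for \<sigma> \<tau>
  have iz: "norm (\<i> * z) = 1" "norm z = 1" by (auto simp: z_def norm_mult)
  have F_geo: "F \<sigma> = geo (p, z) (k *\<^sub>R v \<sigma>, (real c / real d * k) *\<^sub>R (\<i> * z))" for \<sigma>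
  proof
    fix \<tau>
    show "F \<sigma> \<tau> = geo (p, z) (k *\<^sub>R v \<sigma>, (real c / real d * k) *\<^sub>R (\<i> * z)) \<tau>"
      unfolding geo_def fst_conv snd_conv circ_scale[OF v(1)] circ_scale[OF iz(1)] F_def
      by (simp add: complex_eq_iff algebra_simps)
  qed
  have px: "point_at w s = (p, z)" by (simp add: point_at_def p_def z_def)
  have "rot (s + k) w = rot k (rot s w)" by (simp add: rot_rot add.commute)
  then have py: "point_at w t = (cos k *\<^sub>R p + sin k *\<^sub>R v0, z * cis (real c / real d * k))"
    by (simp add: t point_at_def z_def cis_mult pv0 distrib_left[symmetric] add_divide_distrib[symmetric])
      (simp add: rot_def)
  have "sin k = 0" by (simp add: k_def mult.commute)
  have geod: "is_geodesic (S2xS1 c d) UNIV (F \<sigma>)" for \<sigma>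
    unfolding F_geo
  proof (rule geo_is_geodesic)
    show "(p, z) \<in> S2S1" using S iz by simp
    show "tangent (p, z) (k *\<^sub>R v \<sigma>, (real c / real d * k) *\<^sub>R (\<i> * z))"
      using v(2)[of \<sigma>] by (simp add: tangent_def inner_commute inner_complex_def)
  qed
  have sm: "smooth_on (UNIV \<times> UNIV) (\<lambda>(\<sigma>, \<tau>). F \<sigma> \<tau>)"
    unfolding F_def v_def split_beta by (intro smooth_intros)
  \<comment> \<open>A quarter turn from p, where the members for the angles 0 and pi are at opposite
    points.\<close>
  define \<tau> where "\<tau> = pi / 2 / k"
  have "k * \<tau> = pi / 2" using k0 by (simp add: \<tau>_def)
  then have "fst (F 0 \<tau>) = v0" "fst (F pi \<tau>) = - v0" unfolding F_def fst_conv by (simp_all only:) (simp_all add: v_def)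
  moreover have "v0 \<noteq> - v0"
  proof
    assume "v0 = - v0"
    then have "v0 \<bullet> v0 = - (v0 \<bullet> v0)" by (metis inner_minus_left)
    then show False using fr(2) by simp
  qed
  ultimately have "F 0 \<tau> \<noteq> F pi \<tau>" by auto
  then have "\<exists>s\<in>UNIV. \<exists>s'\<in>UNIV. \<exists>\<tau>\<in>UNIV. F s \<tau> \<noteq> F s' \<tau>" by blast
  moreover have "\<forall>\<sigma>\<in>UNIV. is_geodesic (S2xS1 c d) UNIV (F \<sigma>) \<and> F \<sigma> 0 = point_at w s \<and> F \<sigma> 1 = point_at w t"
    using geod \<open>sin k = 0\<close> by (simp add: px py) (simp add: F_def)
  ultimately show ?thesis
    unfolding joined_by_family_def using sm by (intro exI[of _ F] exI[of _ UNIV]) simp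
qed

text \<open>The geodesics joining two points at distance \<open>\<pi>/2\<close> form a countable set.\<close>

lemma quarter_not_joined:
  assumes w: "w \<in> STS"
  shows "\<not> joined_by_family (S2xS1 c d) (point_at w 0) (point_at w (pi / 2))"
proof
  let ?X = "point_at w 0" and ?Y = "point_at w (pi / 2)"
  obtain x u where xu: "w = (x, u)" by (cases w)
  have X: "?X = (x, 1)" and Y: "?Y = (u, cis (real c / real d * (pi / 2)))" by (simp_all add: point_at_def xu rot_def)
  note fr = STS_frame[OF w, unfolded xu fst_conv snd_conv]
  assume "joined_by_family (S2xS1 c d) ?X ?Y"
  then obtain F :: "real \<Rightarrow> real \<Rightarrow> (real^3) \<times> complex" and J I where
    J: "open J" "is_interval J" and I: "0 \<in> I" "1 \<in> I" and sm: "smooth_on (J \<times> I) (\<lambda>(s, \<tau>). F s \<tau>)"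
    and geod: "\<And>s. s \<in> J \<Longrightarrow> is_geodesic (S2xS1 c d) I (F s) \<and> F s 0 = ?X \<and> F s 1 = ?Y"
    and ne: "\<exists>s\<in>J. \<exists>s'\<in>J. \<exists>\<tau>\<in>I. F s \<tau> \<noteq> F s' \<tau>"
    unfolding joined_by_family_def by blast
  define K where "K = {k :: real. cos k = 0}"
  define R where "R = range (\<lambda>j::int. real c / real d * (pi / 2) + 2 * pi * of_int j)"
  \<comment> \<open>Contains the initial velocities of all geodesics from the first point to the
    second. The spatial part has a length k with cos k = 0 and points along u or - u according to
    sin k = 1 or - 1; the circle part is determined up to multiples of 2 pi.\<close>
  define V where "V = (\<lambda>(k, r). ((k * sin k) *\<^sub>R u, r *\<^sub>R \<i>)) ` (K \<times> R)"
  have "countable V" unfolding V_def K_def R_def by (intro countable_image countable_SIGMA countable_cos_zero) auto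
  have inV: "v \<in> V" if "tangent ?X v" "geo ?X v 1 = ?Y" for v
  proof -
    obtain y \<rho> where y: "v = (y, \<rho>)" by (cases v)
    have e1: "cos (norm y) *\<^sub>R x + sin (norm y) *\<^sub>R sgn y = u" and e2: "circ 1 \<rho> 1 = cis (real c / real d * (pi / 2))"
      using that(2) by (auto simp: X Y y geo_def circ_def)
    have yx: "y \<bullet> x = 0" using that(1) by (simp add: X y tangent_def)
    have "(cos (norm y) *\<^sub>R x + sin (norm y) *\<^sub>R sgn y) \<bullet> x = u \<bullet> x" using e1 by simp
    then have ck: "cos (norm y) = 0" using fr yx by (simp add: inner_add_left sgn_div_norm)
    then have "sin (norm y) * sin (norm y) = 1" using sin_cos_squared_add3[of "norm y"] by simp
    moreover have "sin (norm y) *\<^sub>R (sin (norm y) *\<^sub>R sgn y) = sin (norm y) *\<^sub>R u" using e1 ck by simp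
    ultimately have "sgn y = sin (norm y) *\<^sub>R u" by simp
    then have "y = (norm y * sin (norm y)) *\<^sub>R u" by (metis norm_scaleR_sgn scaleR_scaleR)
    have "Re \<rho> = 0" using that(1) by (simp add: X y tangent_def inner_complex_def)
    then have \<rho>: "\<rho> = Im \<rho> *\<^sub>R \<i>" by (simp add: complex_eq_iff)
    have "circ 1 \<rho> 1 = cis (Im \<rho>)"
      by (subst \<rho>, subst circ_scale) (auto simp: complex_eq_iff)
    then obtain j :: int where "Im \<rho> = real c / real d * (pi / 2) + 2 * pi * of_int j"
      using e2 cis_eq_iff by metis
    then have "Im \<rho> \<in> R" unfolding R_def by blast
    moreover have "norm y \<in> K" using ck by (simp add: K_def)
    ultimately show "v \<in> V"
      unfolding V_def y using \<open>y = _\<close> \<rho> by (intro image_eqI[of _ _ "(norm y, Im \<rho>)"]) auto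
  qed
  have const: "F s \<tau> = F s' \<tau>" if "s \<in> J" "s' \<in> J" "\<tau> \<in> I" for s s' \<tau>
  proof (rule ccontr)
    assume neq: "F s \<tau> \<noteq> F s' \<tau>"
    have "F \<sigma> \<tau> \<in> (\<lambda>v. geo ?X v \<tau>) ` V" if \<sigma>: "\<sigma> \<in> J" for \<sigma>
    proof -
      have g: "is_geodesic (S2xS1 c d) I (F \<sigma>)" "F \<sigma> 0 = ?X" "F \<sigma> 1 = ?Y" using geod[OF \<sigma>] by auto
      let ?v = "vector_derivative (F \<sigma>) (at 0)"
      note gg = geodesic_imp_geo[OF g(1) I(1) c d]
      have "geo ?X ?v 1 = ?Y" using gg(3)[OF I(2)] g by simp
      moreover have "tangent ?X ?v" using gg(2) g by simp
      ultimately have "?v \<in> V" using inV by blast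
      moreover have "F \<sigma> \<tau> = geo ?X ?v \<tau>" using gg(3)[OF \<open>\<tau> \<in> I\<close>] g by simp
      ultimately show ?thesis by blast
    qed
    then have "(\<lambda>\<sigma>. F \<sigma> \<tau>) ` J \<subseteq> (\<lambda>v. geo ?X v \<tau>) ` V" by blast
    then have "countable ((\<lambda>\<sigma>. F \<sigma> \<tau>) ` J)"
      using \<open>countable V\<close> countable_subset countable_image by metis
    moreover have "connected ((\<lambda>\<sigma>. F \<sigma> \<tau>) ` J)"
    proof (rule connected_continuous_image)
      have "continuous_on J ((\<lambda>(s, \<tau>). F s \<tau>) \<circ> (\<lambda>\<sigma>. (\<sigma>, \<tau>)))"
        by (intro continuous_on_compose continuous_intros continuous_on_subset[OF smooth_on_imp_continuous_on[OF sm]])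
           (use \<open>\<tau> \<in> I\<close> in auto)
      then show "continuous_on J (\<lambda>\<sigma>. F \<sigma> \<tau>)" by (simp add: o_def)
      show "connected J" using J(2) is_interval_connected by blast
    qed
    ultimately show False using connected_uncountable[OF _ _ _ neq] that by blast
  qed
  then show False using ne by blast
qed

lemma admissible_pair_obtain:
  assumes w: "w \<in> STS" and adm: "admissible_pair (S2xS1 c d) (Q w) X Y"
  obtains s t where "X = point_at w s" "Y = point_at w t" "sin (s - t) \<noteq> 0"
proof -
  obtain s t where "X = point_at w s" "Y = point_at w t"
    using adm unfolding admissible_pair_def Q_eq_range by blast
  then show ?thesis using that adm point_at_joined[OF w] unfolding admissible_pair_def by blast
qed

lemma admissible_pair_exists:
  assumes w: "w \<in> STS"
  shows "admissible_pair (S2xS1 c d) (Q w) (point_at w 0) (point_at w (pi / 2))"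
proof -
  have "fst w \<noteq> snd w" using STS_frame[OF w] by auto
  then have "point_at w 0 \<noteq> point_at w (pi / 2)" by (auto simp: point_at_def rot_def split_beta)
  then show ?thesis
    unfolding admissible_pair_def using quarter_not_joined[OF w] by (auto simp: Q_eq_range)
qed

text \<open>In the coordinates (a n, b n) the two sky directions have determinant sin (s - t) up to
  sign. That it is nonzero yields both the trivial intersection and the full sum. The sum does not
  depend on the pair, and one admissible pair already determines it, as the definite description
  requires.\<close>

lemma canonical_contact_eq:
  assumes w: "w \<in> STS"
  shows "canonical_contact (S2xS1 c d) (Q w) = {null_vector w (a *\<^sub>R nvec w, b *\<^sub>R nvec w) | a b. True}"
    (is "_ = ?D")
proof -
  let ?T = "\<lambda>X. tangent_space N (sky (S2xS1 c d) X) (Q w)"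
  have ds: "direct_sum ?D (?T X) (?T Y)" if adm: "admissible_pair (S2xS1 c d) (Q w) X Y" for X Y
  proof -
    obtain s t where st: "X = point_at w s" "Y = point_at w t" "sin (s - t) \<noteq> 0"
      using admissible_pair_obtain[OF w adm] .
    define \<delta> where "\<delta> = sin s * cos t - cos s * sin t"
    have \<delta>: "\<delta> \<noteq> 0" using st(3) by (simp add: \<delta>_def sin_diff)
    define A where "A a = null_vector w ((- (a * sin s)) *\<^sub>R nvec w, (a * cos s) *\<^sub>R nvec w)" for a
    define B where "B a = null_vector w ((- (a * sin t)) *\<^sub>R nvec w, (a * cos t) *\<^sub>R nvec w)" for a
    have TX: "?T X = range A" and TY: "?T Y = range B"
      unfolding st(1,2) tangent_space_sky[OF w] A_def B_def by auto
    have zero: "A 0 = (\<lambda>_. 0)" "B 0 = (\<lambda>_. 0)"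
      using null_vector_linear(2)[OF w] by (simp_all add: A_def B_def zero_prod_def)
    have "a = 0" if "A a = B b" for a b
    proof -
      have *: "- (a * sin s) = - (b * sin t)" "a * cos s = b * cos t"
        using null_vector_inj[OF w] that unfolding A_def B_def by blast+
      have "a * \<delta> = (a * sin s) * cos t - (a * cos s) * sin t" by (simp add: \<delta>_def algebra_simps)
      also have "\<dots> = 0" using * by (simp add: algebra_simps)
      finally show ?thesis using \<delta> by simp
    qed
    then have "D \<in> {\<lambda>_. 0}" if "D \<in> range A \<inter> range B" for D using that zero by auto
    moreover have "(\<lambda>_. 0) \<in> range A \<inter> range B" using zero by (metis IntI rangeI)
    ultimately have "range A \<inter> range B = {\<lambda>_. 0}" by blast
    moreover have "?D = {\<lambda>f. a f + b f | a b. a \<in> range A \<and> b \<in> range B}"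
    proof -
      have sum: "(\<lambda>f. A a f + B b f) = null_vector w ((- (a * sin s) - b * sin t) *\<^sub>R nvec w, (a * cos s + b * cos t) *\<^sub>R nvec w)" for a b
        unfolding A_def B_def null_vector_linear(1)[OF w, symmetric] by (simp add: scaleR_add_left scaleR_diff_left)
      have "\<exists>a b. null_vector w (\<alpha> *\<^sub>R nvec w, \<beta> *\<^sub>R nvec w) = (\<lambda>f. A a f + B b f)" for \<alpha> \<beta>
      proof -
        \<comment> \<open>Cramer's rule for the linear system with determinant \<delta>.\<close>
        define a where "a = - (\<alpha> * cos t + \<beta> * sin t) / \<delta>"
        define b where "b = (\<alpha> * cos s + \<beta> * sin s) / \<delta>"
        have "- (a * sin s) - b * sin t = (\<alpha> * \<delta>) / \<delta>"
          unfolding a_def b_def by (simp add: \<delta>_def algebra_simps diff_divide_distrib add_divide_distrib)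
        moreover have "a * cos s + b * cos t = (\<beta> * \<delta>) / \<delta>"
          unfolding a_def b_def by (simp add: \<delta>_def algebra_simps diff_divide_distrib add_divide_distrib)
        ultimately have "- (a * sin s) - b * sin t = \<alpha>" "a * cos s + b * cos t = \<beta>" using \<delta> by auto
        then show ?thesis unfolding sum by metis
      qed
      then have "\<exists>a b. D = (\<lambda>f. A a f + B b f)" if "D \<in> ?D" for D using that by blast
      moreover have "D \<in> ?D" if "D = (\<lambda>f. A a f + B b f)" for D a b using that sum by blast
      ultimately show ?thesis by blast
    qed
    ultimately show ?thesis unfolding direct_sum_def TX TY by blast
  qed
  note ex = admissible_pair_exists[OF w]
  show ?thesis
    unfolding canonical_contact_def
  proof (rule the_equality)
    show "(\<exists>x y. admissible_pair (S2xS1 c d) (Q w) x y) \<and>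
      (\<forall>x y. admissible_pair (S2xS1 c d) (Q w) x y \<longrightarrow> direct_sum ?D (?T x) (?T y))"
      using ds ex by blast
  next
    fix E assume "(\<exists>x y. admissible_pair (S2xS1 c d) (Q w) x y) \<and>
      (\<forall>x y. admissible_pair (S2xS1 c d) (Q w) x y \<longrightarrow> direct_sum E (?T x) (?T y))"
    then have "direct_sum E (?T (point_at w 0)) (?T (point_at w (pi / 2)))" using ex by blast
    with ds[OF ex] show "E = ?D" unfolding direct_sum_def by simp
  qed
qed

end

section \<open>Quaternions and lens spaces\<close>

text \<open>With the spinor (\<alpha>, \<beta>) formed by the conjugate components of q, the vector
  x + i u becomes quadratic: this is the classical spinor parametrisation of isotropic vectors in
  C^3.\<close>

lemma quat_to_STS2_zcomp:
  assumes "norm q = 1"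
  shows "zcomp (axis 1 1) (quat_to_STS2 q) = - 2 * (cnj (fst q) * cnj (snd q))"
    "zcomp (axis 2 1) (quat_to_STS2 q) = \<i> * ((cnj (fst q))\<^sup>2 + (cnj (snd q))\<^sup>2)"
    "zcomp (axis 3 1) (quat_to_STS2 q) = (cnj (fst q))\<^sup>2 - (cnj (snd q))\<^sup>2"
  using assms
  by (cases q; simp add: zcomp_def quat_to_STS2_def qimag_def qmult_def qinv_def qk_def qj_def inner_axis
      complex_eq_iff power2_eq_square algebra_simps)+

lemma zcomp_eqI:
  assumes "zcomp (axis 1 1) w = zcomp (axis 1 1) w'" "zcomp (axis 2 1) w = zcomp (axis 2 1) w'"
    "zcomp (axis 3 1) w = zcomp (axis 3 1) w'"
  shows "w = w'"
  using assms by (simp add: zcomp_def inner_axis prod_eq_iff vec_eq_iff forall_3)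

lemma zcomp_axis: "zcomp (axis i 1) w = Complex (fst w $ i) (snd w $ i)"
  by (simp add: zcomp_def inner_axis)

text \<open>For \<zeta> = x + i u the bilinear square is |x|^2 - |u|^2 + 2 i (x . u) and the
  Hermitian square is |x|^2 + |u|^2. So STS^2 is the sphere of radius sqrt 2 in the isotropic
  cone.\<close>

lemma STS_zcomp:
  "w \<in> STS \<longleftrightarrow> (zcomp (axis 1 1) w)\<^sup>2 + (zcomp (axis 2 1) w)\<^sup>2 + (zcomp (axis 3 1) w)\<^sup>2 = 0 \<and>
     (norm (zcomp (axis 1 1) w))\<^sup>2 + (norm (zcomp (axis 2 1) w))\<^sup>2 + (norm (zcomp (axis 3 1) w))\<^sup>2 = 2"
proof -
  obtain x u where w: "w = (x, u)" by (cases w)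
  have 1: "(zcomp (axis 1 1) w)\<^sup>2 + (zcomp (axis 2 1) w)\<^sup>2 + (zcomp (axis 3 1) w)\<^sup>2 =
      Complex (x \<bullet> x - u \<bullet> u) (2 * (x \<bullet> u))"
    unfolding zcomp_axis by (simp add: w complex_eq_iff inner_vec_def sum_3 power2_eq_square algebra_simps)
  have 2: "(norm (zcomp (axis 1 1) w))\<^sup>2 + (norm (zcomp (axis 2 1) w))\<^sup>2 + (norm (zcomp (axis 3 1) w))\<^sup>2 =
      x \<bullet> x + u \<bullet> u"
    unfolding zcomp_axis cmod_power2 by (simp add: w inner_vec_def sum_3 power2_eq_square algebra_simps)
  show ?thesis unfolding 1 2 by (auto simp: w norm_eq_1 complex_eq_iff)
qed

lemma norm_pair_eq_1: "norm (q :: complex \<times> complex) = 1 \<longleftrightarrow> (norm (fst q))\<^sup>2 + (norm (snd q))\<^sup>2 = 1"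
  by (cases q) (simp add: norm_Pair)

lemma norm_spinor:
  fixes \<alpha> \<beta> :: complex
  shows "(norm (- 2 * (\<alpha> * \<beta>)))\<^sup>2 + (norm (\<i> * (\<alpha>\<^sup>2 + \<beta>\<^sup>2)))\<^sup>2 + (norm (\<alpha>\<^sup>2 - \<beta>\<^sup>2))\<^sup>2 =
    2 * ((norm \<alpha>)\<^sup>2 + (norm \<beta>)\<^sup>2)\<^sup>2"
  unfolding cmod_power2 by (simp add: power2_eq_square algebra_simps)

lemma quat_to_STS2_in_STS:
  assumes "norm q = 1"
  shows "quat_to_STS2 q \<in> STS"
  unfolding STS_zcomp quat_to_STS2_zcomp[OF assms]
proof
  show "(- 2 * (cnj (fst q) * cnj (snd q)))\<^sup>2 + (\<i> * ((cnj (fst q))\<^sup>2 + (cnj (snd q))\<^sup>2))\<^sup>2 +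
      ((cnj (fst q))\<^sup>2 - (cnj (snd q))\<^sup>2)\<^sup>2 = 0"
    by (simp add: power_mult_distrib) (simp add: power2_eq_square algebra_simps)
  show "(norm (- 2 * (cnj (fst q) * cnj (snd q))))\<^sup>2 + (norm (\<i> * ((cnj (fst q))\<^sup>2 + (cnj (snd q))\<^sup>2)))\<^sup>2 +
      (norm ((cnj (fst q))\<^sup>2 - (cnj (snd q))\<^sup>2))\<^sup>2 = 2"
    unfolding norm_spinor using assms by (simp add: norm_pair_eq_1)
qed

text \<open>The squares and the product of the conjugate components of a quaternion over \<open>w\<close>.\<close>

definition spin_aa :: "(real^3) \<times> (real^3) \<Rightarrow> complex" where
  "spin_aa w = (zcomp (axis 3 1) w - \<i> * zcomp (axis 2 1) w) / 2"

definition spin_bb :: "(real^3) \<times> (real^3) \<Rightarrow> complex" where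
  "spin_bb w = - (zcomp (axis 3 1) w + \<i> * zcomp (axis 2 1) w) / 2"

definition spin_ab :: "(real^3) \<times> (real^3) \<Rightarrow> complex" where
  "spin_ab w = - zcomp (axis 1 1) w / 2"

lemma quat_to_STS2_eq_iff:
  assumes "norm q = 1"
  shows "quat_to_STS2 q = w \<longleftrightarrow> spin_aa w = (cnj (fst q))\<^sup>2 \<and> spin_bb w = (cnj (snd q))\<^sup>2 \<and>
     spin_ab w = cnj (fst q) * cnj (snd q)"
proof
  show "spin_aa w = (cnj (fst q))\<^sup>2 \<and> spin_bb w = (cnj (snd q))\<^sup>2 \<and> spin_ab w = cnj (fst q) * cnj (snd q)"
    if "quat_to_STS2 q = w"
    unfolding that[symmetric] spin_aa_def spin_bb_def spin_ab_def quat_to_STS2_zcomp[OF assms]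
    by (simp add: algebra_simps)
next
  assume R: "spin_aa w = (cnj (fst q))\<^sup>2 \<and> spin_bb w = (cnj (snd q))\<^sup>2 \<and> spin_ab w = cnj (fst q) * cnj (snd q)"
  have "zcomp (axis 1 1) w = - 2 * spin_ab w" "zcomp (axis 2 1) w = \<i> * (spin_aa w + spin_bb w)"
    "zcomp (axis 3 1) w = spin_aa w - spin_bb w"
    by (simp_all add: spin_aa_def spin_bb_def spin_ab_def field_simps)
  then show "quat_to_STS2 q = w"
    by (intro zcomp_eqI) (simp_all only: quat_to_STS2_zcomp[OF assms] R)
qed

text \<open>Isotropy says \<open>spin_aa w * spin_bb w = (spin_ab w)\<^sup>2\<close>, so square
  roots \<alpha>, \<beta> of the first two can be chosen with product \<open>spin_ab w\<close>:
  divide by \<alpha> if it is nonzero, otherwise any root serves for \<beta>. The norm condition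
  then makes the spinor a unit vector.\<close>

lemma quat_to_STS2_surj:
  assumes "w \<in> STS"
  obtains q where "norm q = 1" "quat_to_STS2 q = w"
proof -
  let ?z1 = "zcomp (axis 1 1) w" and ?z2 = "zcomp (axis 2 1) w" and ?z3 = "zcomp (axis 3 1) w"
  have sq: "?z1\<^sup>2 + ?z2\<^sup>2 + ?z3\<^sup>2 = 0"
    and nn: "(norm ?z1)\<^sup>2 + (norm ?z2)\<^sup>2 + (norm ?z3)\<^sup>2 = 2" using assms unfolding STS_zcomp by auto
  have prod: "spin_aa w * spin_bb w = (spin_ab w)\<^sup>2"
  proof -
    have "4 * (spin_aa w * spin_bb w) = (?z3 - \<i> * ?z2) * (- (?z3 + \<i> * ?z2))"
      by (simp only: spin_aa_def spin_bb_def) simp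
    also have "\<dots> = - (?z3\<^sup>2 + ?z2\<^sup>2)" by (simp add: power2_eq_square algebra_simps)
    finally have "4 * (spin_aa w * spin_bb w) = - (?z3\<^sup>2 + ?z2\<^sup>2)" .
    moreover have "4 * (spin_ab w)\<^sup>2 = ?z1\<^sup>2" by (simp add: spin_ab_def power2_eq_square)
    moreover have "?z1\<^sup>2 = - (?z3\<^sup>2 + ?z2\<^sup>2)" using sq by algebra
    ultimately have "4 * (spin_aa w * spin_bb w) = 4 * (spin_ab w)\<^sup>2" by (simp only:)
    then show ?thesis by simp
  qed
  obtain \<alpha> \<beta> where ab: "\<alpha>\<^sup>2 = spin_aa w" "\<beta>\<^sup>2 = spin_bb w" "\<alpha> * \<beta> = spin_ab w"
  proof (cases "spin_aa w = 0")
    case True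
    then have "spin_ab w = 0" using prod by simp
    then show ?thesis using that[of 0 "csqrt (spin_bb w)"] True by simp
  next
    case False
    define \<alpha> where "\<alpha> = csqrt (spin_aa w)"
    have \<alpha>: "\<alpha>\<^sup>2 = spin_aa w" "\<alpha> \<noteq> 0" using False by (auto simp: \<alpha>_def)
    have "(spin_ab w / \<alpha>)\<^sup>2 = spin_bb w" using prod \<alpha> False by (simp add: power_divide field_simps)
    then show ?thesis using that[of \<alpha> "spin_ab w / \<alpha>"] \<alpha> by simp
  qed
  have z: "?z1 = - 2 * (\<alpha> * \<beta>)" "?z2 = \<i> * (\<alpha>\<^sup>2 + \<beta>\<^sup>2)" "?z3 = \<alpha>\<^sup>2 - \<beta>\<^sup>2"
    unfolding ab by (simp_all add: spin_aa_def spin_bb_def spin_ab_def field_simps)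
  have "2 * ((norm \<alpha>)\<^sup>2 + (norm \<beta>)\<^sup>2)\<^sup>2 = 2" using nn unfolding z norm_spinor .
  then have "((norm \<alpha>)\<^sup>2 + (norm \<beta>)\<^sup>2)\<^sup>2 = 1\<^sup>2" by simp
  then have "(norm \<alpha>)\<^sup>2 + (norm \<beta>)\<^sup>2 = 1" by (rule power2_eq_imp_eq) auto
  then have n: "norm (cnj \<alpha>, cnj \<beta>) = 1" by (simp add: norm_pair_eq_1)
  then have "quat_to_STS2 (cnj \<alpha>, cnj \<beta>) = w" unfolding quat_to_STS2_eq_iff[OF n] by (simp add: ab)
  with n that show ?thesis by blast
qed

text \<open>The squares fix each component up to sign, and the product ties the two signs
  together.\<close>

lemma quat_to_STS2_eqD:
  assumes "norm q = 1" "norm q' = 1" "quat_to_STS2 q = quat_to_STS2 q'"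
  shows "q' = q \<or> q' = - q"
proof -
  obtain a b a' b' where q: "q = (a, b)" "q' = (a', b')" by (cases q; cases q')
  have "(cnj a)\<^sup>2 = (cnj a')\<^sup>2" "(cnj b)\<^sup>2 = (cnj b')\<^sup>2" "cnj a * cnj b = cnj a' * cnj b'"
    using quat_to_STS2_eq_iff[OF assms(1), of "quat_to_STS2 q'"] quat_to_STS2_eq_iff[OF assms(2), of "quat_to_STS2 q'"] assms(3)
    by (auto simp: q)
  then have e: "a\<^sup>2 = a'\<^sup>2" "b\<^sup>2 = b'\<^sup>2" "a * b = a' * b'"
    by (metis complex_cnj_cnj complex_cnj_mult complex_cnj_power)+
  show ?thesis
  proof (cases "a' = 0")
    case True
    then have "a = 0" using e by simp
    then show ?thesis using e True power2_eq_iff[of b' b] by (auto simp: q)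
  next
    case False
    from e(1) have "a = a' \<or> a = - a'" by (simp add: power2_eq_iff)
    then show ?thesis
    proof
      assume a: "a = - a'"
      then have "a' * b' = a' * (- b)" using e(3) by simp
      then have "b' = - b" using False by (metis mult_cancel_left)
      then show ?thesis using a by (simp add: q)
    qed (use e(3) False in \<open>auto simp: q\<close>)
  qed
qed

text \<open>A phase of q is conjugated and squared in x + i u, giving
  \<open>cis (- 2 * \<theta>)\<close>, which is rotation by twice the angle. This doubling turns the
  Z_2c-action on the sphere into the Z_c-action.\<close>

lemma quat_to_STS2_rot:
  assumes "norm q = 1"
  shows "quat_to_STS2 (cis \<theta> * fst q, cis \<theta> * snd q) = rot (2 * \<theta>) (quat_to_STS2 q)"
proof -
  have n: "norm (cis \<theta> * fst q, cis \<theta> * snd q) = 1"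
    using assms by (simp add: norm_pair_eq_1 norm_mult)
  have "cis (- (2 * \<theta>)) = cis (- \<theta>) * cis (- \<theta>)" by (simp add: cis_mult)
  then show ?thesis
    by (intro zcomp_eqI)
       (simp_all add: zcomp_rot quat_to_STS2_zcomp[OF assms] quat_to_STS2_zcomp[OF n] cis_cnj power2_eq_square algebra_simps)
qed

section \<open>Smooth descent along the map from unit quaternions\<close>

lemma smooth_on_zcomp: "smooth_on S f \<Longrightarrow> smooth_on S (\<lambda>x. zcomp b (f x))"
  by (rule smooth_on_linear_compose[OF zcomp_linear])

lemma smooth_on_quat_to_STS2: "smooth_on (sphere 0 1) quat_to_STS2"
proof (rule smooth_on_cong)
  let ?a = "\<lambda>q. cnj (fst q)" and ?b = "\<lambda>q. cnj (snd q)"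
  let ?z = "\<lambda>q. [- 2 * (?a q * ?b q), \<i> * ((?a q)\<^sup>2 + (?b q)\<^sup>2), (?a q)\<^sup>2 - (?b q)\<^sup>2]"
  let ?v = "\<lambda>r q. (r (- 2 * (?a q * ?b q)) *\<^sub>R axis 1 1 + r (\<i> * ((?a q)\<^sup>2 + (?b q)\<^sup>2)) *\<^sub>R axis 2 1 +
      r ((?a q)\<^sup>2 - (?b q)\<^sup>2) *\<^sub>R axis 3 1) :: real^3"
  show "smooth_on (sphere 0 1) (\<lambda>q. (?v Re q, ?v Im q))"
    by (intro smooth_intros)
  fix q :: "complex \<times> complex" assume "q \<in> sphere 0 1"
  then have n: "norm q = 1" by simp
  have *: "fst (quat_to_STS2 q) $ i = Re (zcomp (axis i 1) (quat_to_STS2 q))"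
    "snd (quat_to_STS2 q) $ i = Im (zcomp (axis i 1) (quat_to_STS2 q))" for i
    by (simp_all add: zcomp_def inner_axis)
  show "(?v Re q, ?v Im q) = quat_to_STS2 q"
    unfolding prod_eq_iff vec_eq_iff forall_3 * quat_to_STS2_zcomp[OF n] by (simp add: axis_def)
qed

text \<open>The principal square root on the right half plane, in a form whose smoothness is evident.\<close>

definition rsqrt :: "complex \<Rightarrow> complex" where
  "rsqrt w = inverse (sqrt (2 * (norm w + Re w))) *\<^sub>R (of_real (norm w) + w)"

text \<open>From |w|^2 = w cnj(w) and w + cnj(w) = 2 Re w it follows that (|w| + w)^2 = 2 (|w| + Re
  w) w; the scalar in \<open>rsqrt\<close> normalises this.\<close>

lemma rsqrt_square:
  assumes "Re w > 0"
  shows "(rsqrt w)\<^sup>2 = w"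
proof -
  have pos: "2 * (norm w + Re w) > 0" using assms by (simp add: add_nonneg_pos)
  have nw: "(complex_of_real (norm w))\<^sup>2 = w * cnj w" by (metis complex_norm_square of_real_power)
  have re: "w + cnj w = of_real (2 * Re w)" by (simp add: complex_eq_iff)
  have "(of_real (norm w) + w)\<^sup>2 = (complex_of_real (norm w))\<^sup>2 + 2 * of_real (norm w) * w + w * w"
    by (simp only: power2_eq_square algebra_simps) simp
  also have "\<dots> = ((w + cnj w) + 2 * of_real (norm w)) * w" unfolding nw by (simp only: algebra_simps)
  also have "\<dots> = of_real (2 * (norm w + Re w)) * w" unfolding re by (simp add: add.commute)
  finally have "(of_real (norm w) + w)\<^sup>2 = of_real (2 * (norm w + Re w)) * w" .
  moreover have "(inverse (sqrt (2 * (norm w + Re w))))\<^sup>2 = inverse (2 * (norm w + Re w))"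
    using pos by (simp add: power_inverse)
  ultimately have "(rsqrt w)\<^sup>2 = inverse (2 * (norm w + Re w)) *\<^sub>R (of_real (2 * (norm w + Re w)) * w)"
    unfolding rsqrt_def scaleR_power by simp
  also have "\<dots> = w"
  proof -
    have "inverse r *\<^sub>R (of_real r * w) = w" if "r \<noteq> 0" for r using that by (simp add: scaleR_conv_of_real)
    then show ?thesis using pos by (metis less_numeral_extra(3))
  qed
  finally show ?thesis .
qed

lemma smooth_on_rsqrt:
  assumes "smooth_on S f" "\<And>x. x \<in> S \<Longrightarrow> Re (f x) > 0"
  shows "smooth_on S (\<lambda>x. rsqrt (f x))"
proof -
  have 1: "f x \<noteq> 0" if "x \<in> S" for x using assms(2)[OF that] by auto
  have 2: "2 * (norm (f x) + Re (f x)) > 0" if "x \<in> S" for x using assms(2)[OF that] by (simp add: add_nonneg_pos)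
  show ?thesis
    unfolding rsqrt_def by (intro smooth_intros assms(1) 1 2) (use 2 in \<open>force+\<close>)
qed

text \<open>A local section near \<open>quat_to_STS2 q\<^sub>0\<close>: for a linear form \<open>\<ell>\<close> equal to \<open>1\<close> at the spinor of \<open>q\<^sub>0\<close>, the
  products of \<open>\<ell>\<close> with the spinor components and \<open>\<ell>\<^sup>2\<close> itself are linear functions on \<open>STS\<^sup>2\<close>.\<close>

lemma quat_to_STS2_descent:
  "smooth_on (sphere 0 1) (\<lambda>q. g (quat_to_STS2 q)) \<longleftrightarrow> smooth_on STS g"
proof
  assume "smooth_on STS g"
  from smooth_on_compose[OF this smooth_on_quat_to_STS2]
  show "smooth_on (sphere 0 1) (\<lambda>q. g (quat_to_STS2 q))" using quat_to_STS2_in_STS by simp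
next
  assume g: "smooth_on (sphere 0 1) (\<lambda>q. g (quat_to_STS2 q))"
  show "smooth_on STS g"
  proof (rule smooth_on_local)
    fix w0 assume "w0 \<in> STS"
    then obtain q0 where q0: "norm q0 = 1" "quat_to_STS2 q0 = w0" by (rule quat_to_STS2_surj)
    obtain \<mu> \<nu> where mn: "q0 = (\<mu>, \<nu>)" by (cases q0)
    define S where "S w = \<mu>\<^sup>2 * spin_aa w + 2 * \<mu> * \<nu> * spin_ab w + \<nu>\<^sup>2 * spin_bb w" for w
    define U where "U = {w. Re (S w) > 0}"
    \<comment> \<open>\<open>rsqrt (S w)\<close> is \<ell> or - \<ell>, so this is the inverse of
      \<ell> up to sign. The sign is not controlled and need not be, because opposite quaternions
      have the same image.\<close>
    define \<kappa> where "\<kappa> w = inverse (norm (S w)) *\<^sub>R cnj (rsqrt (S w))" for w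
    define \<sigma> where "\<sigma> w = (cnj ((\<mu> * spin_aa w + \<nu> * spin_ab w) * \<kappa> w), cnj ((\<mu> * spin_ab w + \<nu> * spin_bb w) * \<kappa> w))" for w
    have smspin: "smooth_on T spin_aa" "smooth_on T spin_bb" "smooth_on T spin_ab" for T
    proof -
      have e: "spin_aa w = (1 / 2) *\<^sub>R (zcomp (axis 3 1) w - \<i> * zcomp (axis 2 1) w)"
        "spin_bb w = (1 / 2) *\<^sub>R (- (zcomp (axis 3 1) w + \<i> * zcomp (axis 2 1) w))"
        "spin_ab w = (1 / 2) *\<^sub>R (- zcomp (axis 1 1) w)" for w
        by (simp_all add: spin_aa_def spin_bb_def spin_ab_def complex_eq_iff)
      show "smooth_on T spin_aa" "smooth_on T spin_bb" "smooth_on T spin_ab"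
        unfolding e[abs_def] by (intro smooth_intros smooth_on_zcomp)+
    qed
    have smS: "smooth_on T S" for T
      unfolding S_def by (intro smooth_intros smspin)
    have "continuous_on UNIV S" by (rule smooth_on_imp_continuous_on[OF smS])
    then have "open U" unfolding U_def by (intro open_Collect_less continuous_intros)
    have sect: "norm (\<sigma> w) = 1 \<and> quat_to_STS2 (\<sigma> w) = w" if w: "w \<in> STS" "w \<in> U" for w
    proof -
      obtain q where q: "norm q = 1" "quat_to_STS2 q = w" using quat_to_STS2_surj[OF w(1)] .
      define \<alpha> \<beta> where "\<alpha> = cnj (fst q)" "\<beta> = cnj (snd q)"
      have ab: "spin_aa w = \<alpha>\<^sup>2" "spin_bb w = \<beta>\<^sup>2" "spin_ab w = \<alpha> * \<beta>"
        using quat_to_STS2_eq_iff[OF q(1), of w] q(2) by (auto simp: \<alpha>_\<beta>_def)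
      define l where "l = \<mu> * \<alpha> + \<nu> * \<beta>"
      have S: "S w = l\<^sup>2" by (simp add: S_def ab l_def power2_eq_square algebra_simps)
      have "(rsqrt (S w))\<^sup>2 = l\<^sup>2" using w(2) S by (simp add: U_def rsqrt_square)
      then have "rsqrt (S w) = l \<or> rsqrt (S w) = - l" by (simp add: power2_eq_iff)
      moreover have "l * (inverse (norm (l\<^sup>2)) *\<^sub>R cnj l) = 1"
      proof -
        have "l \<noteq> 0" using w(2) S by (auto simp: U_def)
        have "l * (inverse (norm (l\<^sup>2)) *\<^sub>R cnj l) = inverse ((norm l)\<^sup>2) *\<^sub>R (l * cnj l)"
          by (simp add: norm_power)
        also have "\<dots> = 1"
          using \<open>l \<noteq> 0\<close> by (simp only: complex_norm_square[symmetric]) (simp add: scaleR_conv_of_real)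
        finally show ?thesis .
      qed
      ultimately have "l * \<kappa> w = 1 \<or> l * \<kappa> w = - 1" by (auto simp: \<kappa>_def S)
      moreover have "\<sigma> w = (cnj (\<alpha> * (l * \<kappa> w)), cnj (\<beta> * (l * \<kappa> w)))"
        by (simp add: \<sigma>_def ab l_def power2_eq_square algebra_simps)
      ultimately have "\<sigma> w = (cnj \<alpha>, cnj \<beta>) \<or> \<sigma> w = (- cnj \<alpha>, - cnj \<beta>)" by (elim disjE) simp_all
      then have "\<sigma> w = q \<or> \<sigma> w = - q" by (auto simp: \<alpha>_\<beta>_def prod_eq_iff)
      moreover have "quat_to_STS2 (- q) = quat_to_STS2 q"
        using q(1) quat_to_STS2_eq_iff[of "- q" "quat_to_STS2 q"] quat_to_STS2_eq_iff[of q "quat_to_STS2 q"] by simp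
      ultimately show ?thesis using q by auto
    qed
    have "smooth_on (STS \<inter> U) (\<lambda>w. g (quat_to_STS2 (\<sigma> w)))"
    proof (rule smooth_on_compose[OF g])
      have "S w \<noteq> 0" "norm (S w) \<noteq> 0" if "w \<in> U" for w using that by (auto simp: U_def)
      then show "smooth_on (STS \<inter> U) \<sigma>"
        unfolding \<sigma>_def \<kappa>_def by (intro smooth_intros smspin smS smooth_on_rsqrt) (auto simp: U_def)
    qed (use sect in auto)
    then have "smooth_on (STS \<inter> U) g" by (rule smooth_on_cong) (use sect in auto)
    moreover have "w0 \<in> U"
    proof -
      have "S w0 = (\<mu> * cnj \<mu> + \<nu> * cnj \<nu>)\<^sup>2"
        using quat_to_STS2_eq_iff[OF q0(1), of w0] q0(2) by (simp add: S_def mn power2_eq_square algebra_simps)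
      moreover have "\<mu> * cnj \<mu> + \<nu> * cnj \<nu> = 1"
        using q0(1) unfolding norm_pair_eq_1 mn fst_conv snd_conv complex_norm_square[symmetric] 
        by (metis of_real_1 of_real_add of_real_power)
      ultimately show ?thesis by (simp add: U_def)
    qed
    ultimately show "\<exists>U. open U \<and> w0 \<in> U \<and> smooth_on (STS \<inter> U) g" using \<open>open U\<close> by blast
  qed
qed

declare STS_iff [simp del]

section \<open>Differentials of maps between function-algebra manifolds\<close>

lemma differential_velocity:
  assumes "\<And>f. f \<in> funs Z \<Longrightarrow> f \<circ> \<Phi> \<in> funs X"
  shows "differential Z \<Phi> (velocity X \<beta>) = velocity Z (\<Phi> \<circ> \<beta>)"
  using assms by (auto simp: differential_def velocity_def fun_eq_iff o_assoc)

lemma smooth_curve_map: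
  assumes "\<And>f. f \<in> funs Z \<Longrightarrow> f \<circ> \<Phi> \<in> funs X" "\<Phi> ` pts X \<subseteq> pts Z" "smooth_curve X \<beta>"
  shows "smooth_curve Z (\<Phi> \<circ> \<beta>)"
  using assms unfolding smooth_curve_def o_assoc by fastforce

text \<open>For \<open>f\<close> smooth on the source, \<open>f \<circ> \<Phi>\<^sup>-\<^sup>1\<close> is smooth on the target, so the differential determines
  the derivation.\<close>

lemma differential_diffeo_inj:
  assumes X: "\<And>f g. f \<in> funs X \<Longrightarrow> (\<And>p. p \<in> pts X \<Longrightarrow> f p = g p) \<Longrightarrow> g \<in> funs X"
    and \<Phi>: "diffeo X Z \<Phi>" and \<beta>: "range \<beta> \<subseteq> pts X" and \<gamma>: "range \<gamma> \<subseteq> pts X"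
    and eq: "differential Z \<Phi> (velocity X \<beta>) = differential Z \<Phi> (velocity X \<gamma>)"
  shows "velocity X \<beta> = velocity X \<gamma>"
proof
  fix f
  show "velocity X \<beta> f = velocity X \<gamma> f"
  proof (cases "f \<in> funs X")
    case True
    define g where "g = f \<circ> the_inv_into (pts X) \<Phi>"
    have inj: "inj_on \<Phi> (pts X)" using \<Phi> by (simp add: diffeo_def bij_betw_def)
    have g: "(g \<circ> \<Phi>) p = f p" if "p \<in> pts X" for p
      using that by (simp add: g_def the_inv_into_f_f[OF inj])
    then have "g \<circ> \<Phi> \<in> funs X" using X[OF True] by metis
    then have gZ: "g \<in> funs Z" "g \<circ> \<Phi> \<in> funs X" using \<Phi> by (auto simp: diffeo_def)
    have "velocity X \<delta> f = differential Z \<Phi> (velocity X \<delta>) g" if "range \<delta> \<subseteq> pts X" for \<delta>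
    proof -
      have "\<delta> t \<in> pts X" for t using that by blast
      then have "f \<circ> \<delta> = g \<circ> \<Phi> \<circ> \<delta>" using g by (simp add: fun_eq_iff)
      then show ?thesis using gZ True by (simp add: differential_def velocity_def)
    qed
    then show ?thesis using \<beta> \<gamma> eq by simp
  qed (simp add: velocity_def)
qed

context coprime_pair
begin

lemma funs_null_pullback: "f \<in> funs N \<Longrightarrow> f \<circ> Q \<in> funs STS2"
  by (simp add: funs_null_space)

lemma differential_Q_velocity: "differential N Q (velocity STS2 \<beta>) = velocity N (Q \<circ> \<beta>)"
  by (rule differential_velocity[OF funs_null_pullback])

lemma canonical_contact_image:
  assumes w: "w \<in> STS"
  shows "canonical_contact (S2xS1 c d) (Q w) = differential N Q ` chi_contact w"
proof -
  have "differential N Q (embedded_vector STS w (a *\<^sub>R nvec w, b *\<^sub>R nvec w)) =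
      null_vector w (a *\<^sub>R nvec w, b *\<^sub>R nvec w)" for a b
    using differential_Q_velocity[of "frame_curve w a b"]
      velocity_null[OF frame_curve(1,2,4,3)[OF w]] velocity_embedded[OF frame_curve(1,2,4,3)[OF w]]
    by (simp add: STS2_eq)
  then show ?thesis unfolding canonical_contact_eq[OF w] chi_contact_eq[OF w] by (auto simp: image_iff) metis
qed

section \<open>Identification with the lens space\<close>

lemma orbit_to_null_eq: "orbit_to_null c d (Zc_orbit c w) = Q w"
  unfolding orbit_to_null_def
proof (rule the_equality)
  show "Q w \<in> Q ` Zc_orbit c w" by (rule imageI[OF Zc_orbit_self])
  show "\<Gamma> = Q w" if "\<Gamma> \<in> Q ` Zc_orbit c w" for \<Gamma> using that by (elim imageE) (simp add: to_null_Zc_orbit)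
qed

abbreviation "orb \<equiv> lens_orbit (2 * c)"
abbreviation "L \<equiv> lens_space (2 * c)"
abbreviation "r \<equiv> r_proj c"
abbreviation "\<Psi> \<equiv> lens_to_null c d"

lemma orb_eq: "orb q = range (\<lambda>j::int. (cis (pi * of_int j / real c) * fst q, cis (pi * of_int j / real c) * snd q))"
  by (cases q) (simp add: lens_orbit_def)

lemma pts_L: "pts L = orb ` sphere 0 1" and funs_L: "f \<in> funs L \<longleftrightarrow> smooth_on (sphere 0 1) (f \<circ> orb)"
  by (simp_all add: lens_space_def quotient_space_def)

lemma quat_orbit:
  assumes "norm q = 1"
  shows "lens_to_STS2_mod (orb q) = Zc_orbit c (quat_to_STS2 q)"
  unfolding lens_to_STS2_mod_def orb_eq Zc_orbit_def image_image
  using quat_to_STS2_rot[OF assms] by (simp add: mult.assoc)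

lemma orb_eqI:
  assumes "q' = (cis (pi * of_int k / real c) * fst q, cis (pi * of_int k / real c) * snd q)"
  shows "orb q' = orb q"
proof -
  have *: "pi * of_int j / real c + pi * of_int k / real c = pi * of_int (j + k) / real c" for j
    by (simp add: add_divide_distrib distrib_left)
  have "orb q' = range (\<lambda>j::int. (cis (pi * of_int (j + k) / real c) * fst q, cis (pi * of_int (j + k) / real c) * snd q))"
    unfolding orb_eq assms fst_conv snd_conv mult.assoc[symmetric] cis_mult * ..
  also have "\<dots> = orb q"
    unfolding orb_eq
    by (rule range_shift[of "\<lambda>j. (cis (pi * of_int j / real c) * fst q, cis (pi * of_int j / real c) * snd q)"])
  finally show ?thesis .
qed

text \<open>The element c of Z_2c acts by cis pi = - 1, so the two-to-one ambiguity of the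
  quaternion map lies inside each lens orbit.\<close>

lemma orb_uminus: "orb (- q) = orb q"
  by (rule orb_eqI[of _ "int c"]) (simp add: cis_pi prod_eq_iff)

text \<open>A rotation by 2 pi j / c lifts to multiplication of q by the phase of pi j / c. The lift
  has the same image as q', hence equals q' up to sign, and the sign is absorbed by
  \<open>orb_uminus\<close>.\<close>

lemma lens_to_STS2_mod_inj:
  assumes "norm q = 1" "norm q' = 1" "Zc_orbit c (quat_to_STS2 q') = Zc_orbit c (quat_to_STS2 q)"
  shows "orb q' = orb q"
proof -
  have "quat_to_STS2 q' \<in> Zc_orbit c (quat_to_STS2 q)" using Zc_orbit_self assms(3) by blast
  then obtain j :: int where j: "quat_to_STS2 q' = rot (2 * pi * of_int j / real c) (quat_to_STS2 q)"
    unfolding Zc_orbit_def by blast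
  let ?q = "(cis (pi * of_int j / real c) * fst q, cis (pi * of_int j / real c) * snd q)"
  have n: "norm ?q = 1" using assms(1) by (simp add: norm_pair_eq_1 norm_mult)
  have "quat_to_STS2 ?q = quat_to_STS2 q'" unfolding j quat_to_STS2_rot[OF assms(1)] by (simp add: mult.assoc)
  then have "q' = ?q \<or> q' = - ?q" by (rule quat_to_STS2_eqD[OF n assms(2)])
  then show ?thesis using orb_eqI[of ?q j q] orb_uminus[of ?q] by auto
qed

lemma bij_lens_to_STS2_mod: "bij_betw lens_to_STS2_mod (pts L) (pts (STS2_mod c))"
proof -
  have "inj_on lens_to_STS2_mod (pts L)"
  proof (rule inj_onI)
    fix l l' assume l: "l \<in> pts L" "l' \<in> pts L" "lens_to_STS2_mod l = lens_to_STS2_mod l'"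
    then obtain q q' where q: "norm q = 1" "l = orb q" "norm q' = 1" "l' = orb q'" by (auto simp: pts_L)
    then show "l = l'" using l(3) quat_orbit lens_to_STS2_mod_inj[OF q(3,1)] by simp
  qed
  moreover have "lens_to_STS2_mod ` pts L = pts (STS2_mod c)"
  proof -
    have "lens_to_STS2_mod ` pts L = (\<lambda>q. Zc_orbit c (quat_to_STS2 q)) ` sphere 0 1"
      unfolding pts_L image_image by (intro image_cong refl quat_orbit) simp
    also have "\<dots> = Zc_orbit c ` quat_to_STS2 ` sphere 0 1" by (simp add: image_image)
    also have "quat_to_STS2 ` sphere 0 1 = STS"
    proof (intro equalityI subsetI)
      fix w assume "w \<in> quat_to_STS2 ` sphere 0 1"
      then obtain q where "norm q = 1" "w = quat_to_STS2 q" by (elim imageE) simp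
      then show "w \<in> STS" by (simp only: quat_to_STS2_in_STS)
    next
      fix w assume "w \<in> STS"
      then obtain q where "norm q = 1" "quat_to_STS2 q = w" by (rule quat_to_STS2_surj)
      then show "w \<in> quat_to_STS2 ` sphere 0 1" by (intro image_eqI[of _ _ q]) auto
    qed
    finally show ?thesis by (simp add: STS2_mod_def quotient_space_def)
  qed
  ultimately show ?thesis by (simp add: bij_betw_def)
qed

text \<open>\<open>quat_to_STS2_descent\<close> pulls smoothness on STS^2 back to the 3-sphere,
  where both algebras impose the same condition on the same function.\<close>

lemma diffeo_lens_STS2_mod: "diffeo L (STS2_mod c) lens_to_STS2_mod"
proof -
  have "f \<in> funs (STS2_mod c) \<longleftrightarrow> f \<circ> lens_to_STS2_mod \<in> funs L" for f
  proof -
    have "f \<in> funs (STS2_mod c) \<longleftrightarrow> smooth_on STS (f \<circ> Zc_orbit c)"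
      by (simp add: STS2_mod_def quotient_space_def)
    also have "\<dots> \<longleftrightarrow> smooth_on (sphere 0 1) (\<lambda>q. (f \<circ> Zc_orbit c) (quat_to_STS2 q))"
      by (rule quat_to_STS2_descent[symmetric])
    also have "\<dots> \<longleftrightarrow> smooth_on (sphere 0 1) (f \<circ> lens_to_STS2_mod \<circ> orb)"
      by (intro iffI; erule smooth_on_cong) (simp_all add: quat_orbit)
    finally show ?thesis by (simp add: funs_L)
  qed
  then show ?thesis using bij_lens_to_STS2_mod by (simp add: diffeo_def)
qed

lemma lens_to_null_orb:
  assumes "norm q = 1"
  shows "\<Psi> (orb q) = Q (quat_to_STS2 q)"
  by (simp add: lens_to_null_def quat_orbit[OF assms] orbit_to_null_eq quat_to_STS2_in_STS[OF assms])

text \<open>Bijectivity is composed from the two stages, but smoothness is tested on the 3-sphere in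
  one step, since \<Psi> sends the orbit of q to \<open>Q (quat_to_STS2 q)\<close>.\<close>

lemma diffeo_lens_null: "diffeo L N \<Psi>"
proof -
  have "bij_betw (orbit_to_null c d) (pts (STS2_mod c)) (pts N)"
  proof -
    have "inj_on (orbit_to_null c d) (Zc_orbit c ` STS)"
    proof (rule inj_onI)
      fix l l' assume l: "l \<in> Zc_orbit c ` STS" "l' \<in> Zc_orbit c ` STS" "orbit_to_null c d l = orbit_to_null c d l'"
      then obtain w w' where w: "w \<in> STS" "l = Zc_orbit c w" "w' \<in> STS" "l' = Zc_orbit c w'" by blast
      then have "Q w = Q w'" using l(3) orbit_to_null_eq by simp
      then show "l = l'" using w to_null_eq_iff[OF w(3,1)] Zc_orbit_eqI by simp
    qed
    moreover have "orbit_to_null c d ` Zc_orbit c ` STS = Q ` STS"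
      unfolding image_image by (intro image_cong refl orbit_to_null_eq)
    ultimately show ?thesis by (simp add: bij_betw_def STS2_mod_def quotient_space_def pts_null_space)
  qed
  then have "bij_betw \<Psi> (pts L) (pts N)"
    unfolding lens_to_null_def by (rule bij_betw_trans[OF bij_lens_to_STS2_mod])
  moreover have "f \<in> funs N \<longleftrightarrow> f \<circ> \<Psi> \<in> funs L" for f
  proof -
    have "f \<in> funs N \<longleftrightarrow> smooth_on (sphere 0 1) (\<lambda>q. (f \<circ> Q) (quat_to_STS2 q))"
      unfolding funs_null_space by (rule quat_to_STS2_descent[symmetric])
    also have "\<dots> \<longleftrightarrow> smooth_on (sphere 0 1) (f \<circ> \<Psi> \<circ> orb)"
      by (intro iffI; erule smooth_on_cong) (simp_all add: lens_to_null_orb)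
    finally show ?thesis by (simp add: funs_L)
  qed
  ultimately show ?thesis by (simp add: diffeo_def)
qed

lemma r_quat:
  assumes "norm q = 1"
  shows "r (quat_to_STS2 q) = orb q"
proof -
  have "orb q \<in> pts L" using assms by (simp add: pts_L)
  then show ?thesis
    unfolding r_proj_def quat_orbit[OF assms, symmetric]
    using bij_lens_to_STS2_mod by (simp add: bij_betw_def the_inv_into_f_f)
qed

lemma r_in_L: "w \<in> STS \<Longrightarrow> r w \<in> pts L" and \<Psi>_r: "w \<in> STS \<Longrightarrow> \<Psi> (r w) = Q w"
proof -
  assume "w \<in> STS"
  then obtain q where q: "norm q = 1" "quat_to_STS2 q = w" by (rule quat_to_STS2_surj)
  then show "r w \<in> pts L" "\<Psi> (r w) = Q w" using r_quat[OF q(1)] lens_to_null_orb[OF q(1)] by (auto simp: pts_L)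
qed

lemma r_surj: "l \<in> pts L \<Longrightarrow> \<exists>w\<in>STS. r w = l"
proof -
  assume "l \<in> pts L"
  then obtain q where q: "norm q = 1" "l = orb q" by (auto simp: pts_L)
  then show ?thesis using r_quat quat_to_STS2_in_STS by blast
qed

text \<open>By descent, smoothness can be checked after composition with the quaternion map, where
  \<open>r\<close> becomes the plain orbit projection.\<close>

lemma funs_L_pullback:
  assumes "f \<in> funs L"
  shows "f \<circ> r \<in> funs STS2"
proof -
  have "smooth_on (sphere 0 1) (\<lambda>q. (f \<circ> r) (quat_to_STS2 q))"
    by (rule smooth_on_cong[OF assms[unfolded funs_L]]) (simp add: r_quat)
  then show ?thesis unfolding quat_to_STS2_descent by simp
qed

lemma funs_L_cong: "f \<in> funs L \<Longrightarrow> (\<And>p. p \<in> pts L \<Longrightarrow> f p = g p) \<Longrightarrow> g \<in> funs L"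
  unfolding funs_L by (erule smooth_on_cong) (simp add: pts_L)

section \<open>Pull-back and push-forward of the contact structures\<close>

lemma chi_contact_velocity:
  assumes "D \<in> chi_contact w"
  obtains \<beta> where "D = velocity STS2 \<beta>" "smooth_curve STS2 \<beta>" "range \<beta> \<subseteq> STS" "\<beta> 0 = w"
  using assms by (auto simp: chi_contact_def tangent_space_def)

lemma smooth_curve_r: "smooth_curve STS2 \<beta> \<Longrightarrow> smooth_curve L (r \<circ> \<beta>)"
  by (rule smooth_curve_map[OF funs_L_pullback]) (auto simp: r_in_L)

lemma differential_r_velocity: "differential L r (velocity STS2 \<beta>) = velocity L (r \<circ> \<beta>)"
  by (rule differential_velocity[OF funs_L_pullback])

lemma differential_\<Psi>_velocity: "differential N \<Psi> (velocity L \<beta>) = velocity N (\<Psi> \<circ> \<beta>)"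
  by (rule differential_velocity) (use diffeo_lens_null in \<open>simp add: diffeo_def\<close>)

lemma differential_Q_eq:
  assumes "range \<beta> \<subseteq> STS"
  shows "differential N \<Psi> (differential L r (velocity STS2 \<beta>)) = differential N Q (velocity STS2 \<beta>)"
proof -
  have "\<beta> t \<in> STS" for t using assms by blast
  then have "\<Psi> \<circ> (r \<circ> \<beta>) = Q \<circ> \<beta>" by (simp add: fun_eq_iff \<Psi>_r)
  then show ?thesis
    by (simp only: differential_r_velocity differential_\<Psi>_velocity differential_Q_velocity)
qed

text \<open>As \<Psi> o r = Q, the differential of \<Psi> carries the push-forward of \<chi> by r to
  the canonical structure, and it is injective. The result holds for every w over the given
  point.\<close>

lemma pullback_lens:
  assumes w: "w \<in> STS"
  shows "pullback_distribution L N \<Psi> (canonical_contact (S2xS1 c d)) (r w) = differential L r ` chi_contact w"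
proof (intro equalityI subsetI)
  fix D assume "D \<in> pullback_distribution L N \<Psi> (canonical_contact (S2xS1 c d)) (r w)"
  then have "D \<in> tangent_space L (pts L) (r w)" "differential N \<Psi> D \<in> differential N Q ` chi_contact w"
    using canonical_contact_image[OF w] by (auto simp: pullback_distribution_def \<Psi>_r[OF w])
  then obtain \<gamma> D' where \<gamma>: "D = velocity L \<gamma>" "range \<gamma> \<subseteq> pts L"
    and D': "D' \<in> chi_contact w" "differential N \<Psi> D = differential N Q D'"
    by (auto simp: tangent_space_def)
  obtain \<beta> where \<beta>: "D' = velocity STS2 \<beta>" "range \<beta> \<subseteq> STS" using chi_contact_velocity[OF D'(1)] by metis
  \<comment> \<open>No lift of \<gamma> through \<open>r\<close> is at hand; instead both velocities
    are compared after applying the differential of the diffeomorphism.\<close>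
  have "velocity L \<gamma> = velocity L (r \<circ> \<beta>)"
  proof (rule differential_diffeo_inj[OF funs_L_cong diffeo_lens_null \<gamma>(2)])
    show "range (r \<circ> \<beta>) \<subseteq> pts L"
    proof -
      have "r (\<beta> t) \<in> pts L" for t using \<beta>(2) by (intro r_in_L) blast
      then show ?thesis by (simp add: image_subset_iff)
    qed
    show "differential N \<Psi> (velocity L \<gamma>) = differential N \<Psi> (velocity L (r \<circ> \<beta>))"
      using D'(2) differential_Q_eq[OF \<beta>(2)] by (simp add: \<gamma>(1) \<beta>(1) differential_r_velocity)
  qed
  then have "D = differential L r D'" by (simp add: \<gamma>(1) \<beta>(1) differential_r_velocity)
  then show "D \<in> differential L r ` chi_contact w" using D'(1) by blast
next
  fix D assume "D \<in> differential L r ` chi_contact w"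
  then obtain D' where D': "D' \<in> chi_contact w" "D = differential L r D'" by blast
  obtain \<beta> where \<beta>: "D' = velocity STS2 \<beta>" "smooth_curve STS2 \<beta>" "range \<beta> \<subseteq> STS" "\<beta> 0 = w"
    using chi_contact_velocity[OF D'(1)] .
  have "D = velocity L (r \<circ> \<beta>)" using D' \<beta> by (simp add: differential_r_velocity)
  moreover have "smooth_curve L (r \<circ> \<beta>)" by (rule smooth_curve_r[OF \<beta>(2)])
  ultimately have "D \<in> tangent_space L (pts L) (r w)"
    unfolding tangent_space_def using \<beta>(4) by (auto simp: smooth_curve_def intro!: exI[of _ "r \<circ> \<beta>"])
  moreover have "differential N \<Psi> D = differential N Q D'" using differential_Q_eq[OF \<beta>(3)] D' \<beta>(1) by simp
  ultimately show "D \<in> pullback_distribution L N \<Psi> (canonical_contact (S2xS1 c d)) (r w)"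
    unfolding pullback_distribution_def \<Psi>_r[OF w] canonical_contact_image[OF w] using D'(1) by auto
qed

text \<open>The pull-back is attached to the point l alone, so \<open>pullback_lens\<close> shows
  that all preimages w of l give the same image of \<chi>. This is the uniqueness behind the
  definite description in the push-forward.\<close>

lemma pullback_eq_pushforward:
  assumes "l \<in> pts L"
  shows "pullback_distribution L N \<Psi> (canonical_contact (S2xS1 c d)) l =
    pushforward_distribution STS2 L r chi_contact l"
proof -
  have "pushforward_distribution STS2 L r chi_contact l =
      pullback_distribution L N \<Psi> (canonical_contact (S2xS1 c d)) l"
    unfolding pushforward_distribution_def
  proof (rule the_equality)
    obtain w where w: "w \<in> STS" "r w = l" using r_surj[OF assms] by blast
    then show "\<exists>p\<in>pts STS2. r p = l \<and>
        pullback_distribution L N \<Psi> (canonical_contact (S2xS1 c d)) l = differential L r ` chi_contact p"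
      using pullback_lens[OF w(1)] by (intro bexI[of _ w]) simp_all
  next
    fix E assume "\<exists>p\<in>pts STS2. r p = l \<and> E = differential L r ` chi_contact p"
    then obtain w where w: "w \<in> STS" "r w = l" "E = differential L r ` chi_contact w" by (auto simp del: split_paired_Ex)
    then show "E = pullback_distribution L N \<Psi> (canonical_contact (S2xS1 c d)) l"
      using pullback_lens[OF w(1)] by simp
  qed
  then show ?thesis ..
qed

text \<open>Injectivity of the differential of \<open>Q\<close>, from
  \<open>velocity_null_inj\<close>, identifies a derivation whose image lies in the image of \<chi>
  with an element of \<chi>.\<close>

lemma pullback_STS2:
  assumes w: "w \<in> STS"
  shows "pullback_distribution STS2 N Q (canonical_contact (S2xS1 c d)) w = chi_contact w"
proof (intro equalityI subsetI)
  fix D assume "D \<in> pullback_distribution STS2 N Q (canonical_contact (S2xS1 c d)) w"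
  then have "D \<in> tangent_space STS2 STS w" "differential N Q D \<in> differential N Q ` chi_contact w"
    by (auto simp: pullback_distribution_def canonical_contact_image[OF w])
  then obtain \<gamma> D' where \<gamma>: "D = velocity STS2 \<gamma>" "smooth_curve STS2 \<gamma>" "\<gamma> 0 = w"
    and D': "D' \<in> chi_contact w" "differential N Q D = differential N Q D'"
    by (auto simp: tangent_space_def)
  obtain \<beta> where \<beta>: "D' = velocity STS2 \<beta>" "smooth_curve STS2 \<beta>" "\<beta> 0 = w"
    using chi_contact_velocity[OF D'(1)] by metis
  have cv: "range \<gamma> \<subseteq> STS" "smooth_on UNIV \<gamma>" "range \<beta> \<subseteq> STS" "smooth_on UNIV \<beta>"
    using \<gamma>(2) \<beta>(2) by (auto simp: STS2_eq smooth_curve_embedded)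
  note vg = smooth_curve_has_vector_derivative[OF cv(2), of 0] and vb = smooth_curve_has_vector_derivative[OF cv(4), of 0]
  have "velocity N (Q \<circ> \<gamma>) = velocity N (Q \<circ> \<beta>)"
    using D'(2) unfolding \<gamma>(1) \<beta>(1) differential_Q_velocity .
  from velocity_null_inj[OF cv(1) \<gamma>(3) vg cv(3) \<beta>(3) vb this]
  have "D = D'"
    unfolding \<gamma>(1) \<beta>(1) STS2_eq velocity_embedded[OF cv(1) \<gamma>(3) vg cv(2)] velocity_embedded[OF cv(3) \<beta>(3) vb cv(4)] by simp
  then show "D \<in> chi_contact w" using D'(1) by simp
next
  fix D assume "D \<in> chi_contact w"
  then show "D \<in> pullback_distribution STS2 N Q (canonical_contact (S2xS1 c d)) w"
    by (auto simp: pullback_distribution_def canonical_contact_image[OF w] chi_contact_def)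
qed

lemma diffeo_STS2_null:
  assumes "c = 1"
  shows "diffeo STS2 N Q"
proof -
  have "Zc_orbit c w = {w}" for w
    unfolding Zc_orbit_def using rot_2pi_int[of 0] assms by auto
  then have "inj_on Q STS" unfolding inj_on_def using to_null_eq_iff by blast
  then show ?thesis by (simp add: diffeo_def bij_betw_def pts_null_space funs_null_space)
qed

end

theorem theorem3p14:
  fixes c d :: nat
  assumes "c \<ge> 1" and "d \<ge> 1" and "gcd c d = 1"
  shows
    "(c = 1 \<longrightarrow>
        diffeo STS2 (null_space (S2xS1 c d)) (to_null c d) \<and>
        (\<forall>w\<in>pts STS2.
           pullback_distribution STS2 (null_space (S2xS1 c d)) (to_null c d)
             (canonical_contact (S2xS1 c d)) w = chi_contact w)) \<and>
     (c > 1 \<longrightarrow>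
        diffeo (lens_space (2 * c)) (STS2_mod c) lens_to_STS2_mod \<and>
        diffeo (lens_space (2 * c)) (null_space (S2xS1 c d)) (lens_to_null c d) \<and>
        (\<forall>l\<in>pts (lens_space (2 * c)).
           pullback_distribution (lens_space (2 * c)) (null_space (S2xS1 c d)) (lens_to_null c d)
             (canonical_contact (S2xS1 c d)) l =
           pushforward_distribution STS2 (lens_space (2 * c)) (r_proj c) chi_contact l))"
proof -
  interpret coprime_pair c d by unfold_locales (use assms in auto)
  show ?thesis
    using diffeo_STS2_null pullback_STS2 diffeo_lens_STS2_mod diffeo_lens_null pullback_eq_pushforward
    unfolding pts_STS2 by blast
qed

end
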